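(* Let $T>0$ and let $X=\{X(t)\}_{t\ge0}$ be the generalized fractional Brownian motion with parameters $\gamma\in[0,1)$ and $\alpha\in\big(-\tfrac12+\tfrac{\gamma}{2},\,\tfrac12+\tfrac{\gamma}{2}\big)$, with covariance function $\Psi(s,t)=E[X(s)X(t)]$ and $H=\alpha-\gamma/2+1/2$. Let $K$ be the unit ball of the reproducing kernel Hilbert space $\mathcal{H}(\Psi)$ with kernel $\Psi$ on $[0,T]$. Then the sequence of random functions $t\mapsto \dfrac{X(nt)}{(2n^{2H}\log\log n)^{1/2}}$, $t\in[0,T]$, $n\ge 3$, satisfies $$\lim_{n\to\infty}d\left(\frac{X(n\,\cdot)}{(2n^{2H}\log\log n)^{1/2}},\,K\right)=0\quad\text{a.s.}$$ and $$\mathbb{C}\left\{\frac{X(n\,\cdot)}{(2n^{2H}\log\log n)^{1/2}}\right\}=K\quad\text{a.s.}$$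
   Context: Let $B(\mathrm{d}u)$ be a Gaussian random measure on $\mathbb{R}$ with Lebesgue control measure $\mathrm{d}u$ (equivalently, the white noise of a two-sided standard Brownian motion $B$). For $\gamma\in[0,1)$ and $\alpha\in(-\frac12+\frac{\gamma}{2},\frac12+\frac{\gamma}{2})$, the generalized fractional Brownian motion (GFBM) is the mean-zero Gaussian process with continuous sample paths given (in distribution, as a process) by $$X(t)= c\int_{\mathbb{R}}\big((t-u)_+^{\alpha}-(-u)_+^{\alpha}\big)\,|u|^{-\gamma/2}\,B(\mathrm{d}u),\qquad t\ge 0,$$ where $x_+^{\alpha}=x^{\alpha}$ if $x>0$ and $x_+^{\alpha}=0$ otherwise, and $c=c(\alpha,\gamma)>0$ is the normalization constant for which $\mathrm{Var}(X(t))=t^{2H}$ for all $t\ge0$, that is, $c^{-2}=\int_0^1(1-v)^{2\alpha}v^{-\gamma}\,\mathrm{d}v+\int_0^\infty[(1+v)^{\alpha}-v^{\alpha}]^2v^{-\gamma}\,\mathrm{d}v$. Its covariance function is $$\Psi(s,t)=c^2\int_0^s(t-u)^{\alpha}(s-u)^{\alpha}u^{-\gamma}\,\mathrm{d}u+c^2\int_0^\infty((t+u)^{\alpha}-u^{\alpha})((s+u)^{\alpha}-u^{\alpha})u^{-\gamma}\,\mathrm{d}u,\quad 0\le s\le t,$$ extended symmetrically. The reproducing kernel Hilbert space $\mathcal{H}(\Psi)$ is the completion of the vector space spanned by the functions $\Psi(s,\cdot)$, $s\in[0,T]$, on $[0,T]$, with the scalar product $\big\langle\sum_i c_i\Psi(s_i,\cdot),\sum_j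 c'_j\Psi(s'_j,\cdot)\big\rangle=\sum_i\sum_j c_ic'_j\Psi(s_i,s'_j)$. Its unit ball is $K=\{h\in\mathcal{H}(\Psi):\langle h,h\rangle^{1/2}\le1\}$, regarded as a subset of the space $\mathbb{C}[0,T]$ of continuous functions on $[0,T]$. $d(\cdot,\cdot)$ is the sup-norm distance on $\mathbb{C}[0,T]$ and $d(z,K)=\inf_{h\in K}d(z,h)$. For a sequence $\{z_n\}$ in $\mathbb{C}[0,T]$, $\mathbb{C}\{z_n\}$ denotes its cluster set, i.e. the set of its limit points (limits of subsequences) with respect to $d$. *)

theory Defs
  imports "HOL-Probability.Probability"
begin

section \<open>Gaussian random measures and the Wiener integral\<close>

text \<open>
  An independently scattered, almost surely countably additive random set function \<open>B\<close> on the Borel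
  sets of finite Lebesgue measure, with \<open>B A\<close> centred Gaussian of variance \<open>|A|\<close>.  Null sets are
  treated separately because \<^const>\<open>normal_density\<close> does not describe the degenerate law.  Finite
  families of disjoint sets are covered by padding with empty sets.
\<close>

definition gaussian_random_measure :: "'b measure \<Rightarrow> (real set \<Rightarrow> 'b \<Rightarrow> real) \<Rightarrow> bool" where
  "gaussian_random_measure N B \<longleftrightarrow>
     prob_space N \<and>
     (\<forall>A \<in> fmeasurable lborel.
        B A \<in> borel_measurable N \<and>
        (if measure lborel A = 0 then AE \<omega> in N. B A \<omega> = 0
         else distributed N lborel (B A) (normal_density 0 (sqrt (measure lborel A))))) \<and>
     (\<forall>A :: nat \<Rightarrow> real set. range A \<subseteq> fmeasurable lborel \<longrightarrow> disjoint_family A \<longrightarrow>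
        prob_space.indep_vars N (\<lambda>_. borel) (\<lambda>i. B (A i)) UNIV) \<and>
     (\<forall>A :: nat \<Rightarrow> real set. range A \<subseteq> fmeasurable lborel \<longrightarrow> disjoint_family A \<longrightarrow>
        (\<Union>i. A i) \<in> fmeasurable lborel \<longrightarrow>
        (AE \<omega> in N. (\<lambda>i. B (A i) \<omega>) sums B (\<Union>i. A i) \<omega>))"

text \<open>A list of pairs \<open>(a, A)\<close> represents the simple function \<open>\<Sum> a * indicator A\<close>.\<close>

definition simple_fun :: "(real \<times> real set) list \<Rightarrow> real \<Rightarrow> real" where
  "simple_fun p u = (\<Sum>(a, A) \<leftarrow> p. a * indicator A u)"

definition simple_wiener :: "(real set \<Rightarrow> 'b \<Rightarrow> real) \<Rightarrow> (real \<times> real set) list \<Rightarrow> 'b \<Rightarrow> real" where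
  "simple_wiener B p \<omega> = (\<Sum>(a, A) \<leftarrow> p. a * B A \<omega>)"

text \<open>
  \<open>Y\<close> is a version of \<open>\<integral> f(u) B(du)\<close>: it is the \<open>L\<^sup>2\<close> limit of the integrals of simple functions that
  converge to \<open>f\<close> in \<open>L\<^sup>2\<close> of Lebesgue measure.  The integral is determined up to null sets only,
  whence a relation.
\<close>

definition is_wiener_integral ::
  "'b measure \<Rightarrow> (real set \<Rightarrow> 'b \<Rightarrow> real) \<Rightarrow> (real \<Rightarrow> real) \<Rightarrow> ('b \<Rightarrow> real) \<Rightarrow> bool" where
  "is_wiener_integral N B f Y \<longleftrightarrow>
     f \<in> borel_measurable lborel \<and> Y \<in> borel_measurable N \<and>
     (\<exists>p :: nat \<Rightarrow> (real \<times> real set) list.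
        (\<forall>n. \<forall>(a, A) \<in> set (p n). A \<in> fmeasurable lborel) \<and>
        (\<lambda>n. \<integral>\<^sup>+ u. ennreal ((simple_fun (p n) u - f u)\<^sup>2) \<partial>lborel) \<longlonglongrightarrow> 0 \<and>
        (\<lambda>n. \<integral>\<^sup>+ \<omega>. ennreal ((simple_wiener B (p n) \<omega> - Y \<omega>)\<^sup>2) \<partial>N) \<longlonglongrightarrow> 0)"


section \<open>Generalized fractional Brownian motion\<close>

definition pos_powr :: "real \<Rightarrow> real \<Rightarrow> real" where
  "pos_powr x a = (if x > 0 then x powr a else 0)"

definition gfbm_kernel :: "real \<Rightarrow> real \<Rightarrow> real \<Rightarrow> real \<Rightarrow> real" where
  "gfbm_kernel \<alpha> \<gamma> t u = (pos_powr (t - u) \<alpha> - pos_powr (- u) \<alpha>) * \<bar>u\<bar> powr (- \<gamma> / 2)"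

definition gfbm_const :: "real \<Rightarrow> real \<Rightarrow> real" where
  "gfbm_const \<alpha> \<gamma> =
     1 / sqrt ((LINT v:{0..1}|lborel. (1 - v) powr (2 * \<alpha>) * v powr (- \<gamma>))
             + (LINT v:{0..}|lborel. ((1 + v) powr \<alpha> - v powr \<alpha>)\<^sup>2 * v powr (- \<gamma>)))"

definition same_fdd ::
  "'i set \<Rightarrow> 'a measure \<Rightarrow> ('i \<Rightarrow> 'a \<Rightarrow> real) \<Rightarrow> 'b measure \<Rightarrow> ('i \<Rightarrow> 'b \<Rightarrow> real) \<Rightarrow> bool" where
  "same_fdd I M X N Y \<longleftrightarrow>
     (\<forall>J \<subseteq> I. finite J \<longrightarrow>
        distr M (\<Pi>\<^sub>M t\<in>J. borel) (\<lambda>\<omega>. \<lambda>t\<in>J. X t \<omega>) =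
        distr N (\<Pi>\<^sub>M t\<in>J. borel) (\<lambda>\<omega>. \<lambda>t\<in>J. Y t \<omega>))"

text \<open>
  \<open>X\<close> on \<open>M\<close> is a process with continuous sample paths that has the law of the moving average with
  respect to the Gaussian random measure \<open>B\<close> on \<open>N\<close>.  The representation holds in distribution, so
  \<open>N\<close> need not be \<open>M\<close>.  Only times \<open>t \<ge> 0\<close> matter.
\<close>

definition gfbm ::
  "real \<Rightarrow> real \<Rightarrow> 'b measure \<Rightarrow> (real set \<Rightarrow> 'b \<Rightarrow> real) \<Rightarrow>
   'a measure \<Rightarrow> (real \<Rightarrow> 'a \<Rightarrow> real) \<Rightarrow> bool" where
  "gfbm \<alpha> \<gamma> N B M X \<longleftrightarrow>
     prob_space M \<and>
     (\<forall>t\<ge>0. X t \<in> borel_measurable M) \<and>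
     (\<forall>\<omega> \<in> space M. continuous_on {0..} (\<lambda>t. X t \<omega>)) \<and>
     gaussian_random_measure N B \<and>
     (\<exists>I. (\<forall>t\<ge>0. is_wiener_integral N B (gfbm_kernel \<alpha> \<gamma> t) (I t)) \<and>
          same_fdd {0..} M X N (\<lambda>t \<omega>. gfbm_const \<alpha> \<gamma> * I t \<omega>))"

definition covariance_fun :: "'a measure \<Rightarrow> (real \<Rightarrow> 'a \<Rightarrow> real) \<Rightarrow> real \<Rightarrow> real \<Rightarrow> real" where
  "covariance_fun M X s t = integral\<^sup>L M (\<lambda>\<omega>. X s \<omega> * X t \<omega>)"


section \<open>The reproducing kernel Hilbert space of a kernel\<close>

text \<open>
  An element \<open>\<Sum> c\<^sub>i Q(s\<^sub>i, \<cdot>)\<close> of the span of the functions \<open>Q(s, \<cdot>)\<close>, \<open>s \<in> S\<close>, is given by a finitely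
  supported coefficient function.  Different coefficients may represent the same function; for a
  positive semidefinite \<open>Q\<close> the scalar product depends on the functions only.
\<close>

definition coeffs_on :: "'s set \<Rightarrow> ('s \<Rightarrow> real) set" where
  "coeffs_on S = {a. finite {s. a s \<noteq> 0} \<and> {s. a s \<noteq> 0} \<subseteq> S}"

definition kernel_comb :: "('s \<Rightarrow> 's \<Rightarrow> real) \<Rightarrow> ('s \<Rightarrow> real) \<Rightarrow> 's \<Rightarrow> real" where
  "kernel_comb Q a t = (\<Sum>s | a s \<noteq> 0. a s * Q s t)"

definition kernel_inner :: "('s \<Rightarrow> 's \<Rightarrow> real) \<Rightarrow> ('s \<Rightarrow> real) \<Rightarrow> ('s \<Rightarrow> real) \<Rightarrow> real" where
  "kernel_inner Q a b = (\<Sum>s | a s \<noteq> 0. \<Sum>s' | b s' \<noteq> 0. a s * b s' * Q s s')"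

definition kernel_norm :: "('s \<Rightarrow> 's \<Rightarrow> real) \<Rightarrow> ('s \<Rightarrow> real) \<Rightarrow> real" where
  "kernel_norm Q a = sqrt (kernel_inner Q a a)"

text \<open>
  The completion is realised as a space of functions on \<open>S\<close>: a Cauchy sequence in the span
  converges pointwise by the reproducing property, and equivalent Cauchy sequences are precisely
  those with the same pointwise limit.  \<open>rkhs_approx Q S a h\<close> says that \<open>h\<close> is the element of the
  completion given by the Cauchy sequence \<open>a\<close>.
\<close>

definition rkhs_approx ::
  "('s \<Rightarrow> 's \<Rightarrow> real) \<Rightarrow> 's set \<Rightarrow> (nat \<Rightarrow> 's \<Rightarrow> real) \<Rightarrow> ('s \<Rightarrow> real) \<Rightarrow> bool" where
  "rkhs_approx Q S a h \<longleftrightarrow>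
     (\<forall>n. a n \<in> coeffs_on S) \<and>
     (\<forall>e>0. \<exists>n0. \<forall>m\<ge>n0. \<forall>n\<ge>n0. kernel_norm Q (\<lambda>s. a m s - a n s) < e) \<and>
     h \<in> extensional S \<and>
     (\<forall>t\<in>S. (\<lambda>n. kernel_comb Q (a n) t) \<longlonglongrightarrow> h t)"

definition rkhs :: "('s \<Rightarrow> 's \<Rightarrow> real) \<Rightarrow> 's set \<Rightarrow> ('s \<Rightarrow> real) set" where
  "rkhs Q S = {h. \<exists>a. rkhs_approx Q S a h}"

definition rkhs_inner ::
  "('s \<Rightarrow> 's \<Rightarrow> real) \<Rightarrow> 's set \<Rightarrow> ('s \<Rightarrow> real) \<Rightarrow> ('s \<Rightarrow> real) \<Rightarrow> real" where
  "rkhs_inner Q S h g =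
     (THE r. \<forall>a b. rkhs_approx Q S a h \<longrightarrow> rkhs_approx Q S b g \<longrightarrow>
               (\<lambda>n. kernel_inner Q (a n) (b n)) \<longlonglongrightarrow> r)"

definition rkhs_unit_ball :: "('s \<Rightarrow> 's \<Rightarrow> real) \<Rightarrow> 's set \<Rightarrow> ('s \<Rightarrow> real) set" where
  "rkhs_unit_ball Q S = {h \<in> rkhs Q S. sqrt (rkhs_inner Q S h h) \<le> 1}"


section \<open>The space of continuous functions on an interval\<close>

text \<open>Functions on \<open>[0,T]\<close> are represented by elements of \<^term>\<open>extensional {0..T}\<close>.\<close>

definition C_space :: "real \<Rightarrow> (real \<Rightarrow> real) metric" where
  "C_space T = cfunspace (top_of_set {0..T}) euclidean_metric"

definition mdist_to_set :: "'a metric \<Rightarrow> 'a \<Rightarrow> 'a set \<Rightarrow> real" where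
  "mdist_to_set m z K = (INF h\<in>K. mdist m z h)"

definition cluster_set :: "'a metric \<Rightarrow> (nat \<Rightarrow> 'a) \<Rightarrow> 'a set" where
  "cluster_set m z =
     {x. \<exists>r. strict_mono r \<and> limitin (mtopology_of m) (z \<circ> r) x sequentially}"

text \<open>
  The normalisation is meaningful for \<open>n \<ge> 3\<close> only; limits and cluster sets do not depend on the
  remaining finitely many terms.
\<close>

definition lil_path :: "real \<Rightarrow> real \<Rightarrow> (real \<Rightarrow> 'a \<Rightarrow> real) \<Rightarrow> 'a \<Rightarrow> nat \<Rightarrow> real \<Rightarrow> real" where
  "lil_path T H X \<omega> n =
     (\<lambda>t\<in>{0..T}. X (real n * t) \<omega> / sqrt (2 * real n powr (2 * H) * ln (ln (real n))))"

end

theory Submission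
  imports Defs "HOL-Complex_Analysis.Great_Picard" "HOL-Real_Asymp.Real_Asymp"
begin

text \<open>
  All finite-dimensional laws are Gaussian and determined by the \<open>L\<^sup>2\<close> norms of linear combinations of
  the kernels, and the unit ball of the RKHS consists of those \<open>h\<close> with
  \<open>\<bar>\<Sum> a s * h s\<bar> \<le> \<surd>(\<Sum> a s * a t * \<Psi> s t)\<close> for all finitely supported \<open>a\<close>.  Gaussian tails along
  geometric sequences bound every such combination of the normalised paths, and Fernique's inequality
  for finite families controls their modulus of continuity; so the paths are asymptotically relatively
  compact with all limit points in the ball.

  For the converse, dilation concentrates the kernels of a sparse geometric sequence of times on
  disjoint annuli, which leaves independent main terms and yields the lower half of the
  one-dimensional law of the iterated logarithm for each combination \<open>a\<close>.  A limit point along which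
  that combination attains its norm must, by strict convexity, be the normalised \<open>\<Sum> a s * \<Psi> s\<close>.
  These functions lie on the sphere, but they are dense in the whole ball in the sup norm, since
  \<open>\<Psi> t / t\<^sup>H\<close> tends to 0 uniformly as \<open>t\<close> tends to 0.
\<close>

section \<open>The unit ball of a reproducing kernel Hilbert space\<close>

text \<open>Self-similarity takes the place of quantitative estimates. Dilation by \<open>r\<close>
  turns the normalised kernels into \<open>r powr (- 1 / 2)\<close> times the original ones, an L2
  isometry, so statements at scale 1 hold at every scale. Plain path continuity at scale 1 thus
  supplies the starting probability for Fernique's inequality, with a threshold as small as desired,
  and dominated convergence at scale 1 supplies the asymptotic independence of distant scales. Two
  obstacles shape the rest. Only countably many almost sure statements can be combined, while the
  ball is described by uncountably many coefficient functions; hence rational coefficients at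
  rational times, extended by continuity. And Borel-Cantelli works along sequences
  \<open>l ^ k\<close> only; the modulus of continuity carries the upper bounds to all integers,
  because passing from \<open>n\<close> to a nearby \<open>l ^ k\<close> is a small change of the
  time argument. Laws are compared through characteristic functions rather than densities because
  covariance matrices may be singular, for instance at time 0.\<close>

definition coeff_lin :: "('s \<Rightarrow> real) \<Rightarrow> ('s \<Rightarrow> real) \<Rightarrow> real" where
  "coeff_lin a h = (\<Sum>s | a s \<noteq> 0. a s * h s)"

text \<open>As a functional this is evaluation at \<open>t\<close>; as an element of the span it is
  the kernel section at \<open>t\<close>.\<close>

definition unit_coeff :: "'s \<Rightarrow> 's \<Rightarrow> real" where
  "unit_coeff t s = (if s = t then 1 else 0)"

lemma coeffs_onD: "a \<in> coeffs_on S \<Longrightarrow> finite {s. a s \<noteq> 0}" "a \<in> coeffs_on S \<Longrightarrow> a s \<noteq> 0 \<Longrightarrow> s \<in> S"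
  by (auto simp: coeffs_on_def)

lemma coeffs_on_lincomb:
  assumes "a \<in> coeffs_on S" "b \<in> coeffs_on S"
  shows "(\<lambda>s. a s + r * b s) \<in> coeffs_on S"
proof -
  have "{s. a s + r * b s \<noteq> 0} \<subseteq> {s. a s \<noteq> 0} \<union> {s. b s \<noteq> 0}"
    by auto
  then show ?thesis
    using assms by (auto simp: coeffs_on_def elim!: finite_subset)
qed

lemma coeffs_on_diff:
  "a \<in> coeffs_on S \<Longrightarrow> b \<in> coeffs_on S \<Longrightarrow> (\<lambda>s. a s - b s) \<in> coeffs_on S"
  using coeffs_on_lincomb[of a S b "-1"] by simp

lemma coeffs_on_zero: "(\<lambda>_. 0) \<in> coeffs_on S"
  by (simp add: coeffs_on_def)

lemma coeffs_on_scale: "a \<in> coeffs_on S \<Longrightarrow> (\<lambda>s. r * a s) \<in> coeffs_on S"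
  using coeffs_on_lincomb[OF coeffs_on_zero, of a S r] by simp

lemma coeffs_on_unit: "t \<in> S \<Longrightarrow> unit_coeff t \<in> coeffs_on S"
  by (auto simp: coeffs_on_def unit_coeff_def)

lemma coeff_lin_superset:
  assumes "finite J" "{s. a s \<noteq> 0} \<subseteq> J"
  shows "coeff_lin a h = (\<Sum>s\<in>J. a s * h s)"
  unfolding coeff_lin_def using assms by (intro sum.mono_neutral_left) auto

lemma coeff_lin_lincomb:
  assumes "finite {s. a s \<noteq> 0}" "finite {s. b s \<noteq> 0}"
  shows "coeff_lin (\<lambda>s. a s + r * b s) h = coeff_lin a h + r * coeff_lin b h"
proof -
  let ?J = "{s. a s \<noteq> 0} \<union> {s. b s \<noteq> 0}"
  have "coeff_lin (\<lambda>s. a s + r * b s) h = (\<Sum>s\<in>?J. (a s + r * b s) * h s)"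
    using assms by (intro coeff_lin_superset) auto
  moreover have "coeff_lin a h = (\<Sum>s\<in>?J. a s * h s)" "coeff_lin b h = (\<Sum>s\<in>?J. b s * h s)"
    using assms by (auto intro!: coeff_lin_superset)
  ultimately show ?thesis
    by (simp add: algebra_simps sum.distrib sum_distrib_left)
qed

lemma coeff_lin_unit: "coeff_lin (unit_coeff t) h = h t"
proof -
  have "coeff_lin (unit_coeff t) h = (\<Sum>s\<in>{t}. unit_coeff t s * h s)"
    by (rule coeff_lin_superset) (auto simp: unit_coeff_def)
  then show ?thesis
    by (simp add: unit_coeff_def)
qed

lemma kernel_comb_eq_coeff_lin: "kernel_comb Q a t = coeff_lin a (\<lambda>s. Q s t)"
  by (simp add: kernel_comb_def coeff_lin_def)

lemma kernel_inner_eq_coeff_lin: "kernel_inner Q a b = coeff_lin a (\<lambda>s. coeff_lin b (Q s))"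
  by (simp add: kernel_inner_def coeff_lin_def sum_distrib_left mult.assoc)

text \<open>With \<open>b = unit_coeff t\<close> this is the reproducing property on the span. It
  also turns pointwise convergence of \<open>kernel_comb\<close> into convergence of scalar products
  against a fixed \<open>b\<close>.\<close>

lemma kernel_inner_eq_comb: "kernel_inner Q a b = coeff_lin b (kernel_comb Q a)"
  unfolding kernel_inner_def coeff_lin_def kernel_comb_def sum_distrib_left
  by (subst sum.swap) (simp add: mult_ac)

text \<open>Besides Cauchy-Schwarz it serves as a first order condition: with \<open>A = 0\<close>
  it forces the linear coefficient \<open>B\<close> to vanish.\<close>

lemma discriminant_le:
  fixes A B C :: real
  assumes "\<And>x. 0 \<le> A + 2 * x * B + x\<^sup>2 * C" "0 \<le> C"
  shows "B\<^sup>2 \<le> A * C"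
proof (cases "C = 0")
  case True
  have "B = 0"
  proof (rule ccontr)
    assume "B \<noteq> 0"
    then show False
      \<comment> \<open>The witness makes \<open>A + 2 * x * B\<close> equal to -1.\<close>
      using assms(1)[of "- (A + 1) / (2 * B)"] True by (simp add: field_simps)
  qed
  with True show ?thesis by simp
next
  case False
  with \<open>0 \<le> C\<close> have "C > 0" by simp
  have "0 \<le> A - B\<^sup>2 / C"
    using assms(1)[of "- B / C"] \<open>C > 0\<close> by (simp add: power2_eq_square field_simps)
  with \<open>C > 0\<close> show ?thesis by (simp add: field_simps)
qed

text \<open>Only semidefiniteness is assumed, so the norm is a seminorm on coefficient functions;
  different coefficients may give the same function.\<close>

locale psd_kernel =
  fixes Q :: "'s \<Rightarrow> 's \<Rightarrow> real" and S :: "'s set"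
  assumes sym: "s \<in> S \<Longrightarrow> t \<in> S \<Longrightarrow> Q s t = Q t s"
    and psd: "a \<in> coeffs_on S \<Longrightarrow> 0 \<le> kernel_inner Q a a"
begin

abbreviation "ip \<equiv> kernel_inner Q"
abbreviation "nrm \<equiv> kernel_norm Q"
abbreviation "comb \<equiv> kernel_comb Q"

lemma ip_sym: "a \<in> coeffs_on S \<Longrightarrow> b \<in> coeffs_on S \<Longrightarrow> ip a b = ip b a"
  unfolding kernel_inner_def
  by (subst sum.swap) (auto intro!: sum.cong simp: sym coeffs_onD mult_ac)

lemma ip_lin1:
  "a \<in> coeffs_on S \<Longrightarrow> b \<in> coeffs_on S \<Longrightarrow> ip (\<lambda>s. a s + r * b s) c = ip a c + r * ip b c"
  unfolding kernel_inner_eq_coeff_lin by (intro coeff_lin_lincomb) (auto simp: coeffs_onD)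

lemma ip_lin2:
  assumes "a \<in> coeffs_on S" "b \<in> coeffs_on S" "c \<in> coeffs_on S"
  shows "ip c (\<lambda>s. a s + r * b s) = ip c a + r * ip c b"
  unfolding kernel_inner_eq_comb using assms by (intro coeff_lin_lincomb) (auto simp: coeffs_onD)

lemma ip_lincomb_self:
  assumes "a \<in> coeffs_on S" "b \<in> coeffs_on S"
  shows "ip (\<lambda>s. a s + r * b s) (\<lambda>s. a s + r * b s) = ip a a + 2 * r * ip a b + r\<^sup>2 * ip b b"
  using assms ip_sym[of a b]
  by (simp add: ip_lin1 ip_lin2 coeffs_on_lincomb algebra_simps power2_eq_square)

lemma ip_scale:
  assumes "a \<in> coeffs_on S"
  shows "ip (\<lambda>s. r * a s) (\<lambda>s. r * a s) = r\<^sup>2 * ip a a"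
  using ip_lincomb_self[OF coeffs_on_zero assms, of r]
  by (simp add: kernel_inner_def)

lemma ip_unit: "ip a (unit_coeff t) = comb a t"
  unfolding kernel_inner_eq_comb by (rule coeff_lin_unit)

lemma ip_unit_unit: "ip (unit_coeff s) (unit_coeff t) = Q s t"
  by (simp add: ip_unit kernel_comb_eq_coeff_lin coeff_lin_unit)

lemma comb_unit: "comb (unit_coeff s) t = Q s t"
  by (simp add: kernel_comb_eq_coeff_lin coeff_lin_unit)

lemma Q_nonneg: "t \<in> S \<Longrightarrow> 0 \<le> Q t t"
  using psd[OF coeffs_on_unit, of t] by (simp add: ip_unit_unit)

lemma nrm_nonneg: "a \<in> coeffs_on S \<Longrightarrow> 0 \<le> nrm a"
  by (simp add: kernel_norm_def psd)

lemma nrm_sq: "a \<in> coeffs_on S \<Longrightarrow> (nrm a)\<^sup>2 = ip a a"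
  by (simp add: kernel_norm_def psd)

lemma nrm_scale: "a \<in> coeffs_on S \<Longrightarrow> nrm (\<lambda>s. r * a s) = \<bar>r\<bar> * nrm a"
  by (simp add: kernel_norm_def ip_scale real_sqrt_mult)

lemma ip_le:
  assumes "a \<in> coeffs_on S" "b \<in> coeffs_on S"
  shows "\<bar>ip a b\<bar> \<le> nrm a * nrm b"
proof -
  have "(ip a b)\<^sup>2 \<le> ip a a * ip b b"
    by (rule discriminant_le)
      (use assms psd[OF coeffs_on_lincomb[OF assms]] in \<open>auto simp: ip_lincomb_self psd\<close>)
  then have "(ip a b)\<^sup>2 \<le> (nrm a * nrm b)\<^sup>2"
    using assms by (simp add: power_mult_distrib nrm_sq)
  then show ?thesis
    using assms by (simp add: abs_le_square_iff[symmetric] nrm_nonneg)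
qed

lemma nrm_triangle:
  assumes "a \<in> coeffs_on S" "b \<in> coeffs_on S"
  shows "nrm (\<lambda>s. a s + b s) \<le> nrm a + nrm b"
proof (rule power2_le_imp_le)
  have "(nrm (\<lambda>s. a s + b s))\<^sup>2 = ip a a + 2 * ip a b + ip b b"
    using ip_lincomb_self[OF assms, of 1] nrm_sq[OF coeffs_on_lincomb[OF assms, of 1]] by simp
  also have "\<dots> \<le> (nrm a + nrm b)\<^sup>2"
    using ip_le[OF assms] nrm_sq[OF assms(1)] nrm_sq[OF assms(2)] by (simp add: power2_sum)
  finally show "(nrm (\<lambda>s. a s + b s))\<^sup>2 \<le> (nrm a + nrm b)\<^sup>2" .
qed (use assms in \<open>auto simp: nrm_nonneg\<close>)

lemma nrm_minus_commute: 
  assumes "a \<in> coeffs_on S" "b \<in> coeffs_on S"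
  shows "nrm (\<lambda>s. a s - b s) = nrm (\<lambda>s. b s - a s)"
  using nrm_scale[OF coeffs_on_diff[OF assms], of "-1"] by simp

lemma nrm_diff_le:
  assumes "a \<in> coeffs_on S" "b \<in> coeffs_on S"
  shows "\<bar>nrm a - nrm b\<bar> \<le> nrm (\<lambda>s. a s - b s)"
  using nrm_triangle[OF coeffs_on_diff[OF assms] assms(2)]
    nrm_triangle[OF coeffs_on_diff[OF assms(2,1)] assms(1)] nrm_minus_commute[OF assms]
  by simp

lemma comb_le: "a \<in> coeffs_on S \<Longrightarrow> t \<in> S \<Longrightarrow> \<bar>comb a t\<bar> \<le> nrm a * sqrt (Q t t)"
  using ip_le[OF _ coeffs_on_unit, of a t] by (simp add: ip_unit kernel_norm_def comb_unit)

lemma comb_diff: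
  "a \<in> coeffs_on S \<Longrightarrow> b \<in> coeffs_on S \<Longrightarrow> comb (\<lambda>s. a s - b s) t = comb a t - comb b t"
  unfolding kernel_comb_eq_coeff_lin using coeff_lin_lincomb[of a b "-1"] by (simp add: coeffs_onD)

lemma comb_lincomb:
  "a \<in> coeffs_on S \<Longrightarrow> b \<in> coeffs_on S \<Longrightarrow> comb (\<lambda>s. a s + r * b s) t = comb a t + r * comb b t"
  unfolding kernel_comb_eq_coeff_lin by (rule coeff_lin_lincomb) (auto simp: coeffs_onD)

lemma comb_scale: "a \<in> coeffs_on S \<Longrightarrow> comb (\<lambda>s. r * a s) t = r * comb a t"
  using comb_lincomb[OF coeffs_on_zero, of a r t] by (simp add: kernel_comb_def)

section \<open>Cauchy sequences in the span and the norm of their limits\<close>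

lemma rkhs_approx_norm_convergent:
  assumes "rkhs_approx Q S a h"
  shows "convergent (\<lambda>n. nrm (a n))"
proof (rule Cauchy_convergent, rule metric_CauchyI)
  fix e :: real assume "e > 0"
  then obtain n0 where "\<And>m n. m \<ge> n0 \<Longrightarrow> n \<ge> n0 \<Longrightarrow> nrm (\<lambda>s. a m s - a n s) < e"
    using assms unfolding rkhs_approx_def by blast
  moreover have "a n \<in> coeffs_on S" for n
    using assms by (simp add: rkhs_approx_def)
  ultimately show "\<exists>M. \<forall>m\<ge>M. \<forall>n\<ge>M. dist (nrm (a m)) (nrm (a n)) < e"
    unfolding dist_real_def using nrm_diff_le by (meson order_le_less_trans)
qed

lemma ip_approx_tendsto:
  assumes "rkhs_approx Q S a h" "b \<in> coeffs_on S"
  shows "(\<lambda>n. ip (a n) b) \<longlonglongrightarrow> coeff_lin b h"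
  unfolding kernel_inner_eq_comb coeff_lin_def using assms
  by (intro tendsto_sum tendsto_mult tendsto_const) (auto simp: rkhs_approx_def coeffs_onD)

text \<open>The difference \<open>c\<close> of the two sequences is Cauchy, and its scalar product
  with each fixed coefficient function tends to 0. In
  \<open>ip (c n) (c n) = ip (c n - c m) (c n) + ip (c m) (c n)\<close> the first term is small for
  all large \<open>m\<close> and \<open>n\<close>, and the second vanishes as \<open>m\<close> grows
  with \<open>n\<close> fixed.\<close>

lemma rkhs_approx_unique:
  assumes a: "rkhs_approx Q S a h" and b: "rkhs_approx Q S b h"
  shows "(\<lambda>n. nrm (\<lambda>s. a n s - b n s)) \<longlonglongrightarrow> 0"
proof -
  have ca: "a n \<in> coeffs_on S" and cb: "b n \<in> coeffs_on S" for n
    using a b by (auto simp: rkhs_approx_def)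
  define c where "c n = (\<lambda>s. a n s - b n s)" for n
  have cc: "c n \<in> coeffs_on S" for n
    unfolding c_def by (intro coeffs_on_diff ca cb)
  have cauchy: "\<exists>n0. \<forall>m\<ge>n0. \<forall>n\<ge>n0. nrm (\<lambda>s. c m s - c n s) < e" if "e > 0" for e
  proof -
    from that have "e / 2 > 0" by simp
    then obtain n1 n2 where
      1: "\<And>m n. m \<ge> n1 \<Longrightarrow> n \<ge> n1 \<Longrightarrow> nrm (\<lambda>s. a m s - a n s) < e / 2" and
      2: "\<And>m n. m \<ge> n2 \<Longrightarrow> n \<ge> n2 \<Longrightarrow> nrm (\<lambda>s. b m s - b n s) < e / 2"
      using a b unfolding rkhs_approx_def by meson
    have "nrm (\<lambda>s. c m s - c n s) < e" if "m \<ge> max n1 n2" "n \<ge> max n1 n2" for m n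
    proof -
      have "nrm (\<lambda>s. c m s - c n s) = nrm (\<lambda>s. (a m s - a n s) + (b n s - b m s))"
        by (simp add: c_def algebra_simps)
      also have "\<dots> \<le> nrm (\<lambda>s. a m s - a n s) + nrm (\<lambda>s. b n s - b m s)"
        by (intro nrm_triangle coeffs_on_diff ca cb)
      also have "\<dots> < e"
        using 1[of m n] 2[of n m] that by simp
      finally show ?thesis .
    qed
    then show ?thesis by blast
  qed
  have c0: "(\<lambda>m. ip (c m) b') \<longlonglongrightarrow> 0" if b': "b' \<in> coeffs_on S" for b'
  proof -
    have "ip (c m) b' = ip (a m) b' - ip (b m) b'" for m
      using ip_lin1[OF ca cb, of m "-1" m b'] by (simp add: c_def)
    then show ?thesis
      using tendsto_diff[OF ip_approx_tendsto[OF a b'] ip_approx_tendsto[OF b b']] by simp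
  qed
  obtain n1 where n1: "\<And>n. n \<ge> n1 \<Longrightarrow> nrm (\<lambda>s. c n s - c n1 s) < 1"
    using cauchy[of 1] by auto
  define C where "C = nrm (c n1) + 1"
  have C: "nrm (c n) \<le> C" if "n \<ge> n1" for n
    using n1[OF that] nrm_diff_le[OF cc cc, of n n1] by (simp add: C_def)
  have "C > 0"
    using nrm_nonneg[OF cc, of n1] by (simp add: C_def)
  have "(\<lambda>n. ip (c n) (c n)) \<longlonglongrightarrow> 0"
  proof (rule LIMSEQ_I)
    fix e :: real assume "e > 0"
    obtain n2 where n2: "\<And>m n. m \<ge> n2 \<Longrightarrow> n \<ge> n2 \<Longrightarrow> nrm (\<lambda>s. c m s - c n s) < e / (2 * C)"
      using cauchy[of "e / (2 * C)"] \<open>e > 0\<close> \<open>C > 0\<close> by auto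
    have "norm (ip (c n) (c n) - 0) < e" if n: "n \<ge> max n1 n2" for n
    proof -
      have "ip (c n) (c n) \<le> e / 2 + ip (c m) (c n)" if m: "m \<ge> n2" for m
      proof -
        have "ip (c n) (c n) - ip (c m) (c n) = ip (\<lambda>s. c n s - c m s) (c n)"
          using ip_lin1[OF cc cc, of n "-1" m "c n"] by simp
        also have "\<dots> \<le> nrm (\<lambda>s. c n s - c m s) * nrm (c n)"
          using ip_le[OF coeffs_on_diff[OF cc cc] cc, of n m n] by simp
        also have "\<dots> \<le> e / (2 * C) * C"
          using n2[of n m] m n C[of n] nrm_nonneg[OF coeffs_on_diff[OF cc cc]] nrm_nonneg[OF cc]
            \<open>e > 0\<close> \<open>C > 0\<close> by (intro mult_mono) (auto intro: less_imp_le)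
        also have "\<dots> = e / 2"
          using \<open>C > 0\<close> by simp
        finally show ?thesis by simp
      qed
      then have "ip (c n) (c n) \<le> e / 2 + 0"
        by (intro LIMSEQ_le_const[OF tendsto_add[OF tendsto_const c0[OF cc, of n]]]) auto
      with \<open>e > 0\<close> psd[OF cc, of n] show ?thesis by simp
    qed
    then show "\<exists>no. \<forall>n\<ge>no. norm (ip (c n) (c n) - 0) < e" by blast
  qed
  then have "(\<lambda>n. sqrt (ip (c n) (c n))) \<longlonglongrightarrow> sqrt 0"
    by (intro tendsto_intros)
  then show ?thesis
    by (simp add: kernel_norm_def c_def)
qed

text \<open>The description operator in \<open>rkhs_inner\<close> ranges over all pairs of
  approximating sequences, so one limit must be shown to serve every pair \<open>c\<close>,
  \<open>b\<close>. Both differ from \<open>a\<close> by sequences of vanishing norm, and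
  \<open>ip c b - ip a a = ip (c - a) b + ip a (b - a)\<close>.\<close>

lemma rkhs_inner_self:
  assumes a: "rkhs_approx Q S a h"
  shows "(\<lambda>n. (nrm (a n))\<^sup>2) \<longlonglongrightarrow> rkhs_inner Q S h h"
proof -
  have ca: "a n \<in> coeffs_on S" for n
    using a by (auto simp: rkhs_approx_def)
  obtain L where L: "(\<lambda>n. nrm (a n)) \<longlonglongrightarrow> L"
    using rkhs_approx_norm_convergent[OF a] by (auto simp: convergent_def)
  have key: "(\<lambda>n. ip (c n) (b n)) \<longlonglongrightarrow> L\<^sup>2"
    if c: "rkhs_approx Q S c h" and b: "rkhs_approx Q S b h" for c b
  proof -
    have cc: "c n \<in> coeffs_on S" and cb: "b n \<in> coeffs_on S" for n
      using c b by (auto simp: rkhs_approx_def)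
    let ?c = "\<lambda>n. nrm (\<lambda>s. c n s - a n s)" and ?b = "\<lambda>n. nrm (\<lambda>s. b n s - a n s)"
    have c0: "?c \<longlonglongrightarrow> 0" and b0: "?b \<longlonglongrightarrow> 0"
      by (intro rkhs_approx_unique[OF c a] rkhs_approx_unique[OF b a])+
    have "(\<lambda>n. ip (c n) (b n) - (nrm (a n))\<^sup>2) \<longlonglongrightarrow> 0"
    proof (rule Lim_null_comparison)
      show "\<forall>\<^sub>F n in sequentially. norm (ip (c n) (b n) - (nrm (a n))\<^sup>2)
          \<le> ?c n * (nrm (a n) + ?b n) + nrm (a n) * ?b n"
      proof (intro always_eventually allI)
        fix n
        have "ip (\<lambda>s. c n s - a n s) (b n) = ip (c n) (b n) - ip (a n) (b n)"
          using ip_lin1[OF cc ca, of n "-1" n "b n"] by simp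
        moreover have "ip (a n) (\<lambda>s. b n s - a n s) = ip (a n) (b n) - ip (a n) (a n)"
          using ip_lin2[OF cb ca ca, of n n "-1" n] by simp
        ultimately have "ip (c n) (b n) - (nrm (a n))\<^sup>2
            = ip (\<lambda>s. c n s - a n s) (b n) + ip (a n) (\<lambda>s. b n s - a n s)"
          by (simp add: nrm_sq ca)
        moreover have "\<bar>ip (\<lambda>s. c n s - a n s) (b n)\<bar> \<le> ?c n * nrm (b n)"
          by (intro ip_le coeffs_on_diff cc ca cb)
        moreover have "?c n * nrm (b n) \<le> ?c n * (nrm (a n) + ?b n)"
          using nrm_diff_le[OF cb ca, of n n]
          by (intro mult_left_mono nrm_nonneg coeffs_on_diff cc ca) auto
        moreover have "\<bar>ip (a n) (\<lambda>s. b n s - a n s)\<bar> \<le> nrm (a n) * ?b n"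
          by (intro ip_le coeffs_on_diff ca cb)
        ultimately show "norm (ip (c n) (b n) - (nrm (a n))\<^sup>2)
          \<le> ?c n * (nrm (a n) + ?b n) + nrm (a n) * ?b n"
          by simp
      qed
      show "(\<lambda>n. ?c n * (nrm (a n) + ?b n) + nrm (a n) * ?b n) \<longlonglongrightarrow> 0"
        using tendsto_add[OF tendsto_mult[OF c0 tendsto_add[OF L b0]] tendsto_mult[OF L b0]] by simp
    qed
    from tendsto_add[OF this tendsto_power[OF L, of 2]] show ?thesis by simp
  qed
  have "rkhs_inner Q S h h = L\<^sup>2"
    unfolding rkhs_inner_def
  proof (rule the_equality)
    show "\<forall>c b. rkhs_approx Q S c h \<longrightarrow> rkhs_approx Q S b h \<longrightarrow> (\<lambda>n. ip (c n) (b n)) \<longlonglongrightarrow> L\<^sup>2"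
      using key by blast
    show "r = L\<^sup>2" if "\<forall>c b. rkhs_approx Q S c h \<longrightarrow> rkhs_approx Q S b h \<longrightarrow> (\<lambda>n. ip (c n) (b n)) \<longlonglongrightarrow> r" for r
      using that key[OF a a] a LIMSEQ_unique by blast
  qed
  with tendsto_power[OF L, of 2] show ?thesis by simp
qed

text \<open>A late member of the Cauchy sequence works: its norm is close to that of
  \<open>h\<close>, and letting the other index grow in \<open>comb_le\<close> bounds the pointwise
  error. The weight \<open>sqrt (Q t t)\<close> is what makes the error uniform when the kernel is
  bounded on the diagonal.\<close>

lemma rkhs_unit_ball_approx:
  assumes h: "h \<in> rkhs_unit_ball Q S" and "e > 0"
  obtains a where "a \<in> coeffs_on S" "nrm a \<le> 1 + e"
    "\<And>t. t \<in> S \<Longrightarrow> \<bar>h t - comb a t\<bar> \<le> e * sqrt (Q t t)"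
proof -
  from h obtain a where a: "rkhs_approx Q S a h" and le: "sqrt (rkhs_inner Q S h h) \<le> 1"
    by (auto simp: rkhs_unit_ball_def rkhs_def)
  have ca: "a n \<in> coeffs_on S" for n
    using a by (auto simp: rkhs_approx_def)
  from le have "rkhs_inner Q S h h < (1 + e)\<^sup>2"
    using \<open>e > 0\<close> by (smt (verit) real_sqrt_le_1_iff one_less_power pos2)
  then have "\<forall>\<^sub>F n in sequentially. (nrm (a n))\<^sup>2 < (1 + e)\<^sup>2"
    using rkhs_inner_self[OF a] by (auto simp: order_tendsto_iff)
  moreover obtain n0 where n0: "\<And>m n. m \<ge> n0 \<Longrightarrow> n \<ge> n0 \<Longrightarrow> nrm (\<lambda>s. a m s - a n s) < e"
    using a \<open>e > 0\<close> unfolding rkhs_approx_def by blast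
  ultimately obtain n where n: "(nrm (a n))\<^sup>2 < (1 + e)\<^sup>2" "n \<ge> n0"
    by (metis (mono_tags, lifting) eventually_at_top_linorder nle_le)
  show ?thesis
  proof
    show "nrm (a n) \<le> 1 + e"
      using n(1) \<open>e > 0\<close> by (smt (verit) power2_le_imp_le)
    fix t assume t: "t \<in> S"
    have "\<bar>comb (a m) t - comb (a n) t\<bar> \<le> e * sqrt (Q t t)" if "m \<ge> n0" for m
    proof -
      have "\<bar>comb (a m) t - comb (a n) t\<bar> \<le> nrm (\<lambda>s. a m s - a n s) * sqrt (Q t t)"
        using comb_le[OF coeffs_on_diff[OF ca ca] t, of m n] by (simp add: comb_diff ca)
      also have "\<dots> \<le> e * sqrt (Q t t)"
        using n0[OF that n(2)] Q_nonneg[OF t] by (intro mult_right_mono) auto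
      finally show ?thesis .
    qed
    moreover have "(\<lambda>m. \<bar>comb (a m) t - comb (a n) t\<bar>) \<longlonglongrightarrow> \<bar>h t - comb (a n) t\<bar>"
      using a t by (intro tendsto_intros) (auto simp: rkhs_approx_def)
    ultimately show "\<bar>h t - comb (a n) t\<bar> \<le> e * sqrt (Q t t)"
      by (intro LIMSEQ_le_const2) auto
  qed (rule ca)
qed

text \<open>Cauchy-Schwarz carried to the completion. Together with its converse
  \<open>rkhs_unit_ballI\<close> it describes the ball by inequalities that survive pointwise
  limits, so that they can be checked on limit points of paths.\<close>

lemma rkhs_unit_ball_bound:
  assumes h: "h \<in> rkhs_unit_ball Q S" and b: "b \<in> coeffs_on S"
  shows "\<bar>coeff_lin b h\<bar> \<le> nrm b"
proof -
  from h obtain a where a: "rkhs_approx Q S a h" and le: "sqrt (rkhs_inner Q S h h) \<le> 1"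
    by (auto simp: rkhs_unit_ball_def rkhs_def)
  have ca: "a n \<in> coeffs_on S" for n
    using a by (auto simp: rkhs_approx_def)
  have "(\<lambda>n. sqrt ((nrm (a n))\<^sup>2) * nrm b) \<longlonglongrightarrow> sqrt (rkhs_inner Q S h h) * nrm b"
    by (intro tendsto_intros rkhs_inner_self[OF a])
  then have "(\<lambda>n. nrm (a n) * nrm b) \<longlonglongrightarrow> sqrt (rkhs_inner Q S h h) * nrm b"
    by (simp add: nrm_nonneg ca)
  then have "\<bar>coeff_lin b h\<bar> \<le> sqrt (rkhs_inner Q S h h) * nrm b"
    by (rule LIMSEQ_le[OF tendsto_rabs[OF ip_approx_tendsto[OF a b]]]) (auto intro!: ip_le ca b)
  also have "\<dots> \<le> nrm b"
    using mult_right_mono[OF le nrm_nonneg[OF b]] by simp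
  finally show ?thesis .
qed

text \<open>
  The Riesz representer of \<open>coeff_lin \<cdot> h\<close> is the limit of a maximising sequence of the concave
  functional \<open>2 coeff_lin a h - \<langle>a, a\<rangle>\<close>, which the parallelogram identity makes a Cauchy sequence.
\<close>

lemma rkhs_unit_ballI:
  assumes ext: "h \<in> extensional S"
    and bd: "\<And>b. b \<in> coeffs_on S \<Longrightarrow> \<bar>coeff_lin b h\<bar> \<le> nrm b"
  shows "h \<in> rkhs_unit_ball Q S"
proof -
  define J where "J a = 2 * coeff_lin a h - ip a a" for a
  have J_le: "J a \<le> 1" if "a \<in> coeffs_on S" for a
  proof -
    \<comment> \<open>With \<open>x = nrm a\<close> the claim reduces to
      \<open>2 * x - x * x\<close> being at most 1.\<close>
    have "0 \<le> (nrm a - 1)\<^sup>2" by simp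
    then show ?thesis
      using bd[OF that] nrm_sq[OF that] by (simp add: J_def power2_diff)
  qed
  define s where "s = (SUP a\<in>coeffs_on S. J a)"
  have bdd: "bdd_above (J ` coeffs_on S)"
    using J_le by (auto intro!: bdd_aboveI)
  have J_le_s: "J a \<le> s" if "a \<in> coeffs_on S" for a
    unfolding s_def by (rule cSUP_upper[OF that bdd])
  have "\<exists>a\<in>coeffs_on S. s - 1 / Suc n < J a" for n
    unfolding s_def using less_cSUP_iff[OF _ bdd, of "s - 1 / Suc n"] coeffs_on_zero
    by (auto simp: s_def)
  then obtain a where ca: "\<And>n. a n \<in> coeffs_on S" and a: "\<And>n. s - 1 / Suc n < J (a n)"
    by metis
  have J_add: "J (\<lambda>s. a n s + r * b s) = J (a n) + 2 * r * (coeff_lin b h - ip (a n) b) - r\<^sup>2 * ip b b"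
    if "b \<in> coeffs_on S" for n r b
    using ip_lincomb_self[OF ca that, of n r] coeff_lin_lincomb[of "a n" b r h]
    by (simp add: J_def coeffs_onD ca that coeffs_onD(1)[OF ca] coeffs_onD(1)[OF that] algebra_simps)
  have diff: "(nrm (\<lambda>s. a m s - a n s))\<^sup>2 \<le> 2 / Suc m + 2 / Suc n" for m n
  proof -
    let ?d = "\<lambda>s. a m s - a n s"
    have cd: "?d \<in> coeffs_on S" by (intro coeffs_on_diff ca)
    have m: "J (a m) = J (a n) + 2 * (coeff_lin ?d h - ip (a n) ?d) - ip ?d ?d"
      using J_add[OF cd, of n 1] by simp
    \<comment> \<open>The midpoint of \<open>a m\<close> and \<open>a n\<close>: both are nearly
      maximal and the midpoint cannot exceed \<open>s\<close>, which leaves no room for a long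
      difference.\<close>
    have "J (\<lambda>s. a n s + 1/2 * ?d s) = J (a n) + (coeff_lin ?d h - ip (a n) ?d) - ip ?d ?d / 4"
      using J_add[OF cd, of n "1/2"] by (simp add: power2_eq_square)
    with m have "ip ?d ?d = 4 * J (\<lambda>s. a n s + 1/2 * ?d s) - 2 * J (a m) - 2 * J (a n)"
      by (simp add: algebra_simps)
    also have "\<dots> \<le> 4 * s - 2 * (s - 1 / Suc m) - 2 * (s - 1 / Suc n)"
      using J_le_s[OF coeffs_on_lincomb[OF ca cd], of n "1/2"] a[of m] a[of n] by simp
    finally show ?thesis
      by (simp add: nrm_sq cd)
  qed
  have cauchy: "\<exists>n0. \<forall>m\<ge>n0. \<forall>n\<ge>n0. nrm (\<lambda>s. a m s - a n s) < e" if "e > 0" for e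
  proof -
    obtain n0 where n0: "inverse (real (Suc n0)) < e\<^sup>2 / 4"
      using reals_Archimedean[of "e\<^sup>2/4"] \<open>e > 0\<close> by auto
    have "nrm (\<lambda>s. a m s - a n s) < e" if "m \<ge> n0" "n \<ge> n0" for m n
    proof -
      have "(nrm (\<lambda>s. a m s - a n s))\<^sup>2 \<le> 2 / Suc m + 2 / Suc n" by (rule diff)
      also have "\<dots> \<le> 2 / Suc n0 + 2 / Suc n0"
        using that by (intro add_mono divide_left_mono) auto
      also have "\<dots> < e\<^sup>2"
        using n0 by (simp add: inverse_eq_divide)
      finally show ?thesis
        using \<open>e > 0\<close> power2_less_imp_less[of _ e] by simp
    qed
    then show ?thesis by blast
  qed
  have conv: "(\<lambda>n. comb (a n) t) \<longlonglongrightarrow> h t" if t: "t \<in> S" for t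
  proof -
    have bound: "\<bar>h t - comb (a n) t\<bar> \<le> (1 + Q t t) / 2 * (1 / sqrt (Suc n))" for n
    proof -
      \<comment> \<open>The step length \<open>x\<close> balances the defect
        \<open>1 / Suc n\<close> of maximality against the quadratic term of \<open>J\<close> in the
        direction \<open>unit_coeff t\<close>.\<close>
      define x where "x = 1 / sqrt (real (Suc n))"
      have x: "x > 0" "x\<^sup>2 = 1 / Suc n" by (auto simp: x_def power_divide)
      have *: "2 * r * (h t - comb (a n) t) \<le> x\<^sup>2 + r\<^sup>2 * Q t t" for r
        using J_le_s[OF coeffs_on_lincomb[OF ca coeffs_on_unit[OF t]], of n r] a[of n]
        by (simp add: J_add coeffs_on_unit t coeff_lin_unit ip_unit comb_unit x(2))
      have "2 * x * \<bar>h t - comb (a n) t\<bar> \<le> x\<^sup>2 + x\<^sup>2 * Q t t"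
        using *[of x] *[of "-x"] by (simp add: abs_if algebra_simps)
      then have "x * (2 * \<bar>h t - comb (a n) t\<bar>) \<le> x * (x * (1 + Q t t))"
        by (simp add: algebra_simps power2_eq_square)
      then have "2 * \<bar>h t - comb (a n) t\<bar> \<le> x * (1 + Q t t)"
        using x(1) mult_le_cancel_left_pos by blast
      then show ?thesis
        unfolding x_def[symmetric] by (simp add: algebra_simps)
    qed
    have "(\<lambda>n. (1 + Q t t) / 2 * (1 / sqrt (Suc n))) \<longlonglongrightarrow> (1 + Q t t) / 2 * 0"
      by (intro tendsto_mult tendsto_const) real_asymp
    then have "(\<lambda>n. (1 + Q t t) / 2 * (1 / sqrt (Suc n))) \<longlonglongrightarrow> 0"
      by simp
    moreover have "norm (comb (a n) t - h t) \<le> (1 + Q t t) / 2 * (1 / sqrt (Suc n))" for n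
      using bound[of n] unfolding real_norm_def by (subst abs_minus_commute)
    ultimately have "(\<lambda>n. comb (a n) t - h t) \<longlonglongrightarrow> 0"
      by (metis (no_types, lifting) Lim_null_comparison always_eventually)
    then show ?thesis
      by (simp add: LIM_zero_iff)
  qed
  have approx: "rkhs_approx Q S a h"
    unfolding rkhs_approx_def using ca cauchy ext conv by blast
  have "(\<lambda>n. sqrt ((nrm (a n))\<^sup>2)) \<longlonglongrightarrow> sqrt (rkhs_inner Q S h h)"
    by (intro tendsto_intros rkhs_inner_self[OF approx])
  then have lim: "(\<lambda>n. nrm (a n)) \<longlonglongrightarrow> sqrt (rkhs_inner Q S h h)"
    by (simp add: nrm_nonneg ca)
  have "sqrt (rkhs_inner Q S h h) \<le> 1 + e" if "e > 0" for e
  proof -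
    obtain n0 where n0: "\<And>m n. m \<ge> n0 \<Longrightarrow> n \<ge> n0 \<Longrightarrow> nrm (\<lambda>s. a m s - a n s) < e"
      using cauchy[OF \<open>e > 0\<close>] by blast
    have "nrm (a n) \<le> 1 + e" if n: "n \<ge> n0" for n
    proof (cases "nrm (a n) = 0")
      case False
      then have pos: "nrm (a n) > 0" using nrm_nonneg[OF ca, of n] by simp
      \<comment> \<open>\<open>coeff_lin (a n) h\<close> is the limit of
        \<open>ip (a m) (a n)\<close>, which is the squared norm up to \<open>e * nrm (a n)\<close>.
        The hypothesis bounds it by \<open>nrm (a n)\<close>, and one factor of the norm
        cancels.\<close>
      have "(nrm (a n))\<^sup>2 - e * nrm (a n) \<le> coeff_lin (a n) h"
      proof (rule LIMSEQ_le_const[OF ip_approx_tendsto[OF approx ca]], intro exI allI impI)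
        fix m assume m: "m \<ge> n0"
        have "ip (a n) (a n) - ip (a m) (a n) = ip (\<lambda>s. a n s - a m s) (a n)"
          using ip_lin1[OF ca ca, of n "-1" m "a n"] by simp
        also have "\<dots> \<le> nrm (\<lambda>s. a n s - a m s) * nrm (a n)"
          using ip_le[OF coeffs_on_diff[OF ca ca] ca, of n m n] by simp
        also have "\<dots> \<le> e * nrm (a n)"
          using n0[OF n m] pos by (intro mult_right_mono) auto
        finally show "(nrm (a n))\<^sup>2 - e * nrm (a n) \<le> ip (a m) (a n)"
          by (simp add: nrm_sq ca)
      qed
      also have "\<dots> \<le> nrm (a n)"
        using bd[OF ca, of n] by simp
      finally have "nrm (a n) * (nrm (a n) - e - 1) \<le> 0"
        by (simp add: algebra_simps power2_eq_square)
      with pos show ?thesis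
        by (simp add: mult_le_0_iff)
    qed (use \<open>e > 0\<close> in simp)
    then show ?thesis
      by (intro LIMSEQ_le_const2[OF lim]) auto
  qed
  then have "sqrt (rkhs_inner Q S h h) \<le> 1"
    by (rule field_le_epsilon)
  with approx show ?thesis
    unfolding rkhs_unit_ball_def rkhs_def by blast
qed

lemma rkhs_unit_ball_extensional: "h \<in> rkhs_unit_ball Q S \<Longrightarrow> h \<in> extensional S"
  by (auto simp: rkhs_unit_ball_def rkhs_def rkhs_approx_def)

text \<open>Strict convexity of the unit ball.\<close>

lemma rkhs_unit_ball_peak:
  assumes h: "h \<in> rkhs_unit_ball Q S" and b: "b \<in> coeffs_on S"
    and peak: "nrm b \<le> coeff_lin b h" and t: "t \<in> S"
  shows "nrm b * h t = comb b t"
proof -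
  have eq: "coeff_lin b h = nrm b"
    using peak rkhs_unit_ball_bound[OF h b] by simp
  \<comment> \<open>The inequality of \<open>rkhs_unit_ball_bound\<close> is an equality at
    \<open>b\<close>. Perturbing \<open>b\<close> by \<open>x * unit_coeff t\<close> therefore gives
    a nonnegative quadratic in \<open>x\<close> without constant term, whose linear coefficient must
    vanish.\<close>
  have "0 \<le> 0 + 2 * x * (comb b t - nrm b * h t) + x\<^sup>2 * Q t t" for x
  proof -
    let ?b = "\<lambda>s. b s + x * unit_coeff t s"
    have "?b \<in> coeffs_on S"
      by (intro coeffs_on_lincomb b coeffs_on_unit t)
    then have "\<bar>coeff_lin ?b h\<bar>\<^sup>2 \<le> (nrm ?b)\<^sup>2" "(nrm ?b)\<^sup>2 = ip ?b ?b"
      by (intro power_mono rkhs_unit_ball_bound[OF h] nrm_sq abs_ge_zero; assumption)+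
    moreover have "coeff_lin ?b h = nrm b + x * h t"
      using b coeffs_on_unit[OF t] by (simp add: coeff_lin_lincomb coeffs_onD coeff_lin_unit eq)
    moreover have "ip ?b ?b = (nrm b)\<^sup>2 + 2 * x * comb b t + x\<^sup>2 * Q t t"
      using b coeffs_on_unit[OF t] by (simp add: nrm_sq ip_lincomb_self ip_unit comb_unit)
    ultimately have "(nrm b + x * h t)\<^sup>2 \<le> (nrm b)\<^sup>2 + 2 * x * comb b t + x\<^sup>2 * Q t t"
      by simp
    then have "0 \<le> 2 * x * (comb b t - nrm b * h t) + x\<^sup>2 * Q t t - (x * h t)\<^sup>2"
      by (simp add: power2_sum algebra_simps)
    moreover have "0 \<le> (x * h t)\<^sup>2" by simp
    ultimately show ?thesis by linarith
  qed
  then have "(comb b t - nrm b * h t)\<^sup>2 \<le> 0 * Q t t"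
    using Q_nonneg[OF t] by (rule discriminant_le)
  then show ?thesis by simp
qed

end

section \<open>Uniqueness of multivariate characteristic functions\<close>

text \<open>Divided by its mass \<open>c\<close>, a nonnegative weight is a probability density, and
  Levy uniqueness applies to the law of \<open>Y\<close> under it. The hypothesis at
  \<open>t = 0\<close> says that both masses agree; mass 0 is treated apart, since then nothing can
  be normalised.\<close>

lemma weighted_char_eq:
  fixes Y g :: "'a \<Rightarrow> real" and Y' g' :: "'b \<Rightarrow> real" and C :: real
  assumes M: "prob_space M" and N: "prob_space N"
    and [measurable]: "Y \<in> borel_measurable M" "g \<in> borel_measurable M"
    and [measurable]: "Y' \<in> borel_measurable N" "g' \<in> borel_measurable N"
    and g: "\<And>x. 0 \<le> g x" "\<And>x. g x \<le> C" and g': "\<And>x. 0 \<le> g' x" "\<And>x. g' x \<le> C"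
    and eq: "\<And>t. (CLINT x|M. g x * iexp (t * Y x)) = (CLINT x|N. g' x * iexp (t * Y' x))"
    and S[measurable]: "S \<in> sets borel"
  shows "(LINT x|M. g x * indicator S (Y x)) = (LINT x|N. g' x * indicator S (Y' x))"
proof -
  interpret M: prob_space M by fact
  interpret N: prob_space N by fact
  have int: "integrable M g" "integrable N g'"
    using g g' by (auto intro!: M.integrable_const_bound[where B=C] N.integrable_const_bound[where B=C])
  define c where "c = (LINT x|M. g x)"
  have "complex_of_real c = complex_of_real (LINT x|N. g' x)"
    using eq[of 0] by (simp add: c_def)
  then have c': "c = (LINT x|N. g' x)"
    by (simp only: of_real_eq_iff)
  have "c \<ge> 0"
    unfolding c_def using g by (intro integral_nonneg_AE) auto
  show ?thesis
  proof (cases "c = 0")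
    case True
    have "AE x in M. g x = 0"
      using integral_nonneg_eq_0_iff_AE[OF int(1)] g True by (auto simp: c_def)
    then have "(LINT x|M. g x * indicator S (Y x)) = (LINT x|M. 0)"
      by (intro integral_cong_AE) auto
    moreover have "AE x in N. g' x = 0"
      using integral_nonneg_eq_0_iff_AE[OF int(2)] g' True c' by auto
    then have "(LINT x|N. g' x * indicator S (Y' x)) = (LINT x|N. 0)"
      by (intro integral_cong_AE) auto
    ultimately show ?thesis by simp
  next
    case False
    with \<open>c \<ge> 0\<close> have "c > 0" by simp
    define D D' where "D = distr (density M (\<lambda>x. ennreal (g x / c))) borel Y"
      and "D' = distr (density N (\<lambda>x. ennreal (g' x / c))) borel Y'"
    have nn: "(\<integral>\<^sup>+ x. ennreal (g x / c) \<partial>M) = 1" "(\<integral>\<^sup>+ x. ennreal (g' x / c) \<partial>N) = 1"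
      using int g g' \<open>c > 0\<close> c'
      by (subst nn_integral_eq_integral; force simp: c_def)+
    have "prob_space (density M (\<lambda>x. ennreal (g x / c)))" "prob_space (density N (\<lambda>x. ennreal (g' x / c)))"
      by (rule prob_spaceI; simp add: emeasure_density nn cong: nn_integral_cong)+
    then have "real_distribution D" "real_distribution D'"
      unfolding D_def D'_def real_distribution_def real_distribution_axioms_def
      by (auto intro!: prob_space.prob_space_distr)
    moreover have "char D = char D'"
    proof
      fix t
      have "char D t = (CLINT x|M. (g x / c) *\<^sub>R iexp (t * Y x))"
        unfolding char_def D_def using g \<open>c > 0\<close>
        by (subst integral_distr) (auto simp: integral_density)
      also have "\<dots> = (CLINT x|M. g x * iexp (t * Y x)) / c"
        by (simp add: scaleR_conv_of_real)
      also have "\<dots> = (CLINT x|N. (g' x / c) *\<^sub>R iexp (t * Y' x))"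
        unfolding eq by (simp add: scaleR_conv_of_real)
      also have "\<dots> = char D' t"
        unfolding char_def D'_def using g' \<open>c > 0\<close>
        by (subst integral_distr) (auto simp: integral_density)
      finally show "char D t = char D' t" .
    qed
    ultimately have "D = D'"
      by (rule Levy_uniqueness)
    moreover have "(LINT y|D. indicator S y) = (LINT x|M. g x * indicator S (Y x)) / c"
      unfolding D_def using g \<open>c > 0\<close>
      by (subst integral_distr) (auto simp: integral_density)
    moreover have "(LINT y|D'. indicator S y) = (LINT x|N. g' x * indicator S (Y' x)) / c"
      unfolding D'_def using g' \<open>c > 0\<close>
      by (subst integral_distr) (auto simp: integral_density)
    ultimately show ?thesis
      using \<open>c > 0\<close> by (simp add: divide_eq_eq)
  qed
qed

text \<open>
  Coordinates are moved one at a time from the exponential to the rectangle \<open>S\<close>.  The remaining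
  complex weight is replaced by the nonnegative weights \<open>1 + cos\<close> and \<open>1 + sin\<close>, to which the
  one-dimensional uniqueness theorem applies.
\<close>

lemma joint_char_eq_mixed:
  fixes Y :: "'i \<Rightarrow> 'a \<Rightarrow> real" and Y' :: "'i \<Rightarrow> 'b \<Rightarrow> real"
  assumes M: "prob_space M" and N: "prob_space N" and "finite J"
    and Y: "\<And>j. j \<in> J \<Longrightarrow> Y j \<in> borel_measurable M" and Y': "\<And>j. j \<in> J \<Longrightarrow> Y' j \<in> borel_measurable N"
    and eq: "\<And>t. (CLINT x|M. iexp (\<Sum>j\<in>J. t j * Y j x)) = (CLINT x|N. iexp (\<Sum>j\<in>J. t j * Y' j x))"
    and S: "\<And>j. j \<in> J \<Longrightarrow> S j \<in> sets borel"
    and P: "finite P" "P \<subseteq> J"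
  shows "(CLINT x|M. (\<Prod>j\<in>P. indicator (S j) (Y j x)) * iexp (\<Sum>j\<in>J - P. t j * Y j x)) =
    (CLINT x|N. (\<Prod>j\<in>P. indicator (S j) (Y' j x)) * iexp (\<Sum>j\<in>J - P. t j * Y' j x))"
  using P
proof (induction P arbitrary: t rule: finite_induct)
  case empty
  then show ?case using eq by simp
next
  case (insert k P)
  interpret M: prob_space M by fact
  interpret N: prob_space N by fact
  define R where "R = J - insert k P"
  have J: "J - P = insert k R" "k \<notin> R" "finite R" "R \<subseteq> J" "P \<subseteq> J" "k \<in> J" "finite P"
    using insert \<open>finite J\<close> by (auto simp: R_def)
  define f where "f x = (\<Prod>j\<in>P. indicator (S j) (Y j x) :: real)" for x
  define f' where "f' x = (\<Prod>j\<in>P. indicator (S j) (Y' j x) :: real)" for x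
  define L where "L x = (\<Sum>j\<in>R. t j * Y j x)" for x
  define L' where "L' x = (\<Sum>j\<in>R. t j * Y' j x)" for x
  have [measurable]: "Y k \<in> borel_measurable M" "Y' k \<in> borel_measurable N"
    "L \<in> borel_measurable M" "L' \<in> borel_measurable N" "S k \<in> sets borel"
    unfolding L_def L'_def using J Y Y' S by (auto intro!: borel_measurable_sum)
  have ind[measurable]: "(\<lambda>x. indicator (S j) (Y j x) :: real) \<in> borel_measurable M"
    "(\<lambda>x. indicator (S j) (Y' j x) :: real) \<in> borel_measurable N" if "j \<in> J" for j
    using Y[OF that] Y'[OF that] S[OF that] by measurable
  have [measurable]: "f \<in> borel_measurable M" "f' \<in> borel_measurable N"
    unfolding f_def f'_def using J ind by (auto intro!: borel_measurable_prod)
  have f01: "0 \<le> f x" "f x \<le> 1" for x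
    unfolding f_def by (auto intro!: prod_nonneg prod_le_1)
  have f'01: "0 \<le> f' x" "f' x \<le> 1" for x
    unfolding f'_def by (auto intro!: prod_nonneg prod_le_1)
  have bd: "integrable M (\<lambda>x. complex_of_real (f x) * iexp (l x))"
    if "l \<in> borel_measurable M" for l
    using that f01 by (intro M.integrable_const_bound[where B=1]) (auto simp: norm_mult)
  have bd': "integrable N (\<lambda>x. complex_of_real (f' x) * iexp (l x))"
    if "l \<in> borel_measurable N" for l
    using that f'01 by (intro N.integrable_const_bound[where B=1]) (auto simp: norm_mult)
  \<comment> \<open>Two free frequencies: \<open>s\<close> for the coordinate about to be moved, and
    a common factor \<open>r\<close> for the others. The expansion of the cosine weight needs
    \<open>r\<close> equal to 0, 1 and -1.\<close>
  have IH: "(CLINT x|M. f x * iexp (r * L x + s * Y k x)) = (CLINT x|N. f' x * iexp (r * L' x + s * Y' k x))" for r s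
  proof -
    define t' where "t' j = (if j = k then s else r * t j)" for j
    have sum: "(\<Sum>j\<in>J - P. t' j * y j) = r * (\<Sum>j\<in>R. t j * y j) + s * y k" for y
    proof -
      have "(\<Sum>j\<in>R. t' j * y j) = (\<Sum>j\<in>R. r * (t j * y j))"
        using J(2) by (intro sum.cong) (auto simp: t'_def)
      then show ?thesis
        unfolding J(1) using J by (simp add: t'_def sum_distrib_left)
    qed
    show ?thesis
      using insert.IH[OF J(5), of t'] unfolding sum f_def f'_def L_def L'_def
      by (simp add: of_real_indicator)
  qed
  have trig: "(LINT x|M. f x * (1 + cos (L x + b)) * indicator (S k) (Y k x)) =
    (LINT x|N. f' x * (1 + cos (L' x + b)) * indicator (S k) (Y' k x))" for b
  proof (rule weighted_char_eq[OF M N, where C=2])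
    fix s
    have e: "complex_of_real (g * (1 + cos (l + b))) * iexp (s * y) =
        g * iexp (0 * l + s * y) + (iexp b / 2) * (g * iexp (1 * l + s * y))
        + (iexp (-b) / 2) * (g * iexp (- 1 * l + s * y))"
      for g l y
      by (simp add: cos_of_real[symmetric] cos_exp_eq field_simps exp_add exp_minus exp_diff del: cos_of_real)
    have lin: "(CLINT x|K. A x + c * E x + d * F x) = (CLINT x|K. A x) + c * (CLINT x|K. E x) + d * (CLINT x|K. F x)"
      if "integrable K A" "integrable K E" "integrable K F" for K :: "'c measure" and A E F c d
      using that by simp
    have "(CLINT x|M. complex_of_real (f x * (1 + cos (L x + b))) * iexp (s * Y k x)) =
        (CLINT x|M. f x * iexp (0 * L x + s * Y k x))
        + (iexp b / 2) * (CLINT x|M. f x * iexp (1 * L x + s * Y k x))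
        + (iexp (-b) / 2) * (CLINT x|M. f x * iexp (- 1 * L x + s * Y k x))"
      unfolding e by (intro lin bd) measurable
    also have "\<dots> = (CLINT x|N. f' x * iexp (0 * L' x + s * Y' k x))
        + (iexp b / 2) * (CLINT x|N. f' x * iexp (1 * L' x + s * Y' k x))
        + (iexp (-b) / 2) * (CLINT x|N. f' x * iexp (- 1 * L' x + s * Y' k x))"
      by (simp only: IH)
    also have "\<dots> = (CLINT x|N. complex_of_real (f' x * (1 + cos (L' x + b))) * iexp (s * Y' k x))"
      unfolding e by (intro lin[symmetric] bd') measurable
    finally show "(CLINT x|M. complex_of_real (f x * (1 + cos (L x + b))) * iexp (s * Y k x)) =
      (CLINT x|N. complex_of_real (f' x * (1 + cos (L' x + b))) * iexp (s * Y' k x))" .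
  next
    fix x
    show "0 \<le> f x * (1 + cos (L x + b))"
      using f01(1)[of x] cos_ge_minus_one[of "L x + b"] by (metis add.commute diff_ge_0_iff_ge diff_minus_eq_add mult_nonneg_nonneg)
    have "f x * (1 + cos (L x + b)) \<le> 1 * 2"
    proof (rule mult_mono)
      show "1 + cos (L x + b) \<le> 2" "0 \<le> 1 + cos (L x + b)"
        using cos_ge_minus_one[of "L x + b"] cos_le_one[of "L x + b"] by linarith+
    qed (use f01 in auto)
    then show "f x * (1 + cos (L x + b)) \<le> 2" by simp
  next
    fix x
    show "0 \<le> f' x * (1 + cos (L' x + b))"
      using f'01(1)[of x] cos_ge_minus_one[of "L' x + b"] by (metis add.commute diff_ge_0_iff_ge diff_minus_eq_add mult_nonneg_nonneg)
    have "f' x * (1 + cos (L' x + b)) \<le> 1 * 2"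
    proof (rule mult_mono)
      show "1 + cos (L' x + b) \<le> 2" "0 \<le> 1 + cos (L' x + b)"
        using cos_ge_minus_one[of "L' x + b"] cos_le_one[of "L' x + b"] by linarith+
    qed (use f'01 in auto)
    then show "f' x * (1 + cos (L' x + b)) \<le> 2" by simp
  qed auto
  \<comment> \<open>The constant part of the weight \<open>1 + cos\<close>; subtracting it isolates
    the cosine, which has no sign of its own.\<close>
  have plain: "(LINT x|M. f x * indicator (S k) (Y k x)) = (LINT x|N. f' x * indicator (S k) (Y' k x))"
  proof (rule weighted_char_eq[OF M N, where C=1])
    show "(CLINT x|M. f x * iexp (s * Y k x)) = (CLINT x|N. f' x * iexp (s * Y' k x))" for s
      using IH[of 0 s] by simp
  qed (use f01 f'01 in auto)
  have le1: "norm (w * c * indicator A y) \<le> 1" if "0 \<le> w" "w \<le> 1" "\<bar>c\<bar> \<le> 1" for w c y :: real and A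
    using that mult_le_one[of w "\<bar>c\<bar>"] by (auto simp: abs_mult split: split_indicator)
  have int: "integrable M (\<lambda>x. f x * 1 * indicator (S k) (Y k x))"
      "integrable M (\<lambda>x. f x * cos (L x + b) * indicator (S k) (Y k x))" for b
    by (rule M.integrable_const_bound[where B=1]; (intro AE_I2 le1 f01; simp)?; measurable)+
  have int': "integrable N (\<lambda>x. f' x * 1 * indicator (S k) (Y' k x))"
      "integrable N (\<lambda>x. f' x * cos (L' x + b) * indicator (S k) (Y' k x))" for b
    by (rule N.integrable_const_bound[where B=1]; (intro AE_I2 le1 f'01; simp)?; measurable)+
  have cs: "(LINT x|M. f x * cos (L x + b) * indicator (S k) (Y k x)) =
    (LINT x|N. f' x * cos (L' x + b) * indicator (S k) (Y' k x))" for b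
  proof -
    have "(LINT x|M. f x * (1 + cos (L x + b)) * indicator (S k) (Y k x)) =
        (LINT x|M. f x * indicator (S k) (Y k x)) + (LINT x|M. f x * cos (L x + b) * indicator (S k) (Y k x))"
      using int by (subst Bochner_Integration.integral_add[symmetric]) (auto simp: algebra_simps)
    moreover have "(LINT x|N. f' x * (1 + cos (L' x + b)) * indicator (S k) (Y' k x)) =
        (LINT x|N. f' x * indicator (S k) (Y' k x)) + (LINT x|N. f' x * cos (L' x + b) * indicator (S k) (Y' k x))"
      using int' by (subst Bochner_Integration.integral_add[symmetric]) (auto simp: algebra_simps)
    ultimately show ?thesis using trig[of b] plain by simp
  qed
  \<comment> \<open>The phases 0 and \<open>pi / 2\<close> recover the real and imaginary parts,
    since \<open>cos (l + pi / 2) = - sin l\<close>.\<close>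
  have split: "complex_of_real (g * indicator (S k) y) * iexp l =
      complex_of_real (g * cos (l + 0) * indicator (S k) y)
      - \<i> * complex_of_real (g * cos (l + pi / 2) * indicator (S k) y)" for g l y
    unfolding cos_add by (simp add: exp_Euler cos_of_real sin_of_real algebra_simps split: split_indicator)
  have "(CLINT x|M. complex_of_real (f x * indicator (S k) (Y k x)) * iexp (L x)) =
    (CLINT x|N. complex_of_real (f' x * indicator (S k) (Y' k x)) * iexp (L' x))"
  proof -
    have lin: "(CLINT x|K. complex_of_real (E x) - \<i> * complex_of_real (F x)) =
        complex_of_real (LINT x|K. E x) - \<i> * complex_of_real (LINT x|K. F x)"
      if "integrable K E" "integrable K F" for K :: "'c measure" and E F
      using that by simp
    show ?thesis
      unfolding split lin[OF int(2) int(2)] lin[OF int'(2) int'(2)] cs ..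
  qed
  then show ?case
    using insert.hyps unfolding R_def[symmetric] f_def f'_def L_def L'_def
    by (simp add: mult_ac of_real_indicator)
qed

text \<open>The mixed identity with every coordinate moved, so that the exponential is 1. Rectangles
  are enough: the events compared later all constrain finitely many linear combinations
  separately.\<close>

lemma joint_char_eq_imp_prob_eq:
  fixes Y :: "'i \<Rightarrow> 'a \<Rightarrow> real" and Y' :: "'i \<Rightarrow> 'b \<Rightarrow> real"
  assumes M: "prob_space M" and N: "prob_space N" and "finite J"
    and Y: "\<And>j. j \<in> J \<Longrightarrow> Y j \<in> borel_measurable M" and Y': "\<And>j. j \<in> J \<Longrightarrow> Y' j \<in> borel_measurable N"
    and eq: "\<And>t. (CLINT x|M. iexp (\<Sum>j\<in>J. t j * Y j x)) = (CLINT x|N. iexp (\<Sum>j\<in>J. t j * Y' j x))"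
    and S: "\<And>j. j \<in> J \<Longrightarrow> S j \<in> sets borel"
  shows "measure M {x \<in> space M. \<forall>j\<in>J. Y j x \<in> S j} = measure N {x \<in> space N. \<forall>j\<in>J. Y' j x \<in> S j}"
proof -
  interpret M: prob_space M by fact
  interpret N: prob_space N by fact
  have prod: "(\<Prod>j\<in>J. indicator (S j) (y j)) = (of_bool (\<forall>j\<in>J. y j \<in> S j) :: complex)" for y :: "'i \<Rightarrow> real"
    using \<open>finite J\<close> by (induction J) (auto simp: indicator_def)
  have ms: "{x \<in> space M. \<forall>j\<in>J. Y j x \<in> S j} \<in> sets M" "{x \<in> space N. \<forall>j\<in>J. Y' j x \<in> S j} \<in> sets N"
    using Y Y' S \<open>finite J\<close> by (auto intro!: sets.sets_Collect_finite_All' measurable_sets_Collect)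
  have int: "(CLINT x|K. indicator A x) = complex_of_real (measure K A)" if "A \<in> sets K" for K :: "'c measure" and A
  proof -
    have "(CLINT x|K. indicator A x) = (CLINT x|K. complex_of_real (indicator A x))"
      by (simp add: of_real_indicator)
    then show ?thesis
      using sets.sets_into_space[OF that] by (simp add: Int_absorb2)
  qed
  have "(CLINT x|M. indicator {x \<in> space M. \<forall>j\<in>J. Y j x \<in> S j} x) =
    (CLINT x|N. indicator {x \<in> space N. \<forall>j\<in>J. Y' j x \<in> S j} x)"
  proof -
    have "(CLINT x|M. (\<Prod>j\<in>J. indicator (S j) (Y j x)) * iexp (\<Sum>j\<in>J - J. 0 * Y j x)) =
        (CLINT x|N. (\<Prod>j\<in>J. indicator (S j) (Y' j x)) * iexp (\<Sum>j\<in>J - J. 0 * Y' j x))"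
      by (rule joint_char_eq_mixed[OF M N \<open>finite J\<close> Y Y' eq S \<open>finite J\<close> subset_refl])
    then show ?thesis
      by (simp only: prod) (simp add: indicator_def cong: Bochner_Integration.integral_cong)
  qed
  then have "complex_of_real (M.prob {x \<in> space M. \<forall>j\<in>J. Y j x \<in> S j}) =
     complex_of_real (N.prob {x \<in> space N. \<forall>j\<in>J. Y' j x \<in> S j})"
    unfolding int[OF ms(1)] int[OF ms(2)] .
  then show ?thesis by (simp only: of_real_eq_iff)
qed

section \<open>The Wiener integral\<close>

lemma square_integrable_mult:
  fixes f g :: "'a \<Rightarrow> real"
  assumes [measurable]: "f \<in> borel_measurable M" "g \<in> borel_measurable M"
    and int: "integrable M (\<lambda>x. (f x)\<^sup>2)" "integrable M (\<lambda>x. (g x)\<^sup>2)"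
  shows "integrable M (\<lambda>x. f x * g x)"
proof (rule Bochner_Integration.integrable_bound)
  show "integrable M (\<lambda>x. (f x)\<^sup>2 + (g x)\<^sup>2)"
    using int by simp
  show "AE x in M. norm (f x * g x) \<le> norm ((f x)\<^sup>2 + (g x)\<^sup>2)"
  proof (rule AE_I2)
    fix x
    have "0 \<le> (\<bar>f x\<bar> - \<bar>g x\<bar>)\<^sup>2" by simp
    moreover have "0 \<le> (f x)\<^sup>2 + (g x)\<^sup>2" by simp
    ultimately have "2 * (\<bar>f x\<bar> * \<bar>g x\<bar>) \<le> (f x)\<^sup>2 + (g x)\<^sup>2"
      by (simp add: power2_diff)
    with \<open>0 \<le> (f x)\<^sup>2 + (g x)\<^sup>2\<close> show "norm (f x * g x) \<le> norm ((f x)\<^sup>2 + (g x)\<^sup>2)"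
      unfolding real_norm_def abs_mult by linarith
  qed
qed simp

lemma square_integrable_lincomb:
  fixes f g :: "'a \<Rightarrow> real"
  assumes "f \<in> borel_measurable M" "g \<in> borel_measurable M"
    and "integrable M (\<lambda>x. (f x)\<^sup>2)" "integrable M (\<lambda>x. (g x)\<^sup>2)"
  shows "integrable M (\<lambda>x. (f x + r * g x)\<^sup>2)"
    and "(LINT x|M. (f x + r * g x)\<^sup>2) =
      (LINT x|M. (f x)\<^sup>2) + 2 * r * (LINT x|M. f x * g x) + r\<^sup>2 * (LINT x|M. (g x)\<^sup>2)"
proof -
  have eq: "(f x + r * g x)\<^sup>2 = (f x)\<^sup>2 + (2 * r) * (f x * g x) + r\<^sup>2 * (g x)\<^sup>2" for x
    by (simp add: power2_sum power_mult_distrib)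
  show "integrable M (\<lambda>x. (f x + r * g x)\<^sup>2)"
    unfolding eq using assms square_integrable_mult[OF assms] by simp
  show "(LINT x|M. (f x + r * g x)\<^sup>2) =
      (LINT x|M. (f x)\<^sup>2) + 2 * r * (LINT x|M. f x * g x) + r\<^sup>2 * (LINT x|M. (g x)\<^sup>2)"
    unfolding eq using assms square_integrable_mult[OF assms] by simp
qed

lemma Cauchy_Schwarz_LINT:
  fixes f g :: "'a \<Rightarrow> real"
  assumes "f \<in> borel_measurable M" "g \<in> borel_measurable M"
    and "integrable M (\<lambda>x. (f x)\<^sup>2)" "integrable M (\<lambda>x. (g x)\<^sup>2)"
  shows "\<bar>LINT x|M. f x * g x\<bar> \<le> sqrt (LINT x|M. (f x)\<^sup>2) * sqrt (LINT x|M. (g x)\<^sup>2)"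
proof -
  have "(LINT x|M. f x * g x)\<^sup>2 \<le> (LINT x|M. (f x)\<^sup>2) * (LINT x|M. (g x)\<^sup>2)"
  proof (rule discriminant_le)
    show "0 \<le> (LINT x|M. (f x)\<^sup>2) + 2 * r * (LINT x|M. f x * g x) + r\<^sup>2 * (LINT x|M. (g x)\<^sup>2)" for r
      unfolding square_integrable_lincomb(2)[OF assms, symmetric] by simp
  qed simp
  then show ?thesis
    by (metis real_sqrt_abs real_sqrt_le_iff real_sqrt_mult)
qed

text \<open>Nonnegative integrals, as in \<open>is_wiener_integral\<close>, so that the notion makes
  sense before any integrability is known.\<close>

definition L2_tendsto :: "'a measure \<Rightarrow> (nat \<Rightarrow> 'a \<Rightarrow> real) \<Rightarrow> ('a \<Rightarrow> real) \<Rightarrow> bool" where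
  "L2_tendsto M F f \<longleftrightarrow> (\<lambda>n. \<integral>\<^sup>+ x. ennreal ((F n x - f x)\<^sup>2) \<partial>M) \<longlonglongrightarrow> 0"

lemma L2_tendsto_lincomb:
  assumes [measurable]: "\<And>n. F n \<in> borel_measurable M" "f \<in> borel_measurable M"
    "\<And>n. G n \<in> borel_measurable M" "g \<in> borel_measurable M"
    and F: "L2_tendsto M F f" and G: "L2_tendsto M G g"
  shows "L2_tendsto M (\<lambda>n x. F n x + r * G n x) (\<lambda>x. f x + r * g x)"
  unfolding L2_tendsto_def
proof (rule tendsto_sandwich[OF _ _ tendsto_const])
  let ?I = "\<lambda>n. 2 * (\<integral>\<^sup>+ x. ennreal ((F n x - f x)\<^sup>2) \<partial>M) + ennreal (2 * r\<^sup>2) * (\<integral>\<^sup>+ x. ennreal ((G n x - g x)\<^sup>2) \<partial>M)"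
  have "(\<integral>\<^sup>+ x. ennreal ((F n x + r * G n x - (f x + r * g x))\<^sup>2) \<partial>M) \<le> ?I n" for n
  proof -
    have "(\<integral>\<^sup>+ x. ennreal ((F n x + r * G n x - (f x + r * g x))\<^sup>2) \<partial>M)
        \<le> (\<integral>\<^sup>+ x. 2 * ennreal ((F n x - f x)\<^sup>2) + ennreal (2 * r\<^sup>2) * ennreal ((G n x - g x)\<^sup>2) \<partial>M)"
    proof (rule nn_integral_mono)
      fix x
      have "0 \<le> ((F n x - f x) - r * (G n x - g x))\<^sup>2" by simp
      then have "(F n x + r * G n x - (f x + r * g x))\<^sup>2 \<le> 2 * (F n x - f x)\<^sup>2 + 2 * r\<^sup>2 * (G n x - g x)\<^sup>2"
        by (simp add: power2_eq_square algebra_simps)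
      then have "ennreal ((F n x + r * G n x - (f x + r * g x))\<^sup>2) \<le>
          ennreal (2 * (F n x - f x)\<^sup>2 + 2 * r\<^sup>2 * (G n x - g x)\<^sup>2)"
        by (rule ennreal_leI)
      also have "\<dots> = 2 * ennreal ((F n x - f x)\<^sup>2) + ennreal (2 * r\<^sup>2) * ennreal ((G n x - g x)\<^sup>2)"
        by (simp add: ennreal_plus ennreal_mult)
      finally show "ennreal ((F n x + r * G n x - (f x + r * g x))\<^sup>2)
         \<le> 2 * ennreal ((F n x - f x)\<^sup>2) + ennreal (2 * r\<^sup>2) * ennreal ((G n x - g x)\<^sup>2)" .
    qed
    also have "\<dots> = ?I n"
      by (simp add: nn_integral_add nn_integral_cmult)
    finally show ?thesis .
  qed
  then show "\<forall>\<^sub>F n in sequentially. (\<integral>\<^sup>+ x. ennreal ((F n x + r * G n x - (f x + r * g x))\<^sup>2) \<partial>M) \<le> ?I n"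
    by (intro always_eventually allI)
  have "?I \<longlonglongrightarrow> 2 * 0 + ennreal (2 * r\<^sup>2) * 0"
    using F G unfolding L2_tendsto_def
    by (intro tendsto_add ennreal_tendsto_cmult) auto
  then show "?I \<longlonglongrightarrow> 0" by simp
qed auto

text \<open>A single index at which the distance is below 1 makes \<open>F n - f\<close> square
  integrable, and with it \<open>f\<close>. Cauchy-Schwarz then controls the difference of the
  squared norms.\<close>

lemma L2_tendstoD:
  assumes [measurable]: "\<And>n. F n \<in> borel_measurable M" "f \<in> borel_measurable M"
    and F: "L2_tendsto M F f" and int: "\<And>n. integrable M (\<lambda>x. (F n x)\<^sup>2)"
  shows "integrable M (\<lambda>x. (f x)\<^sup>2)"
    and "(\<lambda>n. LINT x|M. (F n x - f x)\<^sup>2) \<longlonglongrightarrow> 0"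
    and "(\<lambda>n. LINT x|M. (F n x)\<^sup>2) \<longlonglongrightarrow> (LINT x|M. (f x)\<^sup>2)"
proof -
  have "\<forall>\<^sub>F n in sequentially. (\<integral>\<^sup>+ x. ennreal ((F n x - f x)\<^sup>2) \<partial>M) < 1"
    using F unfolding L2_tendsto_def by (rule order_tendstoD) simp
  then obtain n where "(\<integral>\<^sup>+ x. ennreal ((F n x - f x)\<^sup>2) \<partial>M) < 1"
    by (metis (mono_tags, lifting) eventually_sequentially order_refl)
  then have "integrable M (\<lambda>x. (F n x - f x)\<^sup>2)"
    by (intro integrableI_nonneg) (auto simp: less_top intro: order.strict_trans[OF _ ennreal_one_less_top])
  from square_integrable_lincomb(1)[OF _ _ int this, of n "-1"]
  show f: "integrable M (\<lambda>x. (f x)\<^sup>2)" by simp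
  have d: "integrable M (\<lambda>x. (F n x - f x)\<^sup>2)" for n
    using square_integrable_lincomb(1)[OF _ _ int f, of n "-1"] by simp
  have "(\<lambda>n. ennreal (LINT x|M. (F n x - f x)\<^sup>2)) \<longlonglongrightarrow> ennreal 0"
    using F unfolding L2_tendsto_def by (simp add: nn_integral_eq_integral d)
  then show d0: "(\<lambda>n. LINT x|M. (F n x - f x)\<^sup>2) \<longlonglongrightarrow> 0"
    by (subst (asm) tendsto_ennreal_iff) auto
  have "(\<lambda>n. (LINT x|M. (F n x)\<^sup>2) - (LINT x|M. (f x)\<^sup>2)) \<longlonglongrightarrow> 0"
  proof (rule Lim_null_comparison)
    let ?d = "\<lambda>n. LINT x|M. (F n x - f x)\<^sup>2"
    show "\<forall>\<^sub>F n in sequentially. norm ((LINT x|M. (F n x)\<^sup>2) - (LINT x|M. (f x)\<^sup>2))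
        \<le> 2 * (sqrt (LINT x|M. (f x)\<^sup>2) * sqrt (?d n)) + ?d n"
    proof (intro always_eventually allI)
      fix n
      have "(LINT x|M. (F n x)\<^sup>2) = (LINT x|M. (f x)\<^sup>2) + 2 * (LINT x|M. f x * (F n x - f x)) + ?d n"
        using square_integrable_lincomb(2)[OF _ _ f d, of n 1] by simp
      moreover have "\<bar>LINT x|M. f x * (F n x - f x)\<bar> \<le> sqrt (LINT x|M. (f x)\<^sup>2) * sqrt (?d n)"
        by (rule Cauchy_Schwarz_LINT[OF _ _ f d]) simp_all
      moreover have "0 \<le> ?d n" by simp
      ultimately show "norm ((LINT x|M. (F n x)\<^sup>2) - (LINT x|M. (f x)\<^sup>2))
        \<le> 2 * (sqrt (LINT x|M. (f x)\<^sup>2) * sqrt (?d n)) + ?d n"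
        unfolding real_norm_def by linarith
    qed
    have "(\<lambda>n. 2 * (sqrt (LINT x|M. (f x)\<^sup>2) * sqrt (?d n)) + ?d n)
        \<longlonglongrightarrow> 2 * (sqrt (LINT x|M. (f x)\<^sup>2) * sqrt 0) + 0"
      by (intro tendsto_intros d0)
    then show "(\<lambda>n. 2 * (sqrt (LINT x|M. (f x)\<^sup>2) * sqrt (?d n)) + ?d n) \<longlonglongrightarrow> 0"
      by simp
  qed
  then show "(\<lambda>n. LINT x|M. (F n x)\<^sup>2) \<longlonglongrightarrow> (LINT x|M. (f x)\<^sup>2)"
    by (rule LIM_zero_cancel)
qed

section \<open>Simple functions as lists\<close>

lemma simple_fun_append: "simple_fun (p @ q) u = simple_fun p u + simple_fun q u"
  by (simp add: simple_fun_def)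

lemma simple_wiener_append: "simple_wiener B (p @ q) \<omega> = simple_wiener B p \<omega> + simple_wiener B q \<omega>"
  by (simp add: simple_wiener_def)

definition scale_list :: "real \<Rightarrow> (real \<times> real set) list \<Rightarrow> (real \<times> real set) list" where
  "scale_list r p = map (\<lambda>(a, A). (r * a, A)) p"

lemma simple_fun_scale: "simple_fun (scale_list r p) u = r * simple_fun p u"
  by (induction p) (auto simp: simple_fun_def scale_list_def algebra_simps)

lemma simple_wiener_scale: "simple_wiener B (scale_list r p) \<omega> = r * simple_wiener B p \<omega>"
  by (induction p) (auto simp: simple_wiener_def scale_list_def algebra_simps)

lemma simple_fun_nth: "simple_fun p u = (\<Sum>i<length p. fst (p ! i) * indicator (snd (p ! i)) u)"
  by (simp add: simple_fun_def sum_list_sum_nth atLeast0LessThan split_beta)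

lemma simple_wiener_nth: "simple_wiener B p \<omega> = (\<Sum>i<length p. fst (p ! i) * B (snd (p ! i)) \<omega>)"
  by (simp add: simple_wiener_def sum_list_sum_nth atLeast0LessThan split_beta)

lemma simple_fun_measurable:
  assumes "\<And>a A. (a, A) \<in> set p \<Longrightarrow> A \<in> sets borel"
  shows "simple_fun p \<in> borel_measurable borel"
proof -
  have "snd (p ! i) \<in> sets borel" if "i < length p" for i
    using assms[of "fst (p ! i)" "snd (p ! i)"] that by simp
  then show ?thesis
    unfolding simple_fun_nth[abs_def]
    by (intro borel_measurable_sum borel_measurable_times borel_measurable_indicator) auto
qed

section \<open>Gaussian random measures on finite disjoint families\<close>

locale gaussian_measure =
  fixes N :: "'b measure" and B :: "real set \<Rightarrow> 'b \<Rightarrow> real"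
  assumes grm: "gaussian_random_measure N B"
begin

sublocale prob_space N
  using grm by (simp add: gaussian_random_measure_def)

lemma B_measurable: "A \<in> fmeasurable lborel \<Longrightarrow> B A \<in> borel_measurable N"
  using grm by (simp add: gaussian_random_measure_def)

lemma B_null: "A \<in> fmeasurable lborel \<Longrightarrow> measure lborel A = 0 \<Longrightarrow> AE \<omega> in N. B A \<omega> = 0"
  using grm by (simp add: gaussian_random_measure_def)

lemma B_normal:
  "A \<in> fmeasurable lborel \<Longrightarrow> measure lborel A \<noteq> 0 \<Longrightarrow>
    distributed N lborel (B A) (normal_density 0 (sqrt (measure lborel A)))"
  using grm by (simp add: gaussian_random_measure_def)

lemma B_sums:
  fixes A :: "nat \<Rightarrow> real set"
  assumes "range A \<subseteq> fmeasurable lborel" "disjoint_family A" "(\<Union>i. A i) \<in> fmeasurable lborel"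
  shows "AE \<omega> in N. (\<lambda>i. B (A i) \<omega>) sums B (\<Union>i. A i) \<omega>"
  using grm[unfolded gaussian_random_measure_def] assms by blast

lemma B_char:
  assumes A: "A \<in> fmeasurable lborel"
  shows "(CLINT \<omega>|N. iexp (t * B A \<omega>)) = exp (- (t\<^sup>2 * measure lborel A) / 2)"
proof (cases "measure lborel A = 0")
  case True
  have "(CLINT \<omega>|N. iexp (t * B A \<omega>)) = (CLINT \<omega>|N. 1)"
    using B_null[OF A True] B_measurable[OF A] by (intro integral_cong_AE) auto
  then show ?thesis using True by (simp add: prob_space)
next
  case False
  define \<sigma> where "\<sigma> = sqrt (measure lborel A)"
  have "\<sigma> > 0" using False by (simp add: \<sigma>_def less_le)
  have Z: "distributed N lborel (\<lambda>\<omega>. B A \<omega> / \<sigma>) std_normal_density"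
    using B_normal[OF A False] normal_standard_normal_convert[OF \<open>\<sigma> > 0\<close>, of "B A" 0]
    by (simp add: \<sigma>_def)
  have "(CLINT \<omega>|N. iexp (t * B A \<omega>)) = (CLINT \<omega>|N. iexp ((t * \<sigma>) * (B A \<omega> / \<sigma>)))"
    using \<open>\<sigma> > 0\<close> by simp
  also have "\<dots> = (CLINT x|distr N lborel (\<lambda>\<omega>. B A \<omega> / \<sigma>). iexp ((t * \<sigma>) * x))"
    using B_measurable[OF A] by (subst integral_distr) auto
  also have "distr N lborel (\<lambda>\<omega>. B A \<omega> / \<sigma>) = std_normal_distribution"
    using Z by (simp add: distributed_def)
  also have "(CLINT x|std_normal_distribution. iexp ((t * \<sigma>) * x)) = char std_normal_distribution (t * \<sigma>)"
    by (simp add: char_def)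
  finally show ?thesis
    by (simp add: char_std_normal_distribution power_mult_distrib \<sigma>_def exp_of_real)
qed

text \<open>Brings finite families under the axioms of \<open>gaussian_random_measure\<close>, which
  speak of sequences.\<close>

lemma finite_family_enum:
  fixes A :: "'i \<Rightarrow> real set"
  assumes "finite S" "disjoint_family_on A S" "\<And>s. s \<in> S \<Longrightarrow> A s \<in> fmeasurable lborel"
  obtains A' :: "nat \<Rightarrow> real set" and e :: "nat \<Rightarrow> 'i" where "bij_betw e {..<card S} S"
    "\<And>n. n < card S \<Longrightarrow> A' n = A (e n)" "\<And>n. n \<ge> card S \<Longrightarrow> A' n = {}"
    "range A' \<subseteq> fmeasurable lborel" "disjoint_family A'"
proof -
  obtain e where e: "bij_betw e {..<card S} S"
    using ex_bij_betw_nat_finite[OF \<open>finite S\<close>] by (auto simp: atLeast0LessThan)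
  define A' where "A' n = (if n < card S then A (e n) else {})" for n
  have "A' m \<inter> A' n = {}" if "m \<noteq> n" for m n
  proof (cases "m < card S \<and> n < card S")
    case True
    then have "e m \<in> S" "e n \<in> S" "e m \<noteq> e n"
      using e that by (auto simp: bij_betw_def inj_on_def)
    then show ?thesis
      using assms(2) True by (auto simp: disjoint_family_on_def A'_def)
  qed (auto simp: A'_def)
  then have "disjoint_family A'"
    by (auto simp: disjoint_family_on_def)
  moreover have "range A' \<subseteq> fmeasurable lborel"
    using assms(3) e by (auto simp: A'_def bij_betw_def)
  ultimately show ?thesis
    using e by (intro that[of e A']) (auto simp: A'_def)
qed

lemma indep_B:
  fixes A :: "'i \<Rightarrow> real set"
  assumes "finite S" "disjoint_family_on A S" "\<And>s. s \<in> S \<Longrightarrow> A s \<in> fmeasurable lborel"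
  shows "indep_vars (\<lambda>_. borel) (\<lambda>s. B (A s)) S"
proof -
  obtain A' :: "nat \<Rightarrow> real set" and e :: "nat \<Rightarrow> 'i" where e: "bij_betw e {..<card S} S"
    and A': "\<And>n. n < card S \<Longrightarrow> A' n = A (e n)"
      "range A' \<subseteq> fmeasurable lborel" "disjoint_family A'"
    using finite_family_enum[OF assms] by metis
  define f where "f = the_inv_into {..<card S} e"
  have f: "bij_betw f S {..<card S}"
    unfolding f_def using e by (rule bij_betw_the_inv_into)
  have eq: "A' (f s) = A s" if "s \<in> S" for s
  proof -
    have "f s < card S" using f that by (auto simp: bij_betw_def)
    moreover have "e (f s) = s"
      unfolding f_def using e that by (intro f_the_inv_into_f_bij_betw) auto
    ultimately show "A' (f s) = A s" by (simp add: A')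
  qed
  have "indep_vars (\<lambda>_. borel) (\<lambda>n. B (A' n)) UNIV"
    using grm A' by (simp add: gaussian_random_measure_def)
  then have ind: "indep_sets (\<lambda>n. {B (A' n) -` D \<inter> space N |D. D \<in> sets borel}) UNIV"
    by (simp add: indep_vars_def2)
  show ?thesis
    unfolding indep_vars_def2
  proof (intro conjI ballI indep_setsI)
    fix s assume s: "s \<in> S"
    then show "B (A s) \<in> borel_measurable N"
      using assms(3) by (intro B_measurable)
    then show "{B (A s) -` D \<inter> space N |D. D \<in> sets borel} \<subseteq> events"
      by (auto intro: measurable_sets)
  next
    fix E J assume J: "J \<noteq> {}" "J \<subseteq> S" "finite J"
      and E: "\<forall>j\<in>J. E j \<in> {B (A j) -` D \<inter> space N |D. D \<in> sets borel}"
    have inj: "inj_on f J"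
      using f J(2) by (auto simp: bij_betw_def intro: inj_on_subset)
    have fJ: "the_inv_into J f (f j) = j" if "j \<in> J" for j
      using that inj by (rule the_inv_into_f_f[rotated])
    have "prob (\<Inter>n\<in>f ` J. E (the_inv_into J f n)) = (\<Prod>n\<in>f ` J. prob (E (the_inv_into J f n)))"
    proof (rule indep_setsD[OF ind])
      show "\<forall>n\<in>f ` J. E (the_inv_into J f n) \<in> {B (A' n) -` D \<inter> space N |D. D \<in> sets borel}"
        using E J(2) by (auto simp: fJ eq subset_iff)
    qed (use J in auto)
    then show "prob (\<Inter>(E ` J)) = (\<Prod>j\<in>J. prob (E j))"
      by (simp add: prod.reindex[OF inj] fJ)
  qed
qed

lemma B_UN:
  fixes A :: "'i \<Rightarrow> real set"
  assumes "finite S" "disjoint_family_on A S" "\<And>s. s \<in> S \<Longrightarrow> A s \<in> fmeasurable lborel"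
  shows "AE \<omega> in N. B (\<Union>s\<in>S. A s) \<omega> = (\<Sum>s\<in>S. B (A s) \<omega>)"
proof -
  obtain A' :: "nat \<Rightarrow> real set" and e :: "nat \<Rightarrow> 'i" where e: "bij_betw e {..<card S} S"
    and A': "\<And>n. n < card S \<Longrightarrow> A' n = A (e n)" "\<And>n. n \<ge> card S \<Longrightarrow> A' n = {}"
      "range A' \<subseteq> fmeasurable lborel" "disjoint_family A'"
    using finite_family_enum[OF assms] by metis
  have "(\<Union>n. A' n) = (\<Union>s\<in>S. A s)"
  proof -
    have "(\<Union>n. A' n) = (\<Union>n\<in>{..<card S}. A (e n))"
    proof (intro equalityI subsetI)
      fix x assume "x \<in> (\<Union>n. A' n)"
      then obtain n where "x \<in> A' n" by blast
      then show "x \<in> (\<Union>n\<in>{..<card S}. A (e n))"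
        using A'(1,2)[of n] by (cases "n < card S") auto
    next
      fix x assume "x \<in> (\<Union>n\<in>{..<card S}. A (e n))"
      then show "x \<in> (\<Union>n. A' n)" using A'(1) by auto
    qed
    also have "\<dots> = (\<Union>s\<in>e ` {..<card S}. A s)" by simp
    also have "e ` {..<card S} = S" using e by (simp add: bij_betw_def)
    finally show ?thesis .
  qed
  moreover have "(\<Union>s\<in>S. A s) \<in> fmeasurable lborel"
    using assms by (intro fmeasurable.finite_UN) auto
  ultimately have "AE \<omega> in N. (\<lambda>n. B (A' n) \<omega>) sums B (\<Union>s\<in>S. A s) \<omega>"
    using B_sums[OF A'(3,4)] by simp
  \<comment> \<open>The infinitely many empty sets of the padded sequence contribute nothing only
    because \<open>B {}\<close> is almost surely 0.\<close>
  moreover have "AE \<omega> in N. B {} \<omega> = 0"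
    by (intro B_null) auto
  ultimately show ?thesis
  proof eventually_elim
    case (elim \<omega>)
    have "(\<lambda>n. B (A' n) \<omega>) sums (\<Sum>n<card S. B (A' n) \<omega>)"
      using elim(2) A'(2) by (intro sums_finite) auto
    with elim(1) have "B (\<Union>s\<in>S. A s) \<omega> = (\<Sum>n<card S. B (A (e n)) \<omega>)"
      using sums_unique2 A'(1) by fastforce
    also have "\<dots> = (\<Sum>s\<in>S. B (A s) \<omega>)"
      using sum.reindex_bij_betw[OF e, of "\<lambda>s. B (A s) \<omega>"] by simp
    finally show ?case .
  qed
qed

definition fm_list :: "(real \<times> real set) list \<Rightarrow> bool" where
  "fm_list p \<longleftrightarrow> (\<forall>(a, A)\<in>set p. A \<in> fmeasurable lborel)"

lemma fm_list_nth: "fm_list p \<Longrightarrow> i < length p \<Longrightarrow> snd (p ! i) \<in> fmeasurable lborel"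
  unfolding fm_list_def using nth_mem by fastforce

text \<open>The atoms of the algebra generated by the sets of \<open>p\<close>, indexed by the sets containing them.\<close>

lemma simple_disjoint_representation:
  assumes p: "fm_list p"
  obtains S :: "nat set set" and A b where "finite S" "disjoint_family_on A S"
    "\<And>s. s \<in> S \<Longrightarrow> A s \<in> fmeasurable lborel"
    "\<And>u. simple_fun p u = (\<Sum>s\<in>S. b s * indicator (A s) u)"
    "AE \<omega> in N. simple_wiener B p \<omega> = (\<Sum>s\<in>S. b s * B (A s) \<omega>)"
proof -
  define m where "m = length p"
  define a D where "a i = fst (p ! i)" and "D i = snd (p ! i)" for i
  have D: "D i \<in> fmeasurable lborel" if "i < m" for i
    using fm_list_nth[OF p] that by (simp add: D_def m_def)
  \<comment> \<open>The empty index set is excluded: its atom would be the complement of all the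
    sets, which has infinite measure.\<close>
  define S where "S = Pow {..<m} - {{}}"
  define A where "A s = (\<Inter>i\<in>s. D i) - (\<Union>i\<in>{..<m} - s. D i)" for s
  define b where "b s = (\<Sum>i\<in>s. a i)" for s
  have fin: "finite S" by (simp add: S_def)
  have "A s \<inter> A s' = {}" if "s \<in> S" "s' \<in> S" "s \<noteq> s'" for s s'
    using that by (auto simp: A_def S_def)
  then have disj: "disjoint_family_on A S"
    by (simp add: disjoint_family_on_def)
  have fm: "A s \<in> fmeasurable lborel" if "s \<in> S" for s
  proof -
    have s: "finite s" "s \<noteq> {}" "s \<subseteq> {..<m}"
      using that by (auto simp: S_def intro: finite_subset)
    then obtain i where "i \<in> s" by blast
    have "(\<Inter>i\<in>s. D i) \<in> fmeasurable lborel"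
    proof (rule fmeasurableI2[of "D i"])
      show "(\<Inter>i\<in>s. D i) \<in> sets lborel"
        using s D by (intro sets.finite_INT) (auto simp: fmeasurable_def)
    qed (use \<open>i \<in> s\<close> s D in auto)
    moreover have "(\<Union>i\<in>{..<m} - s. D i) \<in> fmeasurable lborel"
      using D by (intro fmeasurable.finite_UN) auto
    ultimately show ?thesis
      unfolding A_def by (rule fmeasurable.Diff)
  qed
  define S' where "S' i = {s \<in> S. i \<in> s}" for i
  have D_eq: "D i = (\<Union>s\<in>S' i. A s)" if "i < m" for i
  proof (intro equalityI subsetI)
    fix u assume "u \<in> D i"
    then have "{j. j < m \<and> u \<in> D j} \<in> S' i" "u \<in> A {j. j < m \<and> u \<in> D j}"
      using that by (auto simp: S'_def S_def A_def)
    then show "u \<in> (\<Union>s\<in>S' i. A s)" by blast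
  qed (auto simp: S'_def A_def)
  have S': "finite (S' i)" "disjoint_family_on A (S' i)" "S' i \<subseteq> S" for i
    using fin disj by (auto simp: S'_def disjoint_family_on_def)
  \<comment> \<open>Pairs \<open>(i, s)\<close> with \<open>i\<close> in \<open>s\<close> are
    counted in two ways. It is used with indicators and again with the values of \<open>B\<close>,
    so that function and integral receive the same coefficients \<open>b\<close>.\<close>
  have swap: "(\<Sum>i<m. a i * (\<Sum>s\<in>S' i. g s)) = (\<Sum>s\<in>S. b s * g s)" for g :: "nat set \<Rightarrow> real"
  proof -
    have "(\<Sum>i<m. a i * (\<Sum>s\<in>S' i. g s)) = (\<Sum>i<m. \<Sum>s\<in>S. if i \<in> s then a i * g s else 0)"
      using fin by (auto simp: S'_def sum_distrib_left sum.inter_filter intro!: sum.cong)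
    also have "\<dots> = (\<Sum>s\<in>S. \<Sum>i<m. if i \<in> s then a i * g s else 0)"
      by (rule sum.swap)
    also have "\<dots> = (\<Sum>s\<in>S. b s * g s)"
    proof (rule sum.cong[OF refl])
      fix s assume "s \<in> S"
      then have "{i \<in> {..<m}. i \<in> s} = s" by (auto simp: S_def)
      then show "(\<Sum>i<m. if i \<in> s then a i * g s else 0) = b s * g s"
        by (simp add: sum.inter_filter[symmetric] b_def sum_distrib_right)
    qed
    finally show ?thesis .
  qed
  show ?thesis
  proof
    fix u
    have "indicator (D i) u = (\<Sum>s\<in>S' i. indicator (A s) u :: real)" if "i < m" for i
      unfolding D_eq[OF that] using S' by (simp add: indicator_UN_disjoint)
    then show "simple_fun p u = (\<Sum>s\<in>S. b s * indicator (A s) u)"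
      unfolding simple_fun_nth swap[symmetric] m_def[symmetric] a_def[symmetric] D_def[symmetric] by simp
  next
    have "AE \<omega> in N. \<forall>i\<in>{..<m}. B (D i) \<omega> = (\<Sum>s\<in>S' i. B (A s) \<omega>)"
    proof (rule AE_finite_allI)
      fix i assume "i \<in> {..<m}"
      then show "AE \<omega> in N. B (D i) \<omega> = (\<Sum>s\<in>S' i. B (A s) \<omega>)"
        using B_UN[OF S'(1,2) fm, of i] S'(3)[of i] D_eq[of i] by auto
    qed simp
    then show "AE \<omega> in N. simple_wiener B p \<omega> = (\<Sum>s\<in>S. b s * B (A s) \<omega>)"
      by eventually_elim
        (simp add: simple_wiener_nth swap[symmetric] m_def[symmetric] a_def[symmetric] D_def[symmetric])
  qed fact+
qed

lemma simple_wiener_measurable: "fm_list p \<Longrightarrow> simple_wiener B p \<in> borel_measurable N"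
  unfolding simple_wiener_nth[abs_def]
  by (intro borel_measurable_sum borel_measurable_times B_measurable fm_list_nth) auto

lemma fm_list_simple_fun_measurable: "fm_list p \<Longrightarrow> simple_fun p \<in> borel_measurable borel"
  by (rule simple_fun_measurable) (auto simp: fm_list_def fmeasurable_def)

text \<open>On disjoint atoms the square of the function has no cross terms, and the values of
  \<open>B\<close> are independent, so the characteristic function is a product of Gaussian factors
  with the matching exponent.\<close>

lemma simple_wiener_char:
  assumes p: "fm_list p"
  shows "integrable lborel (\<lambda>u. (simple_fun p u)\<^sup>2)"
    and "(CLINT \<omega>|N. iexp (simple_wiener B p \<omega>)) = exp (- (LINT u|lborel. (simple_fun p u)\<^sup>2) / 2)"
proof -
  obtain S :: "nat set set" and A b where S: "finite S" and disj: "disjoint_family_on A S"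
    and A: "\<And>s. s \<in> S \<Longrightarrow> A s \<in> fmeasurable lborel"
    and f: "\<And>u. simple_fun p u = (\<Sum>s\<in>S. b s * indicator (A s) u)"
    and W: "AE \<omega> in N. simple_wiener B p \<omega> = (\<Sum>s\<in>S. b s * B (A s) \<omega>)"
  proof (rule simple_disjoint_representation[OF p], goal_cases)
    case (1 S A b)
    from 1(1)[OF 1(2-)] show ?case .
  qed
  have sq: "(simple_fun p u)\<^sup>2 = (\<Sum>s\<in>S. (b s)\<^sup>2 * indicator (A s) u)" for u
  proof (cases "\<exists>s\<in>S. u \<in> A s")
    case True
    then obtain s0 where s0: "s0 \<in> S" "u \<in> A s0" by blast
    have ind: "indicator (A s) u = (if s = s0 then 1 else 0 :: real)" if "s \<in> S" for s
    proof (cases "s = s0")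
      case False
      then have "A s \<inter> A s0 = {}"
        using disj that s0(1) by (simp add: disjoint_family_on_def)
      then have "u \<notin> A s" using s0(2) by blast
      then show ?thesis using False by simp
    qed (use s0 in simp)
    have delta: "(\<Sum>s\<in>S. c s * indicator (A s) u) = c s0" for c :: "nat set \<Rightarrow> real"
    proof -
      have "(\<Sum>s\<in>S. c s * indicator (A s) u) = (\<Sum>s\<in>S. if s = s0 then c s0 else 0)"
        using ind by (intro sum.cong) auto
      then show ?thesis using S s0(1) by simp
    qed
    show ?thesis
      unfolding f delta ..
  next
    case False
    then have "indicator (A s) u = (0::real)" if "s \<in> S" for s
      using that by auto
    then show ?thesis by (simp add: f)
  qed
  have int: "integrable lborel (\<lambda>u. (b s)\<^sup>2 * indicator (A s) u)" if "s \<in> S" for s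
    using A[OF that] by (auto simp: fmeasurable_def)
  show "integrable lborel (\<lambda>u. (simple_fun p u)\<^sup>2)"
    unfolding sq using int by simp
  have "(LINT u|lborel. (simple_fun p u)\<^sup>2) = (\<Sum>s\<in>S. (b s)\<^sup>2 * measure lborel (A s))"
    unfolding sq using int by (simp add: Bochner_Integration.integral_sum)
  have [measurable]: "\<And>s. s \<in> S \<Longrightarrow> B (A s) \<in> borel_measurable N"
    using A by (rule B_measurable)
  have "(CLINT \<omega>|N. iexp (simple_wiener B p \<omega>)) = (CLINT \<omega>|N. iexp (1 * (\<Sum>s\<in>S. b s * B (A s) \<omega>)))"
    using W simple_wiener_measurable[OF p] by (intro integral_cong_AE) auto
  also have "\<dots> = char (distr N borel (\<lambda>\<omega>. \<Sum>s\<in>S. b s * B (A s) \<omega>)) 1"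
    unfolding char_def by (subst integral_distr) auto
  also have "\<dots> = (\<Prod>s\<in>S. char (distr N borel (\<lambda>\<omega>. b s * B (A s) \<omega>)) 1)"
  proof (rule char_distr_sum)
    show "indep_vars (\<lambda>_. borel) (\<lambda>s \<omega>. b s * B (A s) \<omega>) S"
      by (rule indep_vars_compose2[OF indep_B[OF S disj A], of "\<lambda>s x. b s * x"]) auto
  qed
  also have "\<dots> = (\<Prod>s\<in>S. complex_of_real (exp (- ((b s)\<^sup>2 * measure lborel (A s)) / 2)))"
  proof (rule prod.cong[OF refl])
    fix s assume s: "s \<in> S"
    have "char (distr N borel (\<lambda>\<omega>. b s * B (A s) \<omega>)) 1 = (CLINT \<omega>|N. iexp (b s * B (A s) \<omega>))"
      unfolding char_def using s by (subst integral_distr) auto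
    then show "char (distr N borel (\<lambda>\<omega>. b s * B (A s) \<omega>)) 1 =
        complex_of_real (exp (- ((b s)\<^sup>2 * measure lborel (A s)) / 2))"
      using B_char[OF A[OF s], of "b s"] by (simp add: exp_of_real)
  qed
  also have "\<dots> = complex_of_real (exp (\<Sum>s\<in>S. - ((b s)\<^sup>2 * measure lborel (A s)) / 2))"
    using S by (simp add: exp_sum)
  also have "(\<Sum>s\<in>S. - ((b s)\<^sup>2 * measure lborel (A s)) / 2) = - (LINT u|lborel. (simple_fun p u)\<^sup>2) / 2"
    unfolding \<open>(LINT u|lborel. (simple_fun p u)\<^sup>2) = _\<close> by (simp add: sum_divide_distrib sum_negf)
  finally show "(CLINT \<omega>|N. iexp (simple_wiener B p \<omega>)) = exp (- (LINT u|lborel. (simple_fun p u)\<^sup>2) / 2)"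
    by (simp add: exp_of_real)
qed

section \<open>General square integrable integrands\<close>

abbreviation "wiener \<equiv> is_wiener_integral N B"

lemma wienerE:
  assumes "wiener f Y"
  obtains p where "\<And>n. fm_list (p n)" "L2_tendsto lborel (\<lambda>n. simple_fun (p n)) f"
    "L2_tendsto N (\<lambda>n. simple_wiener B (p n)) Y"
  using assms unfolding is_wiener_integral_def fm_list_def L2_tendsto_def by blast

lemma wienerI:
  assumes "f \<in> borel_measurable lborel" "Y \<in> borel_measurable N"
    "\<And>n. fm_list (p n)" "L2_tendsto lborel (\<lambda>n. simple_fun (p n)) f"
    "L2_tendsto N (\<lambda>n. simple_wiener B (p n)) Y"
  shows "wiener f Y"
  using assms unfolding is_wiener_integral_def fm_list_def L2_tendsto_def by blast

lemma wiener_measurable: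
  assumes "wiener f Y"
  shows "f \<in> borel_measurable borel" "Y \<in> borel_measurable N"
  using assms by (auto simp: is_wiener_integral_def)

lemma wiener_square_integrable:
  assumes W: "wiener f Y"
  shows "integrable lborel (\<lambda>u. (f u)\<^sup>2)"
proof -
  obtain p where p: "\<And>n. fm_list (p n)" "L2_tendsto lborel (\<lambda>n. simple_fun (p n)) f"
    using wienerE[OF W] by metis
  show ?thesis
    by (rule L2_tendstoD(1)[OF _ _ p(2)])
      (use wiener_measurable[OF W] p(1) in \<open>auto simp: fm_list_simple_fun_measurable intro: simple_wiener_char\<close>)
qed

text \<open>Both sides pass to the limit along the simple approximants: the exponent because L2
  norms converge, the left side because \<open>iexp\<close> is 1-Lipschitz, so that L2 distances
  bound differences of characteristic functions. The later statements about laws are drawn from this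
  formula applied to linear combinations.\<close>

lemma wiener_char:
  assumes W: "wiener f Y"
  shows "(CLINT \<omega>|N. iexp (Y \<omega>)) = exp (- (LINT u|lborel. (f u)\<^sup>2) / 2)"
proof -
  obtain p where p: "\<And>n. fm_list (p n)" and F: "L2_tendsto lborel (\<lambda>n. simple_fun (p n)) f"
    and Y: "L2_tendsto N (\<lambda>n. simple_wiener B (p n)) Y"
    using wienerE[OF W] by metis
  note [measurable] = wiener_measurable[OF W] simple_wiener_measurable[OF p] fm_list_simple_fun_measurable[OF p]
  let ?W = "\<lambda>n. simple_wiener B (p n)"
  have "(\<lambda>n. complex_of_real (exp (- (LINT u|lborel. (simple_fun (p n) u)\<^sup>2) / 2)))
      \<longlonglongrightarrow> complex_of_real (exp (- (LINT u|lborel. (f u)\<^sup>2) / 2))"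
    by (intro tendsto_intros L2_tendstoD(3)[OF _ _ F] simple_wiener_char p) auto
  then have lim1: "(\<lambda>n. CLINT \<omega>|N. iexp (?W n \<omega>)) \<longlonglongrightarrow> complex_of_real (exp (- (LINT u|lborel. (f u)\<^sup>2) / 2))"
    by (simp add: simple_wiener_char(2)[OF p] exp_of_real)
  have "(\<lambda>n. \<integral>\<^sup>+ \<omega>. ennreal ((?W n \<omega> - Y \<omega>)\<^sup>2) \<partial>N) \<longlonglongrightarrow> 0"
    using Y by (simp add: L2_tendsto_def)
  then have "\<forall>\<^sub>F n in sequentially. (\<integral>\<^sup>+ \<omega>. ennreal ((?W n \<omega> - Y \<omega>)\<^sup>2) \<partial>N) < \<infinity>"
    by (rule order_tendstoD) simp
  \<comment> \<open>On the probability side no second moments of the approximants are available yet,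
    only finiteness of the distances to \<open>Y\<close> from some index on.\<close>
  then have sqint: "\<forall>\<^sub>F n in sequentially. integrable N (\<lambda>\<omega>. (?W n \<omega> - Y \<omega>)\<^sup>2)"
    by eventually_elim (auto intro!: integrableI_nonneg)
  have "(\<lambda>n. LINT \<omega>|N. (?W n \<omega> - Y \<omega>)\<^sup>2) \<longlonglongrightarrow> 0"
  proof -
    have "(\<lambda>n. ennreal (LINT \<omega>|N. (?W n \<omega> - Y \<omega>)\<^sup>2)) \<longlonglongrightarrow> ennreal 0"
    proof (rule Lim_transform_eventually)
      show "(\<lambda>n. \<integral>\<^sup>+ \<omega>. ennreal ((?W n \<omega> - Y \<omega>)\<^sup>2) \<partial>N) \<longlonglongrightarrow> ennreal 0"
        using Y by (simp add: L2_tendsto_def)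
      show "\<forall>\<^sub>F n in sequentially. (\<integral>\<^sup>+ \<omega>. ennreal ((?W n \<omega> - Y \<omega>)\<^sup>2) \<partial>N) =
          ennreal (LINT \<omega>|N. (?W n \<omega> - Y \<omega>)\<^sup>2)"
        using sqint by eventually_elim (simp add: nn_integral_eq_integral)
    qed
    then show ?thesis
      by (subst (asm) tendsto_ennreal_iff) auto
  qed
  then have "(\<lambda>n. sqrt (LINT \<omega>|N. (?W n \<omega> - Y \<omega>)\<^sup>2)) \<longlonglongrightarrow> sqrt 0"
    by (rule tendsto_real_sqrt)
  then have sq0: "(\<lambda>n. sqrt (LINT \<omega>|N. (?W n \<omega> - Y \<omega>)\<^sup>2)) \<longlonglongrightarrow> 0" by simp
  have "(\<lambda>n. (CLINT \<omega>|N. iexp (?W n \<omega>)) - (CLINT \<omega>|N. iexp (Y \<omega>))) \<longlonglongrightarrow> 0"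
  proof (rule Lim_null_comparison[OF _ sq0])
    show "\<forall>\<^sub>F n in sequentially. norm ((CLINT \<omega>|N. iexp (?W n \<omega>)) - (CLINT \<omega>|N. iexp (Y \<omega>)))
        \<le> sqrt (LINT \<omega>|N. (?W n \<omega> - Y \<omega>)\<^sup>2)"
      using sqint
    proof eventually_elim
      case (elim n)
      have int: "integrable N (\<lambda>\<omega>. iexp (?W n \<omega>))" "integrable N (\<lambda>\<omega>. iexp (Y \<omega>))"
        by (auto intro!: integrable_const_bound[where B=1])
      have abs: "integrable N (\<lambda>\<omega>. \<bar>?W n \<omega> - Y \<omega>\<bar> * 1)"
        using elim by (intro square_integrable_mult) auto
      have "norm ((CLINT \<omega>|N. iexp (?W n \<omega>)) - (CLINT \<omega>|N. iexp (Y \<omega>)))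
          = norm (CLINT \<omega>|N. iexp (?W n \<omega>) - iexp (Y \<omega>))"
        using int by simp
      also have "\<dots> \<le> (LINT \<omega>|N. norm (iexp (?W n \<omega>) - iexp (Y \<omega>)))"
        by (rule integral_norm_bound)
      also have "\<dots> \<le> (LINT \<omega>|N. \<bar>?W n \<omega> - Y \<omega>\<bar> * 1)"
      proof (rule integral_mono)
        fix \<omega>
        have "iexp (?W n \<omega>) - iexp (Y \<omega>) = iexp (Y \<omega>) * (iexp (?W n \<omega> - Y \<omega>) - 1)"
          by (simp add: algebra_simps exp_add[symmetric])
        then have "norm (iexp (?W n \<omega>) - iexp (Y \<omega>)) = norm (iexp (?W n \<omega> - Y \<omega>) - 1)"
          by (simp only: norm_mult norm_exp_i_times mult_1)
        also have "\<dots> \<le> \<bar>?W n \<omega> - Y \<omega>\<bar>"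
          using iexp_approx1[of "?W n \<omega> - Y \<omega>" 0] by simp
        finally show "norm (iexp (?W n \<omega>) - iexp (Y \<omega>)) \<le> \<bar>?W n \<omega> - Y \<omega>\<bar> * 1" by simp
      qed (use int abs in auto)
      also have "\<dots> \<le> sqrt (LINT \<omega>|N. \<bar>?W n \<omega> - Y \<omega>\<bar>\<^sup>2) * sqrt (LINT \<omega>|N. 1\<^sup>2)"
        by (rule order_trans[OF abs_ge_self Cauchy_Schwarz_LINT]) (use elim in auto)
      finally show ?case by (simp add: prob_space)
    qed
  qed
  then have "(\<lambda>n. CLINT \<omega>|N. iexp (?W n \<omega>)) \<longlonglongrightarrow> (CLINT \<omega>|N. iexp (Y \<omega>))"
    by (rule LIM_zero_cancel)
  from LIMSEQ_unique[OF this lim1] show ?thesis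
    by (simp add: exp_of_real)
qed

lemma fm_list_append: "fm_list p \<Longrightarrow> fm_list q \<Longrightarrow> fm_list (p @ q)"
  by (auto simp: fm_list_def)

lemma fm_list_scale: "fm_list p \<Longrightarrow> fm_list (scale_list r p)"
  by (auto simp: fm_list_def scale_list_def)

lemma wiener_lincomb:
  assumes f: "wiener f Y" and g: "wiener g Z"
  shows "wiener (\<lambda>u. f u + r * g u) (\<lambda>\<omega>. Y \<omega> + r * Z \<omega>)"
proof -
  obtain p where p: "\<And>n. fm_list (p n)" "L2_tendsto lborel (\<lambda>n. simple_fun (p n)) f"
    "L2_tendsto N (\<lambda>n. simple_wiener B (p n)) Y"
    using wienerE[OF f] by metis
  obtain q where q: "\<And>n. fm_list (q n)" "L2_tendsto lborel (\<lambda>n. simple_fun (q n)) g"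
    "L2_tendsto N (\<lambda>n. simple_wiener B (q n)) Z"
    using wienerE[OF g] by metis
  note m = wiener_measurable[OF f] wiener_measurable[OF g]
  have sf: "simple_fun (p n @ scale_list r (q n)) = (\<lambda>u. simple_fun (p n) u + r * simple_fun (q n) u)" for n
    by (auto simp: simple_fun_append simple_fun_scale)
  have sw: "simple_wiener B (p n @ scale_list r (q n)) =
      (\<lambda>\<omega>. simple_wiener B (p n) \<omega> + r * simple_wiener B (q n) \<omega>)" for n
    by (auto simp: simple_wiener_append simple_wiener_scale)
  show ?thesis
  proof (rule wienerI[where p="\<lambda>n. p n @ scale_list r (q n)"])
    show "L2_tendsto lborel (\<lambda>n. simple_fun (p n @ scale_list r (q n))) (\<lambda>u. f u + r * g u)"
      unfolding sf using m p q by (intro L2_tendsto_lincomb) (auto simp: fm_list_simple_fun_measurable)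
    show "L2_tendsto N (\<lambda>n. simple_wiener B (p n @ scale_list r (q n))) (\<lambda>\<omega>. Y \<omega> + r * Z \<omega>)"
      unfolding sw using m p q by (intro L2_tendsto_lincomb) (auto simp: simple_wiener_measurable)
  qed (use m p q in \<open>auto intro!: fm_list_append fm_list_scale\<close>)
qed

lemma wiener_simple: "fm_list p \<Longrightarrow> wiener (simple_fun p) (simple_wiener B p)"
  by (rule wienerI[where p="\<lambda>_. p"])
    (auto simp: fm_list_simple_fun_measurable simple_wiener_measurable L2_tendsto_def)

lemma wiener_zero: "wiener (\<lambda>_. 0) (\<lambda>_. 0)"
  using wiener_simple[of "[]"] by (simp add: fm_list_def simple_fun_def[abs_def] simple_wiener_def[abs_def])

lemma wiener_scale: "wiener f Y \<Longrightarrow> wiener (\<lambda>u. r * f u) (\<lambda>\<omega>. r * Y \<omega>)"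
  using wiener_lincomb[OF wiener_zero] by simp

lemma wiener_diff: "wiener f Y \<Longrightarrow> wiener g Z \<Longrightarrow> wiener (\<lambda>u. f u - g u) (\<lambda>\<omega>. Y \<omega> - Z \<omega>)"
  using wiener_lincomb[of f Y g Z "-1"] by simp

lemma wiener_sum:
  "finite I \<Longrightarrow> (\<And>i. i \<in> I \<Longrightarrow> wiener (F i) (Y i)) \<Longrightarrow>
    wiener (\<lambda>u. \<Sum>i\<in>I. c i * F i u) (\<lambda>\<omega>. \<Sum>i\<in>I. c i * Y i \<omega>)"
proof (induction I rule: finite_induct)
  case (insert i I)
  have "wiener (\<lambda>u. (\<Sum>i\<in>I. c i * F i u) + c i * F i u) (\<lambda>\<omega>. (\<Sum>i\<in>I. c i * Y i \<omega>) + c i * Y i \<omega>)"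
    using insert by (intro wiener_lincomb) auto
  then show ?case
    using insert by (simp add: add.commute)
qed (simp add: wiener_zero)

text \<open>Intersecting the sets of a simple approximant with \<open>A\<close> leaves the error
  \<open>f\<close> outside \<open>A\<close> and the old error inside. Since \<open>g\<close> is
  simple its integral \<open>V\<close> exists outright, whereas an integral of \<open>f\<close>
  restricted to \<open>A\<close> would first have to be constructed.\<close>

lemma wiener_localize:
  assumes W: "wiener f Y" and [measurable]: "A \<in> sets borel" and "e > 0"
  obtains g V where "wiener g V" "\<And>u. u \<notin> A \<Longrightarrow> g u = 0"
    "(LINT u|lborel. (f u - g u)\<^sup>2) \<le> (LINT u|lborel. indicator (- A) u * (f u)\<^sup>2) + e"
proof -
  obtain p where p: "\<And>n. fm_list (p n)" and F: "L2_tendsto lborel (\<lambda>n. simple_fun (p n)) f"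
    using wienerE[OF W] by metis
  note [measurable] = wiener_measurable[OF W] fm_list_simple_fun_measurable[OF p]
  note f2 = wiener_square_integrable[OF W]
  have "(\<lambda>n. LINT u|lborel. (simple_fun (p n) u - f u)\<^sup>2) \<longlonglongrightarrow> 0"
    by (intro L2_tendstoD(2)[OF _ _ F]) (auto intro: simple_wiener_char p)
  then have "\<forall>\<^sub>F n in sequentially. (LINT u|lborel. (simple_fun (p n) u - f u)\<^sup>2) < e"
    using \<open>e > 0\<close> by (rule order_tendstoD)
  then obtain n where n: "(LINT u|lborel. (simple_fun (p n) u - f u)\<^sup>2) < e"
    by (metis (mono_tags, lifting) eventually_sequentially order_refl)
  define q where "q = map (\<lambda>(a, D). (a, D \<inter> A)) (p n)"
  have q: "fm_list q"
    using p[of n] by (auto simp: fm_list_def q_def intro!: fmeasurable_Int_fmeasurable)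
  have sq: "simple_fun q u = indicator A u * simple_fun (p n) u" for u
  proof -
    have "simple_fun (map (\<lambda>(a, D). (a, D \<inter> A)) l) u = indicator A u * simple_fun l u" for l
      by (induction l) (auto simp: simple_fun_def indicator_def algebra_simps)
    then show ?thesis by (simp add: q_def)
  qed
  have int1: "integrable lborel (\<lambda>u. (simple_fun (p n) u - f u)\<^sup>2)"
    using square_integrable_lincomb(1)[OF _ _ simple_wiener_char(1)[OF p] f2, of n "-1"] by simp
  have int2: "integrable lborel (\<lambda>u. indicator (- A) u * (f u)\<^sup>2)"
    using integrable_mult_indicator[OF _ f2, of "- A"] by simp
  have int3: "integrable lborel (\<lambda>u. (f u - simple_fun q u)\<^sup>2)"
    by (intro wiener_square_integrable[OF wiener_diff[OF W wiener_simple[OF q]]])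
  have "(LINT u|lborel. (f u - simple_fun q u)\<^sup>2) \<le>
      (LINT u|lborel. indicator (- A) u * (f u)\<^sup>2 + (simple_fun (p n) u - f u)\<^sup>2)"
    using int1 int2 int3
    by (intro integral_mono) (auto simp: sq indicator_def power2_commute)
  also have "\<dots> \<le> (LINT u|lborel. indicator (- A) u * (f u)\<^sup>2) + e"
    using int1 int2 n by simp
  finally show ?thesis
    by (intro that[OF wiener_simple[OF q]]) (auto simp: sq)
qed

end

section \<open>Gaussian tails and Fernique's inequality\<close>

lemma sets_Collect_mem:
  assumes "f \<in> measurable M K" "S \<in> sets K"
  shows "{x \<in> space M. f x \<in> S} \<in> sets M"
proof -
  have "{x \<in> space M. f x \<in> S} = f -` S \<inter> space M" by auto
  then show ?thesis using measurable_sets[OF assms] by simp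
qed

text \<open>Beyond \<open>z\<close> the density is at most \<open>exp (- z\<^sup>2 / 2)\<close>
  times the normal density centred at \<open>z\<close>, because the cross term
  \<open>z * (x - z)\<close> is nonnegative; the shifted density has mass 1.\<close>

lemma std_normal_upper_tail:
  assumes "0 \<le> z"
  shows "measure std_normal_distribution {z<..} \<le> exp (- z\<^sup>2 / 2)"
proof -
  have eq: "indicator {z<..} x * std_normal_density x \<le> exp (- z\<^sup>2 / 2) * normal_density z 1 x" for x
  proof (cases "x > z")
    case True
    then have "0 \<le> z * (x - z)" using assms by simp
    then have "- x\<^sup>2 / 2 \<le> - z\<^sup>2 / 2 + - (x - z)\<^sup>2 / 2"
      by (simp add: power2_eq_square algebra_simps)
    then have "exp (- x\<^sup>2 / 2) \<le> exp (- z\<^sup>2 / 2) * exp (- (x - z)\<^sup>2 / 2)"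
      by (simp add: exp_add[symmetric])
    then have "1 / sqrt (2 * pi) * exp (- x\<^sup>2 / 2) \<le> 1 / sqrt (2 * pi) * (exp (- z\<^sup>2 / 2) * exp (- (x - z)\<^sup>2 / 2))"
      by (intro mult_left_mono) auto
    with True show ?thesis
      by (simp add: normal_density_def mult_ac)
  qed (simp add: normal_density_nonneg)
  have "measure std_normal_distribution {z<..} = (LINT x|lborel. indicator {z<..} x * std_normal_density x)"
    using integral_density[of "indicator {z<..} :: real \<Rightarrow> real" lborel std_normal_density]
    by (simp add: mult_ac)
  also have "\<dots> \<le> (LINT x|lborel. exp (- z\<^sup>2 / 2) * normal_density z 1 x)"
  proof (rule integral_mono)
    show "integrable lborel (\<lambda>x. indicator {z<..} x * std_normal_density x)"
      using integrable_mult_indicator[of "{z<..}" lborel std_normal_density] by simp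
  qed (use eq in auto)
  also have "\<dots> = exp (- z\<^sup>2 / 2)" by simp
  finally show ?thesis .
qed

text \<open>The density on the unit interval above \<open>z\<close> is at least its value at
  \<open>z + 1\<close>. The crude shift by 1 is harmless when \<open>z\<close> tends to infinity,
  and \<open>lil_lower_fixed\<close> absorbs it.\<close>

lemma std_normal_lower_tail:
  assumes "0 \<le> z"
  shows "exp (- (z + 1)\<^sup>2 / 2) / sqrt (2 * pi) \<le> measure std_normal_distribution {z<..}"
proof -
  let ?c = "exp (- (z + 1)\<^sup>2 / 2) / sqrt (2 * pi)"
  have "?c = (LINT x|lborel. indicator {z<..z+1} x * ?c)" by simp
  also have "\<dots> \<le> (LINT x|lborel. indicator {z<..} x * std_normal_density x)"
  proof (rule integral_mono)
    show "integrable lborel (\<lambda>x. indicator {z<..} x * std_normal_density x)"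
      using integrable_mult_indicator[of "{z<..}" lborel std_normal_density] by simp
    show "indicator {z<..z+1} x * ?c \<le> indicator {z<..} x * std_normal_density x" for x
    proof (cases "x \<in> {z<..z+1}")
      case True
      then have "x\<^sup>2 \<le> (z + 1)\<^sup>2" using assms by (intro power_mono) auto
      with True show ?thesis
        by (simp add: std_normal_density_def divide_right_mono)
    qed (simp add: normal_density_nonneg)
  qed auto
  also have "\<dots> = measure std_normal_distribution {z<..}"
    using integral_density[of "indicator {z<..} :: real \<Rightarrow> real" lborel std_normal_density]
    by (simp add: mult_ac)
  finally show ?thesis .
qed

section \<open>Laws, moments and independence of Wiener integrals\<close>

context gaussian_measure
begin

lemma wiener_normalized:
  assumes W: "wiener f Y" and pos: "(LINT u|lborel. (f u)\<^sup>2) > 0"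
  shows "distr N borel (\<lambda>\<omega>. Y \<omega> / sqrt (LINT u|lborel. (f u)\<^sup>2)) = std_normal_distribution"
proof (rule Levy_uniqueness[OF _ real_dist_normal_dist])
  define v where "v = (LINT u|lborel. (f u)\<^sup>2)"
  note [measurable] = wiener_measurable[OF W]
  show "real_distribution (distr N borel (\<lambda>\<omega>. Y \<omega> / sqrt (LINT u|lborel. (f u)\<^sup>2)))"
    by (intro real_distribution_distr) simp
  show "char (distr N borel (\<lambda>\<omega>. Y \<omega> / sqrt (LINT u|lborel. (f u)\<^sup>2))) = char std_normal_distribution"
  proof
    fix t
    have "char (distr N borel (\<lambda>\<omega>. Y \<omega> / sqrt v)) t = (CLINT \<omega>|N. iexp ((t / sqrt v) * Y \<omega>))"
      unfolding char_def by (subst integral_distr) auto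
    also have "\<dots> = exp (- (LINT u|lborel. ((t / sqrt v) * f u)\<^sup>2) / 2)"
      by (rule wiener_char[OF wiener_scale[OF W]])
    also have "(LINT u|lborel. ((t / sqrt v) * f u)\<^sup>2) = t\<^sup>2"
      using pos by (simp add: power_mult_distrib power_divide v_def)
    finally show "char (distr N borel (\<lambda>\<omega>. Y \<omega> / sqrt (LINT u|lborel. (f u)\<^sup>2))) t = char std_normal_distribution t"
      by (simp add: v_def char_std_normal_distribution exp_of_real)
  qed
qed

lemma wiener_prob_std:
  assumes W: "wiener f Y" and pos: "(LINT u|lborel. (f u)\<^sup>2) > 0"
  shows "prob {\<omega> \<in> space N. Y \<omega> > x} = measure std_normal_distribution {x / sqrt (LINT u|lborel. (f u)\<^sup>2) <..}"
proof -
  note [measurable] = wiener_measurable[OF W]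
  let ?s = "sqrt (LINT u|lborel. (f u)\<^sup>2)"
  have "measure (distr N borel (\<lambda>\<omega>. Y \<omega> / ?s)) {x / ?s <..} = prob ((\<lambda>\<omega>. Y \<omega> / ?s) -` {x / ?s <..} \<inter> space N)"
    by (rule measure_distr) auto
  also have "(\<lambda>\<omega>. Y \<omega> / ?s) -` {x / ?s <..} \<inter> space N = {\<omega> \<in> space N. Y \<omega> > x}"
    using pos by (auto simp: divide_less_cancel)
  finally show ?thesis
    unfolding wiener_normalized[OF assms] by simp
qed

text \<open>Variance 0 admits no normalisation, so the law is compared with that of the constant 0
  through characteristic functions.\<close>

lemma wiener_null:
  assumes W: "wiener f Y" and zero: "(LINT u|lborel. (f u)\<^sup>2) = 0" and S: "S \<in> sets borel"
  shows "prob {\<omega> \<in> space N. Y \<omega> \<in> S} = of_bool (0 \<in> S)"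
proof -
  note [measurable] = wiener_measurable[OF W]
  have "prob {\<omega> \<in> space N. \<forall>j\<in>{()}. Y \<omega> \<in> S} = prob {\<omega> \<in> space N. \<forall>j\<in>{()}. 0 \<in> S}"
  proof (rule joint_char_eq_imp_prob_eq)
    show "(CLINT \<omega>|N. iexp (\<Sum>j\<in>{()}. t j * Y \<omega>)) = (CLINT \<omega>|N. iexp (\<Sum>j\<in>{()}. t j * 0))" for t
      using wiener_char[OF wiener_scale[OF W, of "t ()"]] zero
      by (simp add: power_mult_distrib prob_space)
  qed (use S in \<open>auto intro: prob_space_axioms\<close>)
  then show ?thesis
    by (auto simp: prob_space)
qed

text \<open>A positive bound \<open>w\<close> in place of the variance itself keeps the degenerate
  case inside the statement.\<close>

lemma wiener_upper_tail:
  assumes W: "wiener f Y" and w: "(LINT u|lborel. (f u)\<^sup>2) \<le> w" "0 < w" and x: "0 \<le> x"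
  shows "prob {\<omega> \<in> space N. \<bar>Y \<omega>\<bar> > x} \<le> 2 * exp (- x\<^sup>2 / (2 * w))"
proof -
  have one: "prob {\<omega> \<in> space N. Y \<omega> > x} \<le> exp (- x\<^sup>2 / (2 * w))"
    if W: "wiener f Y" "(LINT u|lborel. (f u)\<^sup>2) \<le> w" for f Y
  proof (cases "(LINT u|lborel. (f u)\<^sup>2) = 0")
    case True
    then show ?thesis
      using wiener_null[OF W(1) True, of "{x<..}"] x by simp
  next
    case False
    define v where "v = (LINT u|lborel. (f u)\<^sup>2)"
    have "v > 0"
      using False by (simp add: v_def less_le)
    have "prob {\<omega> \<in> space N. Y \<omega> > x} \<le> exp (- (x / sqrt v)\<^sup>2 / 2)"
      using wiener_prob_std[OF W(1)] std_normal_upper_tail[of "x / sqrt v"] \<open>v > 0\<close> x by (simp add: v_def)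
    also have "\<dots> = exp (- x\<^sup>2 / (2 * v))"
      using \<open>v > 0\<close> by (simp add: power_divide)
    also have "\<dots> \<le> exp (- x\<^sup>2 / (2 * w))"
      using W(2) \<open>v > 0\<close> by (simp add: v_def frac_le)
    finally show ?thesis .
  qed
  note [measurable] = wiener_measurable[OF W]
  have "{\<omega> \<in> space N. \<bar>Y \<omega>\<bar> > x} = {\<omega> \<in> space N. Y \<omega> > x} \<union> {\<omega> \<in> space N. (-1) * Y \<omega> > x}"
    using x by auto
  then have "prob {\<omega> \<in> space N. \<bar>Y \<omega>\<bar> > x} \<le> prob {\<omega> \<in> space N. Y \<omega> > x} + prob {\<omega> \<in> space N. (-1) * Y \<omega> > x}"
    by (simp only:) (rule measure_Un_le; measurable)
  also have "\<dots> \<le> exp (- x\<^sup>2 / (2 * w)) + exp (- x\<^sup>2 / (2 * w))"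
    using w(1) by (intro add_mono one[OF W] one[OF wiener_scale[OF W]]) auto
  finally show ?thesis by simp
qed

lemma wiener_lower_tail:
  assumes W: "wiener f Y" and w: "w \<le> (LINT u|lborel. (f u)\<^sup>2)" "0 < w" and x: "0 \<le> x"
  shows "exp (- (x / sqrt w + 1)\<^sup>2 / 2) / sqrt (2 * pi) \<le> prob {\<omega> \<in> space N. Y \<omega> > x}"
proof -
  define v where "v = (LINT u|lborel. (f u)\<^sup>2)"
  have v: "v > 0" "w \<le> v"
    using w by (auto simp: v_def)
  have "x / sqrt v \<le> x / sqrt w"
    using v w x by (intro divide_left_mono) auto
  then have "(x / sqrt v + 1)\<^sup>2 \<le> (x / sqrt w + 1)\<^sup>2"
    using v x by (intro power_mono) auto
  then have "exp (- (x / sqrt w + 1)\<^sup>2 / 2) / sqrt (2 * pi) \<le> exp (- (x / sqrt v + 1)\<^sup>2 / 2) / sqrt (2 * pi)"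
    by (intro divide_right_mono) auto
  also have "\<dots> \<le> prob {\<omega> \<in> space N. Y \<omega> > x}"
    using wiener_prob_std[OF W] v std_normal_lower_tail[of "x / sqrt v"] x by (simp add: v_def)
  finally show ?thesis .
qed

lemma wiener_second_moment:
  assumes W: "wiener f Y"
  shows "integrable N (\<lambda>\<omega>. (Y \<omega>)\<^sup>2)" "expectation (\<lambda>\<omega>. (Y \<omega>)\<^sup>2) = (LINT u|lborel. (f u)\<^sup>2)"
proof -
  note [measurable] = wiener_measurable[OF W]
  define v where "v = (LINT u|lborel. (f u)\<^sup>2)"
  have "integrable N (\<lambda>\<omega>. (Y \<omega>)\<^sup>2) \<and> expectation (\<lambda>\<omega>. (Y \<omega>)\<^sup>2) = v"
  proof (cases "v = 0")
    case True
    then have "prob {\<omega> \<in> space N. Y \<omega> \<in> {0}} = 1"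
      using wiener_null[OF W, of "{0}"] by (simp add: v_def)
    then have "AE \<omega> in N. Y \<omega> = 0"
      using prob_eq_1[of "{\<omega> \<in> space N. Y \<omega> \<in> {0}}"] by simp
    then have "AE \<omega> in N. (Y \<omega>)\<^sup>2 = 0" by auto
    then have "integrable N (\<lambda>\<omega>. (Y \<omega>)\<^sup>2) \<longleftrightarrow> integrable N (\<lambda>\<omega>. 0::real)"
      "expectation (\<lambda>\<omega>. (Y \<omega>)\<^sup>2) = expectation (\<lambda>\<omega>. 0::real)"
      by (intro integrable_cong_AE integral_cong_AE; simp)+
    with True show ?thesis by simp
  next
    case False
    then have pos: "v > 0" by (simp add: v_def less_le)
    have D: "distr N borel (\<lambda>\<omega>. Y \<omega> / sqrt v) = std_normal_distribution"
      unfolding v_def using wiener_normalized[OF W] pos by (simp add: v_def)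
    have "integrable (distr N borel (\<lambda>\<omega>. Y \<omega> / sqrt v)) (\<lambda>x. x\<^sup>2)"
      unfolding D by (rule integrable_std_normal_distribution_moment)
    then have i: "integrable N (\<lambda>\<omega>. (Y \<omega> / sqrt v)\<^sup>2)"
      by (subst (asm) integrable_distr_eq) auto
    have "(LINT x|distr N borel (\<lambda>\<omega>. Y \<omega> / sqrt v). x\<^sup>2) = 1"
      unfolding D using std_normal_distribution_even_moments(1)[of 1] by (simp add: fact_numeral)
    then have e: "expectation (\<lambda>\<omega>. (Y \<omega> / sqrt v)\<^sup>2) = 1"
      by (subst (asm) integral_distr) auto
    have eq: "(Y \<omega>)\<^sup>2 = v * (Y \<omega> / sqrt v)\<^sup>2" for \<omega>
      using pos by (simp add: power_divide)
    show ?thesis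
      unfolding eq using i e by simp
  qed
  then show "integrable N (\<lambda>\<omega>. (Y \<omega>)\<^sup>2)" "expectation (\<lambda>\<omega>. (Y \<omega>)\<^sup>2) = (LINT u|lborel. (f u)\<^sup>2)"
    by (auto simp: v_def)
qed

text \<open>Polarisation of \<open>wiener_second_moment\<close>.\<close>

lemma wiener_covariance:
  assumes f: "wiener f Y" and g: "wiener g Z"
  shows "expectation (\<lambda>\<omega>. Y \<omega> * Z \<omega>) = (LINT u|lborel. f u * g u)"
proof -
  note m = wiener_measurable[OF f] wiener_measurable[OF g]
  have "expectation (\<lambda>\<omega>. (Y \<omega> + 1 * Z \<omega>)\<^sup>2) = (LINT u|lborel. (f u + 1 * g u)\<^sup>2)"
    by (rule wiener_second_moment(2)[OF wiener_lincomb[OF f g]])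
  then have "expectation (\<lambda>\<omega>. (Y \<omega>)\<^sup>2) + 2 * 1 * expectation (\<lambda>\<omega>. Y \<omega> * Z \<omega>) + 1\<^sup>2 * expectation (\<lambda>\<omega>. (Z \<omega>)\<^sup>2)
     = (LINT u|lborel. (f u)\<^sup>2) + 2 * 1 * (LINT u|lborel. f u * g u) + 1\<^sup>2 * (LINT u|lborel. (g u)\<^sup>2)"
    using m f g
    by (subst (asm) (1 2) square_integrable_lincomb(2))
      (auto intro: wiener_second_moment wiener_square_integrable)
  then show ?thesis
    using wiener_second_moment(2)[OF f] wiener_second_moment(2)[OF g] by simp
qed

lemma wiener_prob_eq:
  assumes J: "finite J" and F: "\<And>j. j \<in> J \<Longrightarrow> wiener (F j) (Y j)" and G: "\<And>j. j \<in> J \<Longrightarrow> wiener (G j) (Z j)"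
    and eq: "\<And>c. (LINT u|lborel. (\<Sum>j\<in>J. c j * F j u)\<^sup>2) = (LINT u|lborel. (\<Sum>j\<in>J. c j * G j u)\<^sup>2)"
    and S: "\<And>j. j \<in> J \<Longrightarrow> S j \<in> sets borel"
  shows "prob {\<omega> \<in> space N. \<forall>j\<in>J. Y j \<omega> \<in> S j} = prob {\<omega> \<in> space N. \<forall>j\<in>J. Z j \<omega> \<in> S j}"
proof (rule joint_char_eq_imp_prob_eq[OF prob_space_axioms prob_space_axioms J])
  fix c
  have "(CLINT \<omega>|N. iexp (\<Sum>j\<in>J. c j * Y j \<omega>)) = exp (- (LINT u|lborel. (\<Sum>j\<in>J. c j * F j u)\<^sup>2) / 2)"
    by (rule wiener_char[OF wiener_sum[OF J F]])
  also have "\<dots> = (CLINT \<omega>|N. iexp (\<Sum>j\<in>J. c j * Z j \<omega>))"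
    unfolding eq by (rule wiener_char[OF wiener_sum[OF J G], symmetric])
  finally show "(CLINT \<omega>|N. iexp (\<Sum>j\<in>J. c j * Y j \<omega>)) = (CLINT \<omega>|N. iexp (\<Sum>j\<in>J. c j * Z j \<omega>))" .
next
qed (use F G S wiener_measurable in auto)

text \<open>The variables are compared with independent copies on a product space. Without cross
  terms the variance of a combination is the sum of the single variances, so the characteristic
  functions agree. Disjoint supports give the pointwise orthogonality.\<close>

lemma wiener_orthogonal_prob:
  assumes J: "finite J" and F: "\<And>j. j \<in> J \<Longrightarrow> wiener (F j) (Y j)"
    and orth: "\<And>i j u. i \<in> J \<Longrightarrow> j \<in> J \<Longrightarrow> i \<noteq> j \<Longrightarrow> F i u * F j u = 0"
    and S: "\<And>j. j \<in> J \<Longrightarrow> S j \<in> sets borel"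
  shows "prob {\<omega> \<in> space N. \<forall>j\<in>J. Y j \<omega> \<in> S j} = (\<Prod>j\<in>J. prob {\<omega> \<in> space N. Y j \<omega> \<in> S j})"
proof -
  interpret P: finite_product_prob_space "\<lambda>_. N" J
    by unfold_locales (rule J)
  have meas: "Y j \<in> borel_measurable N" if "j \<in> J" for j
    using wiener_measurable[OF F[OF that]] by simp
  have sq: "(\<Sum>j\<in>J. c j * F j u)\<^sup>2 = (\<Sum>j\<in>J. (c j * F j u)\<^sup>2)" for c u
  proof -
    have "(\<Sum>j\<in>J. c j * F j u)\<^sup>2 = (\<Sum>i\<in>J. \<Sum>j\<in>J. c i * c j * (F i u * F j u))"
      by (simp add: power2_eq_square sum_product mult_ac)
    also have "\<dots> = (\<Sum>i\<in>J. \<Sum>j\<in>J. if j = i then (c i * F i u)\<^sup>2 else 0)"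
      using orth by (intro sum.cong) (auto simp: power2_eq_square)
    finally show ?thesis using J by simp
  qed
  have "prob {\<omega> \<in> space N. \<forall>j\<in>J. Y j \<omega> \<in> S j} =
      measure (\<Pi>\<^sub>M j\<in>J. N) {x \<in> space (\<Pi>\<^sub>M j\<in>J. N). \<forall>j\<in>J. Y j (x j) \<in> S j}"
  proof (rule joint_char_eq_imp_prob_eq[OF prob_space_axioms P.prob_space_axioms J])
    fix c
    have "(CLINT \<omega>|N. iexp (\<Sum>j\<in>J. c j * Y j \<omega>)) = exp (- (LINT u|lborel. (\<Sum>j\<in>J. c j * F j u)\<^sup>2) / 2)"
      by (rule wiener_char[OF wiener_sum[OF J F]])
    also have "(LINT u|lborel. (\<Sum>j\<in>J. c j * F j u)\<^sup>2) = (\<Sum>j\<in>J. LINT u|lborel. (c j * F j u)\<^sup>2)"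
      unfolding sq by (intro Bochner_Integration.integral_sum wiener_square_integrable[OF wiener_scale[OF F]])
    also have "complex_of_real (exp (- (\<Sum>j\<in>J. LINT u|lborel. (c j * F j u)\<^sup>2) / 2)) =
        (\<Prod>j\<in>J. complex_of_real (exp (- (LINT u|lborel. (c j * F j u)\<^sup>2) / 2)))"
      using J by (simp add: exp_sum[symmetric] sum_negf sum_divide_distrib flip: of_real_prod)
    also have "\<dots> = (\<Prod>j\<in>J. CLINT \<omega>|N. iexp (c j * Y j \<omega>))"
      by (intro prod.cong refl wiener_char[OF wiener_scale[OF F], symmetric])
    also have "\<dots> = (CLINT x|(\<Pi>\<^sub>M j\<in>J. N). (\<Prod>j\<in>J. iexp (c j * Y j (x j))))"
    proof (rule P.product_integral_prod[OF J, symmetric])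
      fix j assume "j \<in> J"
      then show "integrable N (\<lambda>\<omega>. iexp (c j * Y j \<omega>))"
        using meas by (intro integrable_const_bound[where B=1]) auto
    qed
    also have "\<dots> = (CLINT x|(\<Pi>\<^sub>M j\<in>J. N). iexp (\<Sum>j\<in>J. c j * Y j (x j)))"
      using J by (simp add: exp_sum sum_distrib_left)
    finally show "(CLINT \<omega>|N. iexp (\<Sum>j\<in>J. c j * Y j \<omega>)) =
      (CLINT x|(\<Pi>\<^sub>M j\<in>J. N). iexp (\<Sum>j\<in>J. c j * Y j (x j)))"
      by simp
  next
    fix j assume "j \<in> J"
    then show "(\<lambda>x. Y j (x j)) \<in> borel_measurable (\<Pi>\<^sub>M j\<in>J. N)"
      using measurable_compose[OF measurable_component_singleton[of j J "\<lambda>_. N"] meas[of j]] by simp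
  qed (use meas S in auto)
  also have "{x \<in> space (\<Pi>\<^sub>M j\<in>J. N). \<forall>j\<in>J. Y j (x j) \<in> S j} = (\<Pi>\<^sub>E j\<in>J. {\<omega> \<in> space N. Y j \<omega> \<in> S j})"
    by (auto simp: space_PiM PiE_def Pi_def extensional_def)
  also have "measure (\<Pi>\<^sub>M j\<in>J. N) \<dots> = (\<Prod>j\<in>J. prob {\<omega> \<in> space N. Y j \<omega> \<in> S j})"
  proof (rule P.prob_times)
    fix j assume "j \<in> J"
    then show "{\<omega> \<in> space N. Y j \<omega> \<in> S j} \<in> sets N"
      using meas S by (intro sets_Collect_mem)
  qed
  finally show ?thesis .
qed

text \<open>
  Fernique: two independent copies \<open>Y\<close>, \<open>Y'\<close> may be rotated to \<open>(Y - Y')/\<surd>2\<close>, \<open>(Y + Y')/\<surd>2\<close>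
  without changing their joint law.
\<close>

lemma wiener_rotation:
  fixes F :: "'i \<Rightarrow> real \<Rightarrow> real" and Y :: "'i \<Rightarrow> 'b \<Rightarrow> real"
  assumes J: "finite J" and F: "\<And>j. j \<in> J \<Longrightarrow> wiener (F j) (Y j)"
    and S: "\<And>j. j \<in> J \<Longrightarrow> S j \<in> sets borel" "\<And>j. j \<in> J \<Longrightarrow> S' j \<in> sets borel"
  shows "measure (N \<Otimes>\<^sub>M N) {x \<in> space (N \<Otimes>\<^sub>M N). (\<forall>j\<in>J. Y j (fst x) \<in> S j) \<and> (\<forall>j\<in>J. Y j (snd x) \<in> S' j)} =
    measure (N \<Otimes>\<^sub>M N) {x \<in> space (N \<Otimes>\<^sub>M N). (\<forall>j\<in>J. (Y j (fst x) - Y j (snd x)) / sqrt 2 \<in> S j) \<and>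
      (\<forall>j\<in>J. (Y j (fst x) + Y j (snd x)) / sqrt 2 \<in> S' j)}"
proof -
  interpret P: pair_prob_space N N ..
  have meas: "Y j \<in> borel_measurable N" if "j \<in> J" for j
    using wiener_measurable[OF F[OF that]] by simp
  have meas1: "(\<lambda>x. Y j (fst x)) \<in> borel_measurable (N \<Otimes>\<^sub>M N)"
    and meas2: "(\<lambda>x. Y j (snd x)) \<in> borel_measurable (N \<Otimes>\<^sub>M N)" if "j \<in> J" for j
    using meas[OF that] by measurable
  define Z where "Z k = (case k of Inl j \<Rightarrow> (\<lambda>x. Y j (fst x)) | Inr j \<Rightarrow> (\<lambda>x. Y j (snd x)))" for k
  define Z' where "Z' k = (case k of Inl j \<Rightarrow> (\<lambda>x. (Y j (fst x) - Y j (snd x)) / sqrt 2)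
      | Inr j \<Rightarrow> (\<lambda>x. (Y j (fst x) + Y j (snd x)) / sqrt 2))" for k
  define V where "V c = (LINT u|lborel. (\<Sum>j\<in>J. c j * F j u)\<^sup>2)" for c
  have char: "(CLINT x|N \<Otimes>\<^sub>M N. iexp ((\<Sum>j\<in>J. a j * Y j (fst x)) + (\<Sum>j\<in>J. b j * Y j (snd x)))) =
      exp (- (V a + V b) / 2)" for a b
  proof -
    let ?f = "\<lambda>x y. iexp (\<Sum>j\<in>J. a j * Y j x) * iexp (\<Sum>j\<in>J. b j * Y j y)"
    have "integrable (N \<Otimes>\<^sub>M N) (\<lambda>(x, y). ?f x y)"
    proof (rule P.integrable_const_bound[where B=1])
      have "(\<lambda>x. \<Sum>j\<in>J. a j * Y j (fst x)) \<in> borel_measurable (N \<Otimes>\<^sub>M N)"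
        "(\<lambda>x. \<Sum>j\<in>J. b j * Y j (snd x)) \<in> borel_measurable (N \<Otimes>\<^sub>M N)"
        using meas1 meas2 by (auto intro!: borel_measurable_sum)
      then show "(\<lambda>(x, y). ?f x y) \<in> borel_measurable (N \<Otimes>\<^sub>M N)"
        unfolding split_beta by measurable
    qed (auto simp: norm_mult simp del: of_real_sum)
    then have "(CLINT x|N \<Otimes>\<^sub>M N. case x of (x, y) \<Rightarrow> ?f x y) = (CLINT x|N. CLINT y|N. ?f x y)"
      by (rule P.integral_fst[symmetric])
    also have "\<dots> = (CLINT x|N. iexp (\<Sum>j\<in>J. a j * Y j x)) * (CLINT y|N. iexp (\<Sum>j\<in>J. b j * Y j y))"
      by simp
    also have "(CLINT x|N. iexp (\<Sum>j\<in>J. a j * Y j x)) = exp (- V a / 2)"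
      unfolding V_def by (rule wiener_char[OF wiener_sum[OF J F]])
    also have "(CLINT x|N. iexp (\<Sum>j\<in>J. b j * Y j x)) = exp (- V b / 2)"
      unfolding V_def by (rule wiener_char[OF wiener_sum[OF J F]])
    also have "complex_of_real (exp (- V a / 2)) * complex_of_real (exp (- V b / 2)) = exp (- (V a + V b) / 2)"
      by (simp only: of_real_mult[symmetric] exp_add[symmetric] minus_add_distrib add_divide_distrib)
    finally show ?thesis
      by (simp add: split_beta exp_add distrib_left)
  qed
  \<comment> \<open>The rotation acts on the coefficient pair \<open>(a, b)\<close>, and the
    parallelogram identity leaves the total variance \<open>V a + V b\<close> unchanged.\<close>
  have par: "V (\<lambda>j. (a j + b j) / sqrt 2) + V (\<lambda>j. (b j - a j) / sqrt 2) = V a + V b" for a b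
  proof -
    let ?A = "\<lambda>u. \<Sum>j\<in>J. a j * F j u" and ?B = "\<lambda>u. \<Sum>j\<in>J. b j * F j u"
    have WA: "wiener ?A (\<lambda>\<omega>. \<Sum>j\<in>J. a j * Y j \<omega>)" and WB: "wiener ?B (\<lambda>\<omega>. \<Sum>j\<in>J. b j * Y j \<omega>)"
      by (intro wiener_sum J F; assumption)+
    have "(\<Sum>j\<in>J. (a j + b j) / sqrt 2 * F j u) = (?A u + ?B u) / sqrt 2"
      "(\<Sum>j\<in>J. (b j - a j) / sqrt 2 * F j u) = (?B u - ?A u) / sqrt 2" for u
      by (simp_all add: sum_divide_distrib sum.distrib[symmetric] sum_subtractf[symmetric] algebra_simps
          add_divide_distrib diff_divide_distrib)
    then have "V (\<lambda>j. (a j + b j) / sqrt 2) + V (\<lambda>j. (b j - a j) / sqrt 2) =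
        (LINT u|lborel. (?A u + 1 * ?B u)\<^sup>2) / 2 + (LINT u|lborel. (?B u + (-1) * ?A u)\<^sup>2) / 2"
      by (simp add: V_def power_divide)
    also have "\<dots> = V a + V b"
      unfolding V_def using wiener_measurable[OF WA] wiener_measurable[OF WB]
        wiener_square_integrable[OF WA] wiener_square_integrable[OF WB]
      by (subst (1 2) square_integrable_lincomb(2)) (simp_all add: mult.commute[of "?A _"] add_divide_distrib diff_divide_distrib)
    finally show ?thesis .
  qed
  have "measure (N \<Otimes>\<^sub>M N) {x \<in> space (N \<Otimes>\<^sub>M N). \<forall>k\<in>J <+> J. Z k x \<in> case_sum S S' k} =
      measure (N \<Otimes>\<^sub>M N) {x \<in> space (N \<Otimes>\<^sub>M N). \<forall>k\<in>J <+> J. Z' k x \<in> case_sum S S' k}"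
  proof (rule joint_char_eq_imp_prob_eq[OF P.prob_space_axioms P.prob_space_axioms])
    fix c :: "'i + 'i \<Rightarrow> real"
    define a b where "a j = c (Inl j)" and "b j = c (Inr j)" for j
    have "(\<Sum>k\<in>J <+> J. c k * Z k x) = (\<Sum>j\<in>J. a j * Y j (fst x)) + (\<Sum>j\<in>J. b j * Y j (snd x))" for x
      using J by (simp add: sum.Plus Z_def a_def b_def)
    moreover have "(\<Sum>k\<in>J <+> J. c k * Z' k x) =
        (\<Sum>j\<in>J. (a j + b j) / sqrt 2 * Y j (fst x)) + (\<Sum>j\<in>J. (b j - a j) / sqrt 2 * Y j (snd x))" for x
      using J by (simp add: sum.Plus Z'_def a_def b_def sum.distrib[symmetric] algebra_simps
          add_divide_distrib diff_divide_distrib)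
    ultimately show "(CLINT x|N \<Otimes>\<^sub>M N. iexp (\<Sum>k\<in>J <+> J. c k * Z k x)) =
        (CLINT x|N \<Otimes>\<^sub>M N. iexp (\<Sum>k\<in>J <+> J. c k * Z' k x))"
      by (simp only: char par)
  qed (use J S meas1 meas2 in \<open>auto simp: Z_def Z'_def\<close>)
  then show ?thesis
    by (simp add: Z_def Z'_def ball_Un Plus_def ball_simps)
qed

text \<open>After the rotation the left side is the probability that all differences are at most
  \<open>s * sqrt 2\<close> in modulus while some sum exceeds \<open>s * sqrt 2 + 2 * u\<close>. At
  that index both copies exceed \<open>u\<close> in modulus, and the two copies are
  independent.\<close>

lemma fernique_step:
  fixes F :: "'i \<Rightarrow> real \<Rightarrow> real" and Y :: "'i \<Rightarrow> 'b \<Rightarrow> real"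
  assumes J: "finite J" and F: "\<And>j. j \<in> J \<Longrightarrow> wiener (F j) (Y j)"
  shows "prob {\<omega> \<in> space N. \<forall>j\<in>J. \<bar>Y j \<omega>\<bar> \<le> s} * prob {\<omega> \<in> space N. \<not> (\<forall>j\<in>J. \<bar>Y j \<omega>\<bar> \<le> s + sqrt 2 * u)}
    \<le> (prob {\<omega> \<in> space N. \<not> (\<forall>j\<in>J. \<bar>Y j \<omega>\<bar> \<le> u)})\<^sup>2"
proof -
  interpret P: pair_prob_space N N ..
  define v where "v = s + sqrt 2 * u"
  have meas: "Y j \<in> borel_measurable N" if "j \<in> J" for j
    using wiener_measurable[OF F[OF that]] by simp
  define A where "A r = {\<omega> \<in> space N. \<forall>j\<in>J. \<bar>Y j \<omega>\<bar> \<le> r}" for r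
  define C where "C r = {\<omega> \<in> space N. \<not> (\<forall>j\<in>J. \<bar>Y j \<omega>\<bar> \<le> r)}" for r
  have A[measurable]: "A r \<in> sets N" for r
    unfolding A_def using J meas by (intro sets.sets_Collect_finite_All borel_measurable_le) auto
  have C_eq: "C r = space N - A r" for r
    by (auto simp: A_def C_def)
  have C[measurable]: "C r \<in> sets N" for r
    unfolding C_eq by measurable
  have rect: "measure (N \<Otimes>\<^sub>M N) (E \<times> E') = prob E * prob E'" if "E \<in> sets N" "E' \<in> sets N" for E E'
    using that by (simp add: measure_def emeasure_pair_measure_Times enn2real_mult)
  define E1 where "E1 = {x \<in> space (N \<Otimes>\<^sub>M N). (\<forall>j\<in>J. (Y j (fst x) - Y j (snd x)) / sqrt 2 \<in> {- s..s})}"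
  define E2 where "E2 = {x \<in> space (N \<Otimes>\<^sub>M N). (\<forall>j\<in>J. (Y j (fst x) - Y j (snd x)) / sqrt 2 \<in> {- s..s}) \<and>
      (\<forall>j\<in>J. (Y j (fst x) + Y j (snd x)) / sqrt 2 \<in> {- v..v})}"
  have mm: "(\<lambda>x. (Y j (fst x) - Y j (snd x)) / sqrt 2) \<in> borel_measurable (N \<Otimes>\<^sub>M N)"
     "(\<lambda>x. (Y j (fst x) + Y j (snd x)) / sqrt 2) \<in> borel_measurable (N \<Otimes>\<^sub>M N)" if "j \<in> J" for j
    using meas[OF that] by measurable
  have E: "E1 \<in> sets (N \<Otimes>\<^sub>M N)" "E2 \<in> sets (N \<Otimes>\<^sub>M N)"
    unfolding E1_def E2_def using J mm
    by (auto intro!: sets.sets_Collect_finite_All sets.sets_Collect_conj sets_Collect_mem)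
  note rot = wiener_rotation[where F=F and Y=Y, OF J F]
  have absle: "y \<in> {- r..r} \<longleftrightarrow> \<bar>y\<bar> \<le> r" for y r :: real by auto
  have 1: "prob (A s) = measure (N \<Otimes>\<^sub>M N) E1"
  proof -
    have "{x \<in> space (N \<Otimes>\<^sub>M N). (\<forall>j\<in>J. Y j (fst x) \<in> {- s..s}) \<and> (\<forall>j\<in>J. Y j (snd x) \<in> UNIV)} = A s \<times> space N"
      unfolding absle by (auto simp: A_def space_pair_measure)
    then have "measure (N \<Otimes>\<^sub>M N) (A s \<times> space N) = measure (N \<Otimes>\<^sub>M N) E1"
      using rot[of "\<lambda>_. {- s..s}" "\<lambda>_. UNIV"] by (simp add: E1_def)
    then show ?thesis by (simp add: rect prob_space)
  qed
  have 2: "prob (A s) * prob (A v) = measure (N \<Otimes>\<^sub>M N) E2"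
  proof -
    have "{x \<in> space (N \<Otimes>\<^sub>M N). (\<forall>j\<in>J. Y j (fst x) \<in> {- s..s}) \<and> (\<forall>j\<in>J. Y j (snd x) \<in> {- v..v})} = A s \<times> A v"
      unfolding absle by (auto simp: A_def space_pair_measure)
    then have "measure (N \<Otimes>\<^sub>M N) (A s \<times> A v) = measure (N \<Otimes>\<^sub>M N) E2"
      using rot[of "\<lambda>_. {- s..s}" "\<lambda>_. {- v..v}"] by (simp add: E2_def)
    then show ?thesis by (simp add: rect)
  qed
  have Cv: "prob (C v) = 1 - prob (A v)"
    unfolding C_eq by (rule prob_compl) simp
  have "prob (A s) * prob (C v) = measure (N \<Otimes>\<^sub>M N) E1 - measure (N \<Otimes>\<^sub>M N) E2"
    unfolding Cv 1[symmetric] 2[symmetric] by (simp add: right_diff_distrib)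
  also have "\<dots> = measure (N \<Otimes>\<^sub>M N) (E1 - E2)"
    using E by (intro P.finite_measure_Diff[symmetric]) (auto simp: E1_def E2_def)
  also have "\<dots> \<le> measure (N \<Otimes>\<^sub>M N) (C u \<times> C u)"
  proof (rule P.finite_measure_mono)
    show "E1 - E2 \<subseteq> C u \<times> C u"
    proof
      fix x assume x: "x \<in> E1 - E2"
      then obtain j where j: "j \<in> J" "\<not> \<bar>(Y j (fst x) + Y j (snd x)) / sqrt 2\<bar> \<le> v"
        unfolding E1_def E2_def absle by blast
      have "\<bar>(Y j (fst x) - Y j (snd x)) / sqrt 2\<bar> \<le> s"
        using x j(1) unfolding E1_def absle by blast
      then have "\<bar>Y j (fst x) - Y j (snd x)\<bar> \<le> s * sqrt 2"
        by (simp add: abs_divide pos_divide_le_eq)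
      moreover have "v * sqrt 2 < \<bar>Y j (fst x) + Y j (snd x)\<bar>"
        using j(2) by (simp add: abs_divide pos_divide_le_eq not_le)
      moreover have "v * sqrt 2 = s * sqrt 2 + 2 * u"
        by (simp add: v_def algebra_simps)
      ultimately have "\<bar>Y j (fst x)\<bar> > u" "\<bar>Y j (snd x)\<bar> > u"
        by linarith+
      moreover have "fst x \<in> space N" "snd x \<in> space N"
        using x by (auto simp: E1_def space_pair_measure)
      ultimately have "fst x \<in> C u" "snd x \<in> C u"
        using j(1) by (auto simp: C_def not_le)
      then show "x \<in> C u \<times> C u"
        by (metis mem_Times_iff)
    qed
  qed simp
  also have "\<dots> = (prob (C u))\<^sup>2"
    by (simp add: rect power2_eq_square)
  finally show ?thesis
    by (simp add: A_def C_def v_def)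
qed

text \<open>Each use of \<open>fernique_step\<close> squares the ratio of the exceedance probability
  to \<open>p\<close>, while the level grows only by a factor of about \<open>sqrt 2\<close>. An
  exponent that doubles whenever the squared level doubles is a Gaussian tail.\<close>

lemma fernique:
  fixes F :: "'i \<Rightarrow> real \<Rightarrow> real" and Y :: "'i \<Rightarrow> 'b \<Rightarrow> real"
  assumes J: "finite J" and F: "\<And>j. j \<in> J \<Longrightarrow> wiener (F j) (Y j)"
    and s: "0 < s" "3 / 4 \<le> prob {\<omega> \<in> space N. \<forall>j\<in>J. \<bar>Y j \<omega>\<bar> \<le> s}" and u: "4 * s \<le> u"
  shows "prob {\<omega> \<in> space N. \<not> (\<forall>j\<in>J. \<bar>Y j \<omega>\<bar> \<le> u)} \<le> exp (- u\<^sup>2 / (32 * s\<^sup>2))"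
proof -
  define p where "p = prob {\<omega> \<in> space N. \<forall>j\<in>J. \<bar>Y j \<omega>\<bar> \<le> s}"
  define q where "q r = prob {\<omega> \<in> space N. \<not> (\<forall>j\<in>J. \<bar>Y j \<omega>\<bar> \<le> r)}" for r
  have meas: "Y j \<in> borel_measurable N" if "j \<in> J" for j
    using wiener_measurable[OF F[OF that]] by simp
  have A[measurable]: "{\<omega> \<in> space N. \<forall>j\<in>J. \<bar>Y j \<omega>\<bar> \<le> r} \<in> sets N" for r
    using J meas by (intro sets.sets_Collect_finite_All borel_measurable_le) auto
  have p: "3 / 4 \<le> p" "p \<le> 1"
    using s by (auto simp: p_def)
  have "{\<omega> \<in> space N. \<not> (\<forall>j\<in>J. \<bar>Y j \<omega>\<bar> \<le> s)} = space N - {\<omega> \<in> space N. \<forall>j\<in>J. \<bar>Y j \<omega>\<bar> \<le> s}"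
    by auto
  then have q0: "q s = 1 - p"
    unfolding q_def p_def by (simp only:) (rule prob_compl[OF A])
  define r where "r = rec_nat s (\<lambda>_ x. s + sqrt 2 * x)"
  have r: "r 0 = s" "r (Suc n) = s + sqrt 2 * r n" for n
    by (simp_all add: r_def)
  have step: "p * q (r (Suc n)) \<le> (q (r n))\<^sup>2" for n
    unfolding p_def q_def r by (rule fernique_step[OF J F])
  \<comment> \<open>The start \<open>p\<close> of at least 3/4 makes the initial ratio
    \<open>(1 - p) / p\<close> at most 1/3.\<close>
  have q: "q (r n) \<le> p * (1 / 3) ^ (2 ^ n)" for n
  proof (induction n)
    case 0
    then show ?case using q0 p r by simp
  next
    case (Suc n)
    have "p * q (r (Suc n)) \<le> (q (r n))\<^sup>2" by (rule step)
    also have "\<dots> \<le> (p * (1 / 3) ^ (2 ^ n))\<^sup>2"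
      using Suc by (intro power_mono) (auto simp: q_def)
    also have "\<dots> = p * (p * (1 / 3) ^ (2 ^ Suc n))"
      by (simp add: power2_eq_square power_add[symmetric] mult_2)
    finally show ?case
      using p by (simp add: mult_le_cancel_left_pos)
  qed
  \<comment> \<open>Exactly what absorbs the additive \<open>s\<close> of the recursion:
    \<open>4 * s\<close> is at most \<open>sqrt 2 * (3 * s)\<close>, which is why
    \<open>r n + 3 * s\<close> is the quantity that grows geometrically.\<close>
  have sqrt2: "4 / 3 \<le> sqrt 2"
    by (rule real_le_rsqrt) (simp add: power2_eq_square)
  have r_le: "r n + 3 * s \<le> 4 * s * sqrt 2 ^ n" for n
  proof (induction n)
    case (Suc n)
    have "r (Suc n) + 3 * s = 4 * s + sqrt 2 * r n"
      by (simp add: r)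
    also have "\<dots> \<le> sqrt 2 * (3 * s) + sqrt 2 * r n"
      using mult_right_mono[OF sqrt2, of "3 * s"] s by simp
    also have "\<dots> = sqrt 2 * (r n + 3 * s)" by (simp add: algebra_simps)
    also have "\<dots> \<le> sqrt 2 * (4 * s * sqrt 2 ^ n)"
      using Suc by (intro mult_left_mono) auto
    finally show ?case by (simp add: mult_ac)
  qed (simp add: r)
  obtain n where n: "4 * s * sqrt 2 ^ n \<le> u" "u < 4 * s * sqrt 2 ^ Suc n"
  proof -
    have "\<exists>n. u < 4 * s * sqrt 2 ^ n"
    proof -
      obtain n where "u / (4 * s) < sqrt 2 ^ n"
        using real_arch_pow[of "sqrt 2"] by auto
      then show ?thesis using s by (auto simp: field_simps)
    qed
    then obtain m where m: "u < 4 * s * sqrt 2 ^ m" "\<And>k. k < m \<Longrightarrow> \<not> u < 4 * s * sqrt 2 ^ k"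
      using exists_least_iff[of "\<lambda>n. u < 4 * s * sqrt 2 ^ n"] by auto
    \<comment> \<open>The hypothesis \<open>4 * s \<le> u\<close> excludes 0, so the least exceeding
      index has a predecessor.\<close>
    with u have "m \<noteq> 0" by (intro notI) auto
    then obtain k where "m = Suc k" by (cases m) auto
    with m show ?thesis by (intro that[of k]) (auto simp: not_less)
  qed
  have "q u \<le> q (r n)"
    unfolding q_def
  proof (rule finite_measure_mono)
    have "r n \<le> u"
      using r_le[of n] n(1) s by linarith
    then show "{\<omega> \<in> space N. \<not> (\<forall>j\<in>J. \<bar>Y j \<omega>\<bar> \<le> u)} \<subseteq> {\<omega> \<in> space N. \<not> (\<forall>j\<in>J. \<bar>Y j \<omega>\<bar> \<le> r n)}"
      by fastforce
    have "space N - {\<omega> \<in> space N. \<forall>j\<in>J. \<bar>Y j \<omega>\<bar> \<le> r n} = {\<omega> \<in> space N. \<not> (\<forall>j\<in>J. \<bar>Y j \<omega>\<bar> \<le> r n)}"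
      by auto
    then show "{\<omega> \<in> space N. \<not> (\<forall>j\<in>J. \<bar>Y j \<omega>\<bar> \<le> r n)} \<in> events"
      using sets.compl_sets[OF A[of "r n"]] by simp
  qed
  also have "\<dots> \<le> p * (1 / 3) ^ (2 ^ n)" by (rule q)
  also have "\<dots> \<le> 1 * (exp (- 1)) ^ (2 ^ n)"
    using p exp_le by (intro mult_mono power_mono) (auto simp: exp_minus field_simps)
  also have "\<dots> = exp (- (2 ^ n))"
    by (simp add: exp_of_nat_mult[symmetric])
  also have "\<dots> \<le> exp (- u\<^sup>2 / (32 * s\<^sup>2))"
  proof -
    \<comment> \<open>Source of the constant 32: it is 4 squared, times 2 for passing from
      \<open>n\<close> to \<open>Suc n\<close>.\<close>
    have "u\<^sup>2 \<le> (4 * s * sqrt 2 ^ Suc n)\<^sup>2"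
      using n(2) s u by (intro power_mono) auto
    also have "(sqrt 2 ^ Suc n)\<^sup>2 = (2::real) ^ Suc n"
      by (metis abs_numeral power2_eq_square power_mult_distrib real_sqrt_abs2 real_sqrt_mult_self)
    then have "(4 * s * sqrt 2 ^ Suc n)\<^sup>2 = 32 * s\<^sup>2 * 2 ^ n"
      by (simp only: power_mult_distrib) simp
    finally have "u\<^sup>2 / (32 * s\<^sup>2) \<le> 2 ^ n"
      using s by (simp add: divide_le_eq mult_ac)
    then show ?thesis by simp
  qed
  finally show ?thesis by (simp add: q_def)
qed

end

section \<open>The upper half of the law of the iterated logarithm\<close>

locale gfbm_process = gaussian_measure N B
  for N :: "'b measure" and B :: "real set \<Rightarrow> 'b \<Rightarrow> real" +
  fixes T \<alpha> \<gamma> H :: real and M :: "'a measure" and X :: "real \<Rightarrow> 'a \<Rightarrow> real" and I :: "real \<Rightarrow> 'b \<Rightarrow> real"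
  assumes T: "T > 0" and H: "H = \<alpha> - \<gamma> / 2 + 1 / 2" "0 < H"
    and prob_M: "prob_space M"
    and X_measurable: "\<And>t. t \<ge> 0 \<Longrightarrow> X t \<in> borel_measurable M"
    and X_continuous: "\<And>\<omega>. \<omega> \<in> space M \<Longrightarrow> continuous_on {0..} (\<lambda>t. X t \<omega>)"
    and I_wiener: "\<And>t. t \<ge> 0 \<Longrightarrow> is_wiener_integral N B (gfbm_kernel \<alpha> \<gamma> t) (I t)"
    and X_fdd: "same_fdd {0..} M X N (\<lambda>t \<omega>. gfbm_const \<alpha> \<gamma> * I t \<omega>)"
begin

sublocale M: prob_space M by (rule prob_M)

definition f :: "real \<Rightarrow> real \<Rightarrow> real" where
  "f t u = gfbm_const \<alpha> \<gamma> * gfbm_kernel \<alpha> \<gamma> t u"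

definition Y :: "real \<Rightarrow> 'b \<Rightarrow> real" where
  "Y t \<omega> = gfbm_const \<alpha> \<gamma> * I t \<omega>"

definition Q :: "real \<Rightarrow> real \<Rightarrow> real" where
  "Q s t = (LINT u|lborel. f s u * f t u)"

lemma wiener_Y: "t \<ge> 0 \<Longrightarrow> wiener (f t) (Y t)"
  unfolding f_def[abs_def] Y_def[abs_def] by (intro wiener_scale I_wiener)

lemma f_measurable: "t \<ge> 0 \<Longrightarrow> f t \<in> borel_measurable borel"
  using wiener_measurable[OF wiener_Y] by simp

lemma Y_measurable: "t \<ge> 0 \<Longrightarrow> Y t \<in> borel_measurable N"
  using wiener_measurable[OF wiener_Y] by simp

lemma f_integrable: "t \<ge> 0 \<Longrightarrow> integrable lborel (\<lambda>u. (f t u)\<^sup>2)"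
  by (rule wiener_square_integrable[OF wiener_Y])

text \<open>Homogeneity gives the exponent \<open>\<alpha>\<close> from the power and
  \<open>- \<gamma> / 2\<close> from the weight. Dividing by \<open>r powr H\<close> leaves -1/2,
  the exponent for which dilation preserves the L2 norm.\<close>

lemma f_self_similar:
  assumes "r > 0"
  shows "f (r * t) (r * u) / r powr H = r powr (- 1 / 2) * f t u"
proof -
  have pos: "pos_powr (r * x) \<alpha> = r powr \<alpha> * pos_powr x \<alpha>" for x
    using assms by (auto simp: pos_powr_def powr_mult zero_less_mult_iff)
  have "gfbm_kernel \<alpha> \<gamma> (r * t) (r * u) = r powr (\<alpha> - \<gamma> / 2) * gfbm_kernel \<alpha> \<gamma> t u"
  proof -
    have "\<bar>r * u\<bar> powr (- \<gamma> / 2) = r powr (- \<gamma> / 2) * \<bar>u\<bar> powr (- \<gamma> / 2)"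
      using assms by (simp add: abs_mult powr_mult)
    moreover have "r powr (\<alpha> - \<gamma> / 2) = r powr \<alpha> * r powr (- \<gamma> / 2)"
      by (simp flip: powr_add)
    moreover have "r * t - r * u = r * (t - u)" "- (r * u) = r * (- u)"
      by (simp_all add: algebra_simps)
    ultimately show ?thesis
      unfolding gfbm_kernel_def by (simp only: pos) (simp only: algebra_simps)
  qed
  moreover have "r powr (\<alpha> - \<gamma> / 2) / r powr H = r powr (- 1 / 2)"
    unfolding powr_diff[symmetric] by (simp add: H)
  ultimately show ?thesis
    by (simp add: f_def) (metis mult.left_commute times_divide_eq_left)
qed

lemma L2_norm_dilation:
  fixes G :: "real \<Rightarrow> real"
  assumes "r > 0" "\<And>u. G (r * u) = r powr (- 1 / 2) * G' u"
  shows "(LINT u|lborel. (G u)\<^sup>2) = (LINT u|lborel. (G' u)\<^sup>2)"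
proof -
  have "(r powr (- 1 / 2))\<^sup>2 = 1 / r"
    using assms(1) powr_add[of r "- 1 / 2" "- 1 / 2"] by (simp add: power2_eq_square powr_minus_divide)
  then have sq: "(G (r * u))\<^sup>2 = (G' u)\<^sup>2 / r" for u
    unfolding assms(2) power_mult_distrib by simp
  have "(LINT u|lborel. (G u)\<^sup>2) = r * (LINT u|lborel. (G (r * u))\<^sup>2)"
    using lborel_integral_real_affine[of r "\<lambda>u. (G u)\<^sup>2" 0] assms(1) by simp
  then show ?thesis
    unfolding sq using assms(1) by simp
qed

text \<open>Stated for families of linear combinations, so that one lemma serves the tails of a
  single functional, the increments in the modulus of continuity and the blocks of scales in the
  lower bound.\<close>

lemma fdd_transfer:
  fixes b :: "'i \<Rightarrow> 'k \<Rightarrow> real" and \<tau> :: "'i \<Rightarrow> 'k \<Rightarrow> real"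
  assumes fin: "finite J" "\<And>i. i \<in> J \<Longrightarrow> finite (K i)"
    and \<tau>: "\<And>i k. i \<in> J \<Longrightarrow> k \<in> K i \<Longrightarrow> 0 \<le> \<tau> i k"
    and S: "\<And>i. i \<in> J \<Longrightarrow> S i \<in> sets borel"
  shows "measure M {\<omega> \<in> space M. \<forall>i\<in>J. (\<Sum>k\<in>K i. b i k * X (\<tau> i k) \<omega>) \<in> S i} =
    measure N {\<omega> \<in> space N. \<forall>i\<in>J. (\<Sum>k\<in>K i. b i k * Y (\<tau> i k) \<omega>) \<in> S i}"
proof -
  define L where "L = (\<Union>i\<in>J. \<tau> i ` K i)"
  have L: "finite L" "L \<subseteq> {0..}"
    using fin \<tau> by (auto simp: L_def)
  have \<tau>L: "\<tau> i k \<in> L" if "i \<in> J" "k \<in> K i" for i k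
    using that by (auto simp: L_def)
  define A where "A = {x \<in> space (\<Pi>\<^sub>M t\<in>L. (borel :: real measure)). \<forall>i\<in>J. (\<Sum>k\<in>K i. b i k * x (\<tau> i k)) \<in> S i}"
  have A: "A \<in> sets (\<Pi>\<^sub>M t\<in>L. borel)"
    unfolding A_def
  proof (intro sets.sets_Collect_finite_All fin(1) sets_Collect_mem[where K=borel] S)
    fix i assume i: "i \<in> J"
    have "(\<lambda>x. b i k * x (\<tau> i k)) \<in> borel_measurable (\<Pi>\<^sub>M t\<in>L. (borel :: real measure))" if "k \<in> K i" for k
      using measurable_component_singleton[OF \<tau>L[OF i that], of "\<lambda>_. borel :: real measure"] by simp
    then show "(\<lambda>x. \<Sum>k\<in>K i. b i k * x (\<tau> i k)) \<in> borel_measurable (\<Pi>\<^sub>M t\<in>L. (borel :: real measure))"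
      by (intro borel_measurable_sum)
  qed
  have mX: "(\<lambda>\<omega>. \<lambda>t\<in>L. X t \<omega>) \<in> measurable M (\<Pi>\<^sub>M t\<in>L. borel)"
    using L by (intro measurable_restrict X_measurable) auto
  have mY: "(\<lambda>\<omega>. \<lambda>t\<in>L. Y t \<omega>) \<in> measurable N (\<Pi>\<^sub>M t\<in>L. borel)"
    using L by (intro measurable_restrict Y_measurable) auto
  have "distr M (\<Pi>\<^sub>M t\<in>L. borel) (\<lambda>\<omega>. \<lambda>t\<in>L. X t \<omega>) = distr N (\<Pi>\<^sub>M t\<in>L. borel) (\<lambda>\<omega>. \<lambda>t\<in>L. Y t \<omega>)"
    using X_fdd L unfolding same_fdd_def Y_def by blast
  then have "measure M ((\<lambda>\<omega>. \<lambda>t\<in>L. X t \<omega>) -` A \<inter> space M) = measure N ((\<lambda>\<omega>. \<lambda>t\<in>L. Y t \<omega>) -` A \<inter> space N)"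
    using measure_distr[OF mX A] measure_distr[OF mY A] by simp
  moreover have "(\<lambda>\<omega>. \<lambda>t\<in>L. X t \<omega>) -` A \<inter> space M =
      {\<omega> \<in> space M. \<forall>i\<in>J. (\<Sum>k\<in>K i. b i k * X (\<tau> i k) \<omega>) \<in> S i}"
    using \<tau>L by (auto simp: A_def space_PiM cong: sum.cong)
  moreover have "(\<lambda>\<omega>. \<lambda>t\<in>L. Y t \<omega>) -` A \<inter> space N =
      {\<omega> \<in> space N. \<forall>i\<in>J. (\<Sum>k\<in>K i. b i k * Y (\<tau> i k) \<omega>) \<in> S i}"
    using \<tau>L by (auto simp: A_def space_PiM cong: sum.cong)
  ultimately show ?thesis by simp
qed

lemma covariance_eq:
  assumes "s \<ge> 0" "t \<ge> 0"
  shows "covariance_fun M X s t = Q s t"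
proof -
  let ?L = "{s, t}"
  have mX: "(\<lambda>\<omega>. \<lambda>t\<in>?L. X t \<omega>) \<in> measurable M (\<Pi>\<^sub>M t\<in>?L. borel)"
    using assms by (intro measurable_restrict X_measurable) auto
  have mY: "(\<lambda>\<omega>. \<lambda>t\<in>?L. Y t \<omega>) \<in> measurable N (\<Pi>\<^sub>M t\<in>?L. borel)"
    using assms by (intro measurable_restrict Y_measurable) auto
  have D: "distr M (\<Pi>\<^sub>M t\<in>?L. borel) (\<lambda>\<omega>. \<lambda>t\<in>?L. X t \<omega>) = distr N (\<Pi>\<^sub>M t\<in>?L. borel) (\<lambda>\<omega>. \<lambda>t\<in>?L. Y t \<omega>)"
    using X_fdd assms unfolding same_fdd_def Y_def by simp
  have "(\<lambda>x. x s) \<in> borel_measurable (\<Pi>\<^sub>M t\<in>?L. (borel :: real measure))"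
    "(\<lambda>x. x t) \<in> borel_measurable (\<Pi>\<^sub>M t\<in>?L. (borel :: real measure))"
    using measurable_component_singleton[of s ?L "\<lambda>_. borel :: real measure"]
      measurable_component_singleton[of t ?L "\<lambda>_. borel :: real measure"] by auto
  then have m: "(\<lambda>x. x s * x t) \<in> borel_measurable (\<Pi>\<^sub>M t\<in>?L. (borel :: real measure))"
    by (rule borel_measurable_times)
  have "covariance_fun M X s t = (LINT x|distr M (\<Pi>\<^sub>M t\<in>?L. borel) (\<lambda>\<omega>. \<lambda>t\<in>?L. X t \<omega>). x s * x t)"
    by (subst integral_distr[OF mX m]) (simp add: covariance_fun_def)
  also have "\<dots> = expectation (\<lambda>\<omega>. Y s \<omega> * Y t \<omega>)"
    unfolding D by (subst integral_distr[OF mY m]) simp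
  also have "\<dots> = Q s t"
    unfolding Q_def by (rule wiener_covariance[OF wiener_Y[OF assms(1)] wiener_Y[OF assms(2)]])
  finally show ?thesis .
qed

lemma L2_norm_sum:
  assumes K: "finite K" and K0: "K \<subseteq> {0..}"
  shows "(LINT u|lborel. (\<Sum>s\<in>K. a s * f s u)\<^sup>2) = (\<Sum>s\<in>K. \<Sum>t\<in>K. a s * a t * Q s t)"
proof -
  have int: "integrable lborel (\<lambda>u. a s * a t * (f s u * f t u))" if "s \<in> K" "t \<in> K" for s t
    using that K0 f_measurable f_integrable by (intro integrable_mult_right square_integrable_mult) auto
  have "(\<Sum>s\<in>K. a s * f s u)\<^sup>2 = (\<Sum>s\<in>K. \<Sum>t\<in>K. a s * a t * (f s u * f t u))" for u
    by (simp add: power2_eq_square sum_product mult_ac)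
  then have "(LINT u|lborel. (\<Sum>s\<in>K. a s * f s u)\<^sup>2) = (\<Sum>s\<in>K. LINT u|lborel. (\<Sum>t\<in>K. a s * a t * (f s u * f t u)))"
    using int by (simp add: Bochner_Integration.integral_sum)
  also have "\<dots> = (\<Sum>s\<in>K. \<Sum>t\<in>K. LINT u|lborel. a s * a t * (f s u * f t u))"
    using int by (intro sum.cong refl Bochner_Integration.integral_sum) auto
  finally show ?thesis
    by (simp add: Q_def)
qed

abbreviation "\<Psi> \<equiv> covariance_fun M X"

lemma kernel_inner_eq_L2:
  assumes "a \<in> coeffs_on {0..T}"
  shows "kernel_inner \<Psi> a a = (LINT u|lborel. (coeff_lin a (\<lambda>s. f s u))\<^sup>2)"
proof -
  have "kernel_inner \<Psi> a a = (\<Sum>s | a s \<noteq> 0. \<Sum>t | a t \<noteq> 0. a s * a t * Q s t)"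
    unfolding kernel_inner_def
    using coeffs_onD(2)[OF assms] by (intro sum.cong refl) (auto simp: covariance_eq)
  also have "\<dots> = (LINT u|lborel. (coeff_lin a (\<lambda>s. f s u))\<^sup>2)"
    unfolding coeff_lin_def using coeffs_onD[OF assms] by (intro L2_norm_sum[symmetric]) auto
  finally show ?thesis .
qed

sublocale psd_kernel \<Psi> "{0..T}"
proof
  show "\<Psi> s t = \<Psi> t s" for s t
    by (simp add: covariance_fun_def mult.commute)
  show "0 \<le> kernel_inner \<Psi> a a" if "a \<in> coeffs_on {0..T}" for a
    unfolding kernel_inner_eq_L2[OF that] by simp
qed

text \<open>The denominator of \<open>lil_path\<close> at a real scale, with the self-similarity
  factor \<open>r powr H\<close> split off.\<close>

definition norming :: "real \<Rightarrow> real" where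
  "norming r = r powr H * sqrt (2 * ln (ln r))"

lemma wiener_coeff:
  assumes a: "a \<in> coeffs_on {0..T}" and r: "r > 0"
  shows "wiener (\<lambda>u. coeff_lin a (\<lambda>s. f (r * s) u) / r powr H) (\<lambda>\<omega>. coeff_lin a (\<lambda>s. Y (r * s) \<omega>) / r powr H)"
proof -
  have "wiener (\<lambda>u. \<Sum>s | a s \<noteq> 0. a s * f (r * s) u) (\<lambda>\<omega>. \<Sum>s | a s \<noteq> 0. a s * Y (r * s) \<omega>)"
    using coeffs_onD[OF a] r by (intro wiener_sum wiener_Y) auto
  from wiener_scale[OF this, of "1 / r powr H"] show ?thesis
    by (simp add: coeff_lin_def)
qed

lemma coeff_lin_f_self_similar:
  assumes "r > 0"
  shows "coeff_lin a (\<lambda>s. f (r * s) (r * u)) / r powr H = r powr (- 1 / 2) * coeff_lin a (\<lambda>s. f s u)"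
  unfolding coeff_lin_def sum_divide_distrib sum_distrib_left
  by (intro sum.cong refl)
    (simp only: times_divide_eq_right[symmetric] f_self_similar[OF assms] mult.left_commute)

lemma coeff_variance:
  assumes a: "a \<in> coeffs_on {0..T}" and r: "r > 0"
  shows "(LINT u|lborel. (coeff_lin a (\<lambda>s. f (r * s) u) / r powr H)\<^sup>2) = (nrm a)\<^sup>2"
  unfolding nrm_sq[OF a] kernel_inner_eq_L2[OF a]
  by (rule L2_norm_dilation[OF r]) (rule coeff_lin_f_self_similar[OF r])

lemma coeff_lin_X_measurable:
  assumes a: "a \<in> coeffs_on {0..T}" and r: "r > 0"
  shows "(\<lambda>\<omega>. coeff_lin a (\<lambda>s. X (r * s) \<omega>)) \<in> borel_measurable M"
  unfolding coeff_lin_def using coeffs_onD[OF a] r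
  by (intro borel_measurable_sum borel_measurable_times X_measurable) auto

lemma coeff_upper_tail:
  assumes a: "a \<in> coeffs_on {0..T}" and r: "r > 0" and w: "(nrm a)\<^sup>2 \<le> w" "0 < w" and x: "0 \<le> x"
  shows "measure M {\<omega> \<in> space M. \<bar>coeff_lin a (\<lambda>s. X (r * s) \<omega>)\<bar> > x * r powr H} \<le> 2 * exp (- x\<^sup>2 / (2 * w))"
proof -
  have r': "r powr H > 0" using r by simp
  have "measure M {\<omega> \<in> space M. \<forall>i\<in>{()}. (\<Sum>s\<in>{s. a s \<noteq> 0}. a s * X (r * s) \<omega>) \<in> {y. \<bar>y\<bar> > x * r powr H}} =
      measure N {\<omega> \<in> space N. \<forall>i\<in>{()}. (\<Sum>s\<in>{s. a s \<noteq> 0}. a s * Y (r * s) \<omega>) \<in> {y. \<bar>y\<bar> > x * r powr H}}"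
    using coeffs_onD[OF a] r by (intro fdd_transfer) auto
  then have "measure M {\<omega> \<in> space M. \<bar>coeff_lin a (\<lambda>s. X (r * s) \<omega>)\<bar> > x * r powr H} =
      prob {\<omega> \<in> space N. \<bar>coeff_lin a (\<lambda>s. Y (r * s) \<omega>) / r powr H\<bar> > x}"
    using r' by (simp add: coeff_lin_def abs_divide pos_less_divide_eq)
  also have "\<dots> \<le> 2 * exp (- x\<^sup>2 / (2 * w))"
    using w x by (intro wiener_upper_tail[OF wiener_coeff[OF a r]]) (auto simp: coeff_variance[OF a r])
  finally show ?thesis .
qed

text \<open>For positive \<open>k\<close> the summand is \<open>(k * ln l) powr (- p)\<close>, since
  the inner logarithm is linear in \<open>k\<close>. Iterated logarithms along a geometric sequence
  thus turn Gaussian tails into p-series.\<close>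

lemma summable_log_power:
  fixes l p :: real
  assumes "1 < l" "1 < p"
  shows "summable (\<lambda>k. exp (- p * ln (ln (l ^ k))))"
proof (rule summable_comparison_test_ev)
  have "ln l > 0" using assms by simp
  show "\<forall>\<^sub>F k in sequentially. norm (exp (- p * ln (ln (l ^ k)))) \<le> ln l powr (- p) * real k powr (- p)"
    using eventually_gt_at_top[of 0]
  proof eventually_elim
    case (elim k)
    then have "ln (ln (l ^ k)) = ln (real k) + ln (ln l)"
      using assms \<open>ln l > 0\<close> by (simp add: ln_realpow ln_mult)
    then show ?case
      using elim \<open>ln l > 0\<close> by (simp add: powr_def exp_add[symmetric] algebra_simps)
  qed
  show "summable (\<lambda>k. ln l powr (- p) * real k powr (- p))"
    using assms by (intro summable_mult) (simp add: summable_real_powr_iff)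
qed

text \<open>Borel-Cantelli with a tail exponent \<open>p > 1\<close>. As \<open>nrm a\<close> may be
  0, the tail bound is applied with the positive number \<open>nrm a + e i / 2\<close>, which still
  lies strictly below the level \<open>nrm a + e i\<close>.\<close>

lemma lil_upper:
  fixes l :: real
  assumes a: "a \<in> coeffs_on {0..T}" and l: "1 < l"
  shows "AE \<omega> in M. \<forall>e>0. \<forall>\<^sub>F k in sequentially. \<bar>coeff_lin a (\<lambda>s. X (l ^ k * s) \<omega>)\<bar> \<le> (nrm a + e) * norming (l ^ k)"
proof -
  define e where "e i = 1 / real (Suc i)" for i
  have e: "e i > 0" for i by (simp add: e_def)
  have mX[measurable]: "(\<lambda>\<omega>. coeff_lin a (\<lambda>s. X (l ^ k * s) \<omega>)) \<in> borel_measurable M" for k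
    using l by (intro coeff_lin_X_measurable[OF a]) simp
  have "AE \<omega> in M. \<forall>\<^sub>F k in sequentially. \<bar>coeff_lin a (\<lambda>s. X (l ^ k * s) \<omega>)\<bar> \<le> (nrm a + e i) * norming (l ^ k)" for i
  proof -
    define A where "A k = {\<omega> \<in> space M. \<bar>coeff_lin a (\<lambda>s. X (l ^ k * s) \<omega>)\<bar> > (nrm a + e i) * norming (l ^ k)}" for k
    have [measurable]: "A k \<in> sets M" for k
      unfolding A_def by measurable
    define p where "p = ((nrm a + e i) / (nrm a + e i / 2))\<^sup>2"
    have na: "nrm a \<ge> 0" using a by (rule nrm_nonneg)
    have "1 < (nrm a + e i) / (nrm a + e i / 2)"
      using e[of i] na by (simp add: less_divide_eq)
    then have p: "1 < p"
      unfolding p_def by (rule one_less_power) simp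
    have "\<forall>\<^sub>F k in sequentially. 1 \<le> ln (l ^ k)"
      using l by real_asymp
    then have bound: "\<forall>\<^sub>F k in sequentially. norm (measure M (A k)) \<le> 2 * exp (- p * ln (ln (l ^ k)))"
    proof eventually_elim
      case (elim k)
      define x where "x = (nrm a + e i) * sqrt (2 * ln (ln (l ^ k)))"
      have "measure M (A k) = measure M {\<omega> \<in> space M. \<bar>coeff_lin a (\<lambda>s. X (l ^ k * s) \<omega>)\<bar> > x * (l ^ k) powr H}"
        by (simp add: A_def x_def norming_def mult_ac)
      also have "\<dots> \<le> 2 * exp (- x\<^sup>2 / (2 * (nrm a + e i / 2)\<^sup>2))"
        using l elim e[of i] na by (intro coeff_upper_tail a) (auto simp: x_def intro!: power_mono)
      also have "x\<^sup>2 / (2 * (nrm a + e i / 2)\<^sup>2) = p * ln (ln (l ^ k))"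
        using elim by (simp add: x_def p_def power_mult_distrib power_divide)
      then have "- x\<^sup>2 / (2 * (nrm a + e i / 2)\<^sup>2) = - p * ln (ln (l ^ k))"
        by simp
      finally show ?case by simp
    qed
    have "summable (\<lambda>k. measure M (A k))"
      by (rule summable_comparison_test_ev[OF bound]) (intro summable_mult summable_log_power l p)
    then have "AE \<omega> in M. \<forall>\<^sub>F k in sequentially. \<omega> \<in> space M - A k"
      by (intro borel_cantelli_AE1) (auto simp: M.emeasure_eq_measure)
    then show ?thesis
      by eventually_elim (auto simp: A_def not_less elim!: eventually_mono)
  qed
  then have "AE \<omega> in M. \<forall>i. \<forall>\<^sub>F k in sequentially. \<bar>coeff_lin a (\<lambda>s. X (l ^ k * s) \<omega>)\<bar> \<le> (nrm a + e i) * norming (l ^ k)"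
    by (simp add: AE_all_countable)
  then show ?thesis
  proof eventually_elim
    case (elim \<omega>)
    show ?case
    proof (intro allI impI)
      fix d :: real assume "d > 0"
      then obtain i where i: "e i < d"
        using reals_Archimedean[of d] by (auto simp: e_def inverse_eq_divide)
      have "\<forall>\<^sub>F k in sequentially. 1 \<le> ln (l ^ k)"
        using l by real_asymp
      then show "\<forall>\<^sub>F k in sequentially. \<bar>coeff_lin a (\<lambda>s. X (l ^ k * s) \<omega>)\<bar> \<le> (nrm a + d) * norming (l ^ k)"
        using elim[rule_format, of i]
      proof eventually_elim
        case (elim k)
        have "0 \<le> norming (l ^ k)"
          using elim(1) l by (simp add: norming_def)
        then have "(nrm a + e i) * norming (l ^ k) \<le> (nrm a + d) * norming (l ^ k)"
          using i by (intro mult_right_mono) auto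
        with elim(2) show ?case by simp
      qed
    qed
  qed
qed

section \<open>The modulus of continuity along powers of two\<close>

lemma rational_approx:
  assumes "t \<in> {0..T}" "0 < d"
  obtains q where "q \<in> \<rat> \<inter> {0..T}" "\<bar>q - t\<bar> < d"
proof -
  have "max 0 (t - d) < min T (t + d)"
    using assms T by auto
  then obtain q where "q \<in> \<rat>" "max 0 (t - d) < q" "q < min T (t + d)"
    using Rats_dense_in_real by blast
  then show ?thesis by (intro that[of q]) auto
qed

text \<open>Rational times make the modulus event a countable intersection, hence measurable and a
  limit of finite ones; continuity of the paths recovers all real times.\<close>

definition rat_pairs :: "real \<Rightarrow> (real \<times> real) set" where
  "rat_pairs d = {(s, t). s \<in> \<rat> \<inter> {0..T} \<and> t \<in> \<rat> \<inter> {0..T} \<and> \<bar>s - t\<bar> \<le> d}"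

lemma countable_rat_pairs: "countable (rat_pairs d)"
proof (rule countable_subset)
  show "rat_pairs d \<subseteq> \<rat> \<times> \<rat>" by (auto simp: rat_pairs_def)
qed (simp add: countable_rat)

lemma rat_pairs_nonneg:
  assumes "i \<in> J" "J \<subseteq> rat_pairs d" "r > 0"
  shows "0 \<le> r * fst i" "0 \<le> r * snd i"
proof -
  have "i \<in> rat_pairs d" using assms by blast
  then have "0 \<le> fst i" "0 \<le> snd i" by (auto simp: rat_pairs_def)
  then show "0 \<le> r * fst i" "0 \<le> r * snd i" using assms(3) by simp_all
qed

definition modulus_event :: "(real \<times> real) set \<Rightarrow> real \<Rightarrow> real \<Rightarrow> 'a set" where
  "modulus_event J r u = {\<omega> \<in> space M. \<forall>i\<in>J. \<bar>X (r * fst i) \<omega> - X (r * snd i) \<omega>\<bar> \<le> u}"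

lemma modulus_event_measurable:
  assumes "J \<subseteq> rat_pairs d" "r > 0"
  shows "modulus_event J r u \<in> sets M"
  unfolding modulus_event_def
proof (rule sets.sets_Collect_countable_All')
  show "countable J"
    using countable_subset[OF assms(1) countable_rat_pairs] .
  fix i assume "i \<in> J"
  then have "0 \<le> r * fst i" "0 \<le> r * snd i"
    using assms by (auto intro: rat_pairs_nonneg)
  note [measurable] = this[THEN X_measurable]
  show "{\<omega> \<in> space M. \<bar>X (r * fst i) \<omega> - X (r * snd i) \<omega>\<bar> \<le> u} \<in> sets M"
    by measurable
qed

text \<open>Every path is uniformly continuous on the compact interval, so the modulus events
  exhaust the space as \<open>d\<close> decreases. The value 3/4 is the starting probability
  required by \<open>fernique\<close>.\<close>

lemma initial_modulus:
  assumes "0 < \<sigma>"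
  obtains d where "0 < d" "3 / 4 \<le> measure M (modulus_event (rat_pairs d) 1 \<sigma>)"
proof -
  define A where "A m = modulus_event (rat_pairs (1 / real (Suc m))) 1 \<sigma>" for m
  have A: "A m \<in> sets M" for m
    unfolding A_def by (rule modulus_event_measurable[OF order_refl]) simp
  have "incseq A"
  proof (rule incseq_SucI)
    fix m
    have "rat_pairs (1 / real (Suc (Suc m))) \<subseteq> rat_pairs (1 / real (Suc m))"
    proof -
      have "1 / real (Suc (Suc m)) \<le> 1 / real (Suc m)" by (simp add: field_simps)
      then show ?thesis by (auto simp: rat_pairs_def)
    qed
    then show "A m \<le> A (Suc m)"
      unfolding A_def modulus_event_def by blast
  qed
  then have lim: "(\<lambda>m. measure M (A m)) \<longlonglongrightarrow> measure M (\<Union>m. A m)"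
    using A by (intro M.finite_Lim_measure_incseq) auto
  have "(\<Union>m. A m) = space M"
  proof (intro equalityI subsetI)
    fix \<omega> assume \<omega>: "\<omega> \<in> space M"
    have "continuous_on {0..T} (\<lambda>t. X t \<omega>)"
      using X_continuous[OF \<omega>] by (rule continuous_on_subset) auto
    then have "uniformly_continuous_on {0..T} (\<lambda>t. X t \<omega>)"
      by (rule compact_uniformly_continuous) simp
    then obtain d where d: "d > 0" "\<And>s t. s \<in> {0..T} \<Longrightarrow> t \<in> {0..T} \<Longrightarrow> \<bar>s - t\<bar> < d \<Longrightarrow> \<bar>X s \<omega> - X t \<omega>\<bar> < \<sigma>"
      using assms unfolding uniformly_continuous_on_def dist_real_def by metis
    obtain m where "1 / real (Suc m) < d"
      using reals_Archimedean[OF d(1)] by (auto simp: inverse_eq_divide)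
    then have "\<omega> \<in> A m"
      using d(2) \<omega> by (force simp: A_def modulus_event_def rat_pairs_def intro: less_imp_le)
    then show "\<omega> \<in> (\<Union>m. A m)" by blast
  qed (auto simp: A_def modulus_event_def)
  with lim have "(\<lambda>m. measure M (A m)) \<longlonglongrightarrow> 1"
    by (simp add: M.prob_space)
  then have "\<forall>\<^sub>F m in sequentially. 3 / 4 < measure M (A m)"
    by (rule order_tendstoD) simp
  then obtain m where "3 / 4 < measure M (A m)"
    by (metis (mono_tags, lifting) eventually_sequentially order_refl)
  then show ?thesis
    unfolding A_def by (intro that[of "1 / real (Suc m)"]) auto
qed

lemma modulus_event_transfer:
  assumes "finite J" "J \<subseteq> rat_pairs d" "r > 0"
  shows "measure M (modulus_event J r (u * r powr H)) =
    prob {\<omega> \<in> space N. \<forall>i\<in>J. \<bar>(Y (r * fst i) \<omega> - Y (r * snd i) \<omega>) / r powr H\<bar> \<le> u}"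
proof -
  have "measure M {\<omega> \<in> space M. \<forall>i\<in>J. (\<Sum>k\<in>UNIV. (if k then 1 else - 1) * X (if k then r * fst i else r * snd i) \<omega>)
        \<in> {y. \<bar>y\<bar> \<le> u * r powr H}} =
    prob {\<omega> \<in> space N. \<forall>i\<in>J. (\<Sum>k\<in>UNIV. (if k then 1 else - 1) * Y (if k then r * fst i else r * snd i) \<omega>)
        \<in> {y. \<bar>y\<bar> \<le> u * r powr H}}"
  proof (rule fdd_transfer)
    fix i :: "real \<times> real" and k :: bool
    assume "i \<in> J"
    then show "0 \<le> (if k then r * fst i else r * snd i)"
      using assms by (auto intro: rat_pairs_nonneg)
  qed (use assms in auto)
  moreover have "0 < r powr H" using assms by simp
  ultimately show ?thesis
    by (simp add: UNIV_bool modulus_event_def abs_divide pos_divide_le_eq)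
qed

text \<open>The starting probability is known at scale 1. Dilation preserves the L2 norms of all
  combinations of increments, hence the joint law, and moves it to scale \<open>r\<close>, where
  Fernique's inequality is applied.\<close>

lemma modulus_tail_finite:
  assumes J: "finite J" "J \<subseteq> rat_pairs d" and r: "r > 0" and \<sigma>: "0 < \<sigma>"
    and start: "3 / 4 \<le> measure M (modulus_event (rat_pairs d) 1 \<sigma>)" and u: "4 * \<sigma> \<le> u"
  shows "1 - measure M (modulus_event J r (u * r powr H)) \<le> exp (- u\<^sup>2 / (32 * \<sigma>\<^sup>2))"
proof -
  define Z where "Z r i \<omega> = (Y (r * fst i) \<omega> - Y (r * snd i) \<omega>) / r powr H" for r \<omega> and i :: "real \<times> real"
  define G where "G r i u = (f (r * fst i) u - f (r * snd i) u) / r powr H" for r u and i :: "real \<times> real"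
  have W: "wiener (G r i) (Z r i)" if "r > 0" "i \<in> J" for r i
  proof -
    have "0 \<le> r * fst i" "0 \<le> r * snd i"
      using that J by (auto intro: rat_pairs_nonneg)
    then have "wiener (\<lambda>u. 1 / r powr H * (f (r * fst i) u - f (r * snd i) u)) (\<lambda>\<omega>. 1 / r powr H * (Y (r * fst i) \<omega> - Y (r * snd i) \<omega>))"
      by (intro wiener_scale wiener_diff wiener_Y)
    then show ?thesis
      by (simp add: G_def[abs_def] Z_def[abs_def])
  qed
  have sets: "{\<omega> \<in> space N. \<forall>i\<in>J. \<bar>Z r i \<omega>\<bar> \<le> v} \<in> sets N" for v
    using J wiener_measurable[OF W[OF r]] by (intro sets.sets_Collect_finite_All borel_measurable_le) auto
  have "3 / 4 \<le> measure M (modulus_event J 1 (\<sigma> * 1 powr H))"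
  proof (rule order_trans[OF start], rule M.finite_measure_mono)
    show "modulus_event (rat_pairs d) 1 \<sigma> \<subseteq> modulus_event J 1 (\<sigma> * 1 powr H)"
      using J by (auto simp: modulus_event_def)
    show "modulus_event J 1 (\<sigma> * 1 powr H) \<in> sets M"
      by (rule modulus_event_measurable[OF J(2)]) simp
  qed
  also have "\<dots> = prob {\<omega> \<in> space N. \<forall>i\<in>J. \<bar>Z 1 i \<omega>\<bar> \<le> \<sigma>}"
    unfolding Z_def by (rule modulus_event_transfer[OF J]) simp
  also have "\<dots> = prob {\<omega> \<in> space N. \<forall>i\<in>J. Z 1 i \<omega> \<in> {- \<sigma>..\<sigma>}}"
    by (intro arg_cong[where f=prob] Collect_cong) (auto simp: abs_le_iff)
  also have "\<dots> = prob {\<omega> \<in> space N. \<forall>i\<in>J. Z r i \<omega> \<in> {- \<sigma>..\<sigma>}}"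
  proof (rule wiener_prob_eq[OF J(1)])
    fix c :: "real \<times> real \<Rightarrow> real"
    show "(LINT u|lborel. (\<Sum>i\<in>J. c i * G 1 i u)\<^sup>2) = (LINT u|lborel. (\<Sum>i\<in>J. c i * G r i u)\<^sup>2)"
    proof (rule L2_norm_dilation[OF r, symmetric])
      fix u
      have "G r i (r * u) = r powr (- 1 / 2) * G 1 i u" for i
        using f_self_similar[OF r, of "fst i" u] f_self_similar[OF r, of "snd i" u]
        by (simp add: G_def diff_divide_distrib right_diff_distrib)
      then show "(\<Sum>i\<in>J. c i * G r i (r * u)) = r powr (- 1 / 2) * (\<Sum>i\<in>J. c i * G 1 i u)"
        by (simp add: sum_distrib_left mult.left_commute)
    qed
  qed (use W r in auto)
  also have "\<dots> = prob {\<omega> \<in> space N. \<forall>i\<in>J. \<bar>Z r i \<omega>\<bar> \<le> \<sigma>}"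
    by (intro arg_cong[where f=prob] Collect_cong) (auto simp: abs_le_iff)
  finally have start': "3 / 4 \<le> prob {\<omega> \<in> space N. \<forall>i\<in>J. \<bar>Z r i \<omega>\<bar> \<le> \<sigma>}" .
  have "measure M (modulus_event J r (u * r powr H)) = prob {\<omega> \<in> space N. \<forall>i\<in>J. \<bar>Z r i \<omega>\<bar> \<le> u}"
    unfolding Z_def by (rule modulus_event_transfer[OF J r])
  moreover have "prob {\<omega> \<in> space N. \<not> (\<forall>i\<in>J. \<bar>Z r i \<omega>\<bar> \<le> u)} = 1 - prob {\<omega> \<in> space N. \<forall>i\<in>J. \<bar>Z r i \<omega>\<bar> \<le> u}"
  proof -
    have "{\<omega> \<in> space N. \<not> (\<forall>i\<in>J. \<bar>Z r i \<omega>\<bar> \<le> u)} = space N - {\<omega> \<in> space N. \<forall>i\<in>J. \<bar>Z r i \<omega>\<bar> \<le> u}"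
      by auto
    then show ?thesis by (simp only:) (rule prob_compl[OF sets])
  qed
  moreover have "prob {\<omega> \<in> space N. \<not> (\<forall>i\<in>J. \<bar>Z r i \<omega>\<bar> \<le> u)} \<le> exp (- u\<^sup>2 / (32 * \<sigma>\<^sup>2))"
    by (rule fernique[OF J(1) _ \<sigma> start' u]) (rule W[OF r])
  ultimately show ?thesis by simp
qed

text \<open>The bound for finite families does not depend on the family, so it passes to the
  decreasing limit along an enumeration.\<close>

lemma modulus_tail:
  assumes r: "r > 0" and \<sigma>: "0 < \<sigma>"
    and start: "3 / 4 \<le> measure M (modulus_event (rat_pairs d) 1 \<sigma>)" and u: "4 * \<sigma> \<le> u" and "d > 0"
  shows "1 - measure M (modulus_event (rat_pairs d) r (u * r powr H)) \<le> exp (- u\<^sup>2 / (32 * \<sigma>\<^sup>2))"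
proof -
  let ?v = "u * r powr H"
  define e where "e = from_nat_into (rat_pairs d)"
  have "(0, 0) \<in> rat_pairs d"
    using T \<open>d > 0\<close> by (auto simp: rat_pairs_def)
  then have e: "range e = rat_pairs d"
    unfolding e_def using countable_rat_pairs by (intro range_from_nat_into) auto
  define E where "E n = modulus_event (e ` {..n}) r ?v" for n
  have sub: "e ` {..n} \<subseteq> rat_pairs d" for n
    using e by auto
  have "(\<lambda>n. measure M (E n)) \<longlonglongrightarrow> measure M (\<Inter>n. E n)"
  proof (rule M.finite_Lim_measure_decseq)
    show "range E \<subseteq> sets M"
      unfolding E_def using modulus_event_measurable[OF sub r] by auto
    show "decseq E"
      by (rule decseq_SucI) (auto simp: E_def modulus_event_def)
  qed
  also have "(\<Inter>n. E n) = modulus_event (rat_pairs d) r ?v"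
    unfolding e[symmetric] E_def modulus_event_def by auto
  finally have "(\<lambda>n. 1 - measure M (E n)) \<longlonglongrightarrow> 1 - measure M (modulus_event (rat_pairs d) r ?v)"
    by (intro tendsto_intros)
  then show ?thesis
  proof (rule LIMSEQ_le_const2, intro exI allI impI)
    show "1 - measure M (E n) \<le> exp (- u\<^sup>2 / (32 * \<sigma>\<^sup>2))" for n
      unfolding E_def by (rule modulus_tail_finite[OF _ sub r \<sigma> start u]) simp
  qed
qed

lemma lil_modulus:
  "AE \<omega> in M. \<forall>e>0. \<exists>d>0. \<forall>\<^sub>F k in sequentially. \<forall>s\<in>{0..T}. \<forall>t\<in>{0..T}. \<bar>s - t\<bar> \<le> d \<longrightarrow>
     \<bar>X (2 ^ k * s) \<omega> - X (2 ^ k * t) \<omega>\<bar> \<le> e * norming (2 ^ k)"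
proof -
  have fixed: "\<exists>d>0. AE \<omega> in M. \<forall>\<^sub>F k in sequentially. \<forall>s\<in>{0..T}. \<forall>t\<in>{0..T}. \<bar>s - t\<bar> \<le> d \<longrightarrow>
     \<bar>X (2 ^ k * s) \<omega> - X (2 ^ k * t) \<omega>\<bar> \<le> e * norming (2 ^ k)" if "e > 0" for e
  proof -
    \<comment> \<open>With \<open>u = e * sqrt (2 * ln (ln (2 ^ k)))\<close> the choice
      \<open>e / 8\<close> turns the exponent \<open>u\<^sup>2 / (32 * \<sigma>\<^sup>2)\<close>
      into \<open>4 * ln (ln (2 ^ k))\<close>, which is summable. Also
      \<open>4 * \<sigma> = e / 2\<close> is at most \<open>u\<close> for large
      \<open>k\<close>.\<close>
    define \<sigma> where "\<sigma> = e / 8"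
    have \<sigma>: "\<sigma> > 0" using that by (simp add: \<sigma>_def)
    obtain d where d: "0 < d" and start: "3 / 4 \<le> measure M (modulus_event (rat_pairs d) 1 \<sigma>)"
      by (rule initial_modulus[OF \<sigma>])
    define E where "E k = modulus_event (rat_pairs d) (2 ^ k) (e * norming (2 ^ k))" for k
    have E: "E k \<in> sets M" for k
      unfolding E_def by (rule modulus_event_measurable[OF order_refl]) simp
    have "\<forall>\<^sub>F k in sequentially. 1 \<le> sqrt (2 * ln (ln ((2::real) ^ k)))"
      by real_asymp
    moreover have "\<forall>\<^sub>F k in sequentially. 0 \<le> ln (ln (2 ^ k :: real))"
      by real_asymp
    ultimately have bound: "\<forall>\<^sub>F k in sequentially. norm (measure M (space M - E k)) \<le> exp (- 4 * ln (ln ((2::real) ^ k)))"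
    proof eventually_elim
      case (elim k)
      define u where "u = e * sqrt (2 * ln (ln (2 ^ k)))"
      have "e * 1 \<le> u"
        unfolding u_def using elim that by (intro mult_left_mono) auto
      then have u: "4 * \<sigma> \<le> u" using that by (simp add: \<sigma>_def)
      have Ek: "E k = modulus_event (rat_pairs d) (2 ^ k) (u * (2 ^ k) powr H)"
        by (simp add: E_def u_def norming_def mult_ac)
      have "measure M (space M - E k) = 1 - measure M (modulus_event (rat_pairs d) (2 ^ k) (u * (2 ^ k) powr H))"
        unfolding Ek[symmetric] by (rule M.prob_compl[OF E])
      also have "\<dots> \<le> exp (- u\<^sup>2 / (32 * \<sigma>\<^sup>2))"
        by (rule modulus_tail[OF _ \<sigma> start u d]) simp
      also have "u\<^sup>2 / (32 * \<sigma>\<^sup>2) = 4 * ln (ln (2 ^ k))"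
        using elim that by (simp add: u_def \<sigma>_def power_mult_distrib power_divide)
      then have "- u\<^sup>2 / (32 * \<sigma>\<^sup>2) = - 4 * ln (ln (2 ^ k))" by simp
      finally show ?case by simp
    qed
    have "summable (\<lambda>k. measure M (space M - E k))"
      by (rule summable_comparison_test_ev[OF bound]) (rule summable_log_power; simp)
    then have "AE \<omega> in M. \<forall>\<^sub>F k in sequentially. \<omega> \<in> space M - (space M - E k)"
      using E by (intro borel_cantelli_AE1) (auto simp: M.emeasure_eq_measure)
    then have "AE \<omega> in M. \<forall>\<^sub>F k in sequentially. \<forall>s\<in>{0..T}. \<forall>t\<in>{0..T}. \<bar>s - t\<bar> \<le> d / 2 \<longrightarrow>
        \<bar>X (2 ^ k * s) \<omega> - X (2 ^ k * t) \<omega>\<bar> \<le> e * norming (2 ^ k)"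
    proof (eventually_elim, elim eventually_mono, intro ballI impI)
      fix \<omega> k s t
      assume \<omega>: "\<omega> \<in> space M - (space M - E k)" and st: "s \<in> {0..T}" "t \<in> {0..T}" "\<bar>s - t\<bar> \<le> d / 2"
      have mod: "\<bar>X (2 ^ k * s) \<omega> - X (2 ^ k * t) \<omega>\<bar> \<le> e * norming (2 ^ k)" if "(s, t) \<in> rat_pairs d" for s t
        using \<omega> that unfolding E_def modulus_event_def by fastforce
      \<comment> \<open>Rationals within \<open>d / 4\<close> of two reals at distance at most
        \<open>d / 2\<close> form a pair in \<open>rat_pairs d\<close>; this is why the real times
        get only half of \<open>d\<close>.\<close>
      define q where "q t n = (SOME q. q \<in> \<rat> \<inter> {0..T} \<and> \<bar>q - t\<bar> < (d / 4) / real (Suc n))" for t n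
      have q: "q t n \<in> \<rat> \<inter> {0..T}" "\<bar>q t n - t\<bar> < (d / 4) / real (Suc n)" if "t \<in> {0..T}" for t n
      proof -
        have "\<exists>q. q \<in> \<rat> \<inter> {0..T} \<and> \<bar>q - t\<bar> < (d / 4) / real (Suc n)"
          using rational_approx[OF that, of "(d / 4) / real (Suc n)"] d by auto
        from someI_ex[OF this] show "q t n \<in> \<rat> \<inter> {0..T}" "\<bar>q t n - t\<bar> < (d / 4) / real (Suc n)"
          by (auto simp: q_def)
      qed
      have qX: "(\<lambda>n. X (2 ^ k * q t n) \<omega>) \<longlonglongrightarrow> X (2 ^ k * t) \<omega>" if t: "t \<in> {0..T}" for t
      proof (rule continuous_on_tendsto_compose[OF X_continuous])
        have "(\<lambda>n. (d / 4) / real (Suc n)) \<longlonglongrightarrow> 0" by real_asymp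
        then have "(\<lambda>n. q t n - t) \<longlonglongrightarrow> 0"
          by (rule Lim_null_comparison[rotated]) (use q(2)[OF t] in \<open>auto intro!: always_eventually less_imp_le\<close>)
        then have "(\<lambda>n. q t n) \<longlonglongrightarrow> t" by (simp add: LIM_zero_iff)
        then show "(\<lambda>n. 2 ^ k * q t n) \<longlonglongrightarrow> 2 ^ k * t" by (intro tendsto_intros)
        show "\<forall>\<^sub>F n in sequentially. 2 ^ k * q t n \<in> {0..}"
          using q(1)[OF t] by (auto intro!: always_eventually)
      qed (use \<omega> t in auto)
      have "(\<lambda>n. \<bar>X (2 ^ k * q s n) \<omega> - X (2 ^ k * q t n) \<omega>\<bar>) \<longlonglongrightarrow> \<bar>X (2 ^ k * s) \<omega> - X (2 ^ k * t) \<omega>\<bar>"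
        by (intro tendsto_intros qX st)
      moreover have "\<bar>X (2 ^ k * q s n) \<omega> - X (2 ^ k * q t n) \<omega>\<bar> \<le> e * norming (2 ^ k)" for n
      proof (rule mod)
        have "(d / 4) / real (Suc n) \<le> d / 4"
          using d by (simp add: divide_le_eq)
        then have "\<bar>q s n - q t n\<bar> \<le> d"
          using q(2)[OF st(1), of n] q(2)[OF st(2), of n] st(3) by linarith
        then show "(q s n, q t n) \<in> rat_pairs d"
          using q(1)[OF st(1)] q(1)[OF st(2)] by (simp add: rat_pairs_def)
      qed
      ultimately show "\<bar>X (2 ^ k * s) \<omega> - X (2 ^ k * t) \<omega>\<bar> \<le> e * norming (2 ^ k)"
        by (intro LIMSEQ_le_const2) auto
    qed
    then show ?thesis
      using d by (intro exI[of _ "d / 2"]) simp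
  qed
  \<comment> \<open>The moduli are chosen before the path, so that countably many null sets can be
    united.\<close>
  have "\<exists>d. \<forall>i. d i > 0 \<and> (AE \<omega> in M. \<forall>\<^sub>F k in sequentially. \<forall>s\<in>{0..T}. \<forall>t\<in>{0..T}. \<bar>s - t\<bar> \<le> d i \<longrightarrow>
     \<bar>X (2 ^ k * s) \<omega> - X (2 ^ k * t) \<omega>\<bar> \<le> (1 / real (Suc i)) * norming (2 ^ k))"
    by (intro choice allI fixed) simp
  then obtain d where d: "\<And>i. d i > 0" and ae: "\<And>i. AE \<omega> in M. \<forall>\<^sub>F k in sequentially. \<forall>s\<in>{0..T}. \<forall>t\<in>{0..T}.
      \<bar>s - t\<bar> \<le> d i \<longrightarrow> \<bar>X (2 ^ k * s) \<omega> - X (2 ^ k * t) \<omega>\<bar> \<le> (1 / real (Suc i)) * norming (2 ^ k)"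
    by blast
  from ae have "AE \<omega> in M. \<forall>i. \<forall>\<^sub>F k in sequentially. \<forall>s\<in>{0..T}. \<forall>t\<in>{0..T}. \<bar>s - t\<bar> \<le> d i \<longrightarrow>
      \<bar>X (2 ^ k * s) \<omega> - X (2 ^ k * t) \<omega>\<bar> \<le> (1 / real (Suc i)) * norming (2 ^ k)"
    by (subst AE_all_countable) (intro allI)
  then show ?thesis
  proof eventually_elim
    case (elim \<omega>)
    show ?case
    proof (intro allI impI)
      fix e :: real assume "e > 0"
      then obtain i where i: "1 / real (Suc i) < e"
        using reals_Archimedean[of e] by (auto simp: inverse_eq_divide)
      have nn: "\<forall>\<^sub>F k in sequentially. 0 \<le> ln (ln (2 ^ k :: real))"
        by real_asymp
      have "\<forall>\<^sub>F k in sequentially. \<forall>s\<in>{0..T}. \<forall>t\<in>{0..T}. \<bar>s - t\<bar> \<le> d i \<longrightarrow>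
          \<bar>X (2 ^ k * s) \<omega> - X (2 ^ k * t) \<omega>\<bar> \<le> e * norming (2 ^ k)"
        using nn elim[rule_format, of i]
      proof eventually_elim
        case (elim k)
        have "(1 / real (Suc i)) * norming (2 ^ k) \<le> e * norming (2 ^ k)"
          using i elim(1) by (intro mult_right_mono) (auto simp: norming_def)
        with elim(2) show ?case by (meson order_trans)
      qed
      with d[of i] show "\<exists>d>0. \<forall>\<^sub>F k in sequentially. \<forall>s\<in>{0..T}. \<forall>t\<in>{0..T}. \<bar>s - t\<bar> \<le> d \<longrightarrow>
          \<bar>X (2 ^ k * s) \<omega> - X (2 ^ k * t) \<omega>\<bar> \<le> e * norming (2 ^ k)"
        by blast
    qed
  qed
qed

end

section \<open>The lower half of the law of the iterated logarithm\<close>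

lemma L2_triangle:
  fixes f g :: "'a \<Rightarrow> real"
  assumes "f \<in> borel_measurable M" "g \<in> borel_measurable M"
    and "integrable M (\<lambda>x. (f x)\<^sup>2)" "integrable M (\<lambda>x. (g x)\<^sup>2)"
  shows "sqrt (LINT x|M. (f x + g x)\<^sup>2) \<le> sqrt (LINT x|M. (f x)\<^sup>2) + sqrt (LINT x|M. (g x)\<^sup>2)"
proof (rule real_le_lsqrt)
  let ?a = "sqrt (LINT x|M. (f x)\<^sup>2)" and ?b = "sqrt (LINT x|M. (g x)\<^sup>2)"
  have "(LINT x|M. (f x + g x)\<^sup>2) = ?a\<^sup>2 + 2 * (LINT x|M. f x * g x) + ?b\<^sup>2"
    using square_integrable_lincomb(2)[OF assms, of 1] by simp
  also have "\<dots> \<le> (?a + ?b)\<^sup>2"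
    using Cauchy_Schwarz_LINT[OF assms] by (simp add: power2_sum)
  finally show "(LINT x|M. (f x + g x)\<^sup>2) \<le> (?a + ?b)\<^sup>2" .
qed auto

text \<open>The annuli exhaust the line up to the null set containing 0, and dominated convergence
  applies. The quotient \<open>n\<close> of outer and inner radius makes the dilates by powers of
  \<open>n\<close> disjoint.\<close>

lemma L2_mass_outside_annulus:
  fixes F :: "real \<Rightarrow> real"
  assumes [measurable]: "F \<in> borel_measurable borel" and F2: "integrable lborel (\<lambda>u. (F u)\<^sup>2)"
  shows "(\<lambda>n. LINT u|lborel. indicator (- {u. 1 / sqrt (real n) \<le> \<bar>u\<bar> \<and> \<bar>u\<bar> < sqrt (real n)}) u * (F u)\<^sup>2) \<longlonglongrightarrow> 0"
proof -
  let ?A = "\<lambda>n. {u. 1 / sqrt (real n) \<le> \<bar>u\<bar> \<and> \<bar>u\<bar> < sqrt (real n)} :: real set"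
  have "(\<lambda>n. LINT u|lborel. indicator (- ?A n) u * (F u)\<^sup>2) \<longlonglongrightarrow> (LINT u::real|lborel. (0::real))"
  proof (rule integral_dominated_convergence[where w="\<lambda>u. (F u)\<^sup>2" and f="\<lambda>_. 0"
        and s="\<lambda>n u. indicator (- ?A n) u * (F u)\<^sup>2"])
    show "AE u in lborel. (\<lambda>n. indicator (- ?A n) u * (F u)\<^sup>2) \<longlonglongrightarrow> 0"
      using AE_lborel_singleton[of "0::real"]
    proof eventually_elim
      case (elim u)
      have "filterlim (\<lambda>n. sqrt (real n)) at_top sequentially" by real_asymp
      then have ev: "\<forall>\<^sub>F n in sequentially. c < sqrt (real n)" for c
        by (auto simp: filterlim_at_top_dense)
      have "\<forall>\<^sub>F n in sequentially. indicator (- ?A n) u * (F u)\<^sup>2 = 0"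
        using ev[of "\<bar>u\<bar>"] ev[of "1 / \<bar>u\<bar>"] ev[of 0]
      proof eventually_elim
        case (elim n)
        then have "1 / sqrt (real n) < \<bar>u\<bar>"
          using \<open>u \<noteq> 0\<close> by (simp add: field_simps)
        with elim show ?case by simp
      qed
      then show ?case by (rule tendsto_eventually)
    qed
  qed (use F2 in \<open>auto split: split_indicator\<close>)
  then show ?thesis by simp
qed

context gfbm_process
begin

text \<open>
  On the annuli \<open>{q\<^sup>k/\<surd>q \<le> |u| < q\<^sup>k\<surd>q}\<close>, which are disjoint, the kernels at the times \<open>q\<^sup>k s\<close> carry
  all but a small part of their mass if \<open>q\<close> is large.  This splits the variables into independent
  main terms \<open>V k\<close> and remainders of small variance.
\<close>

lemma almost_independent_decomposition:
  assumes a: "a \<in> coeffs_on {0..T}" and w: "0 < w"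
  obtains q :: nat and G V where "3 \<le> q" "\<And>k. wiener (G k) (V k)"
    "\<And>i j u. i \<noteq> j \<Longrightarrow> G i u * G j u = 0"
    "\<And>k. (LINT u|lborel. (coeff_lin a (\<lambda>s. f (real q ^ k * s) u) / (real q ^ k) powr H - G k u)\<^sup>2) \<le> w"
proof -
  define F where "F r u = coeff_lin a (\<lambda>s. f (r * s) u) / r powr H" for r u
  define Z where "Z r \<omega> = coeff_lin a (\<lambda>s. Y (r * s) \<omega>) / r powr H" for r \<omega>
  have W: "wiener (F r) (Z r)" if "r > 0" for r
    using wiener_coeff[OF a that] by (simp add: F_def[abs_def] Z_def[abs_def])
  have "(\<lambda>n. LINT u|lborel. indicator (- {u. 1 / sqrt (real n) \<le> \<bar>u\<bar> \<and> \<bar>u\<bar> < sqrt (real n)}) u * (F 1 u)\<^sup>2) \<longlonglongrightarrow> 0"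
    using W[of 1] by (intro L2_mass_outside_annulus wiener_measurable wiener_square_integrable) auto
  \<comment> \<open>Half of \<open>w\<close> is for the mass outside the annulus, the other half for
    the approximation error in \<open>wiener_localize\<close>.\<close>
  then have "\<forall>\<^sub>F n in sequentially. (LINT u|lborel. indicator (- {u. 1 / sqrt (real n) \<le> \<bar>u\<bar> \<and> \<bar>u\<bar> < sqrt (real n)}) u * (F 1 u)\<^sup>2) < w / 2"
    using w by (intro order_tendstoD) auto
  with eventually_ge_at_top[of 3] have "\<forall>\<^sub>F n in sequentially. 3 \<le> n \<and> (LINT u|lborel. indicator (- {u. 1 / sqrt (real n) \<le> \<bar>u\<bar> \<and> \<bar>u\<bar> < sqrt (real n)}) u * (F 1 u)\<^sup>2) < w / 2"
    by eventually_elim simp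
  then obtain q :: nat where q: "3 \<le> q"
    and small: "(LINT u|lborel. indicator (- {u. 1 / sqrt (real q) \<le> \<bar>u\<bar> \<and> \<bar>u\<bar> < sqrt (real q)}) u * (F 1 u)\<^sup>2) < w / 2"
    by (auto simp: eventually_sequentially)
  define r where "r k = real q ^ k" for k
  have r: "r k > 0" for k using q by (simp add: r_def)
  \<comment> \<open>The outer radius at \<open>k\<close> is the inner radius at
    \<open>Suc k\<close>; one strict inequality keeps neighbours disjoint.\<close>
  define A where "A k = {u. r k / sqrt (real q) \<le> \<bar>u\<bar> \<and> \<bar>u\<bar> < r k * sqrt (real q)}" for k
  have [measurable]: "A k \<in> sets borel" for k
    unfolding A_def by measurable
  have disj: "A i \<inter> A j = {}" if "i < j" for i j
  proof -
    have "r i * sqrt (real q) * sqrt (real q) = r (Suc i)"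
      using q by (simp add: r_def)
    also have "\<dots> \<le> r j"
      unfolding r_def using q that by (intro power_increasing) auto
    finally have "r i * sqrt (real q) \<le> r j / sqrt (real q)"
      using q by (simp add: field_simps)
    then show ?thesis by (auto simp: A_def)
  qed
  \<comment> \<open>The mass outside the annulus is invariant under dilation, so the
    \<open>q\<close> chosen at scale 1 serves every \<open>k\<close>.\<close>
  have out: "(LINT u|lborel. indicator (- A k) u * (F (r k) u)\<^sup>2) < w / 2" for k
  proof -
    let ?B = "{u. 1 / sqrt (real q) \<le> \<bar>u\<bar> \<and> \<bar>u\<bar> < sqrt (real q)} :: real set"
    have "(LINT u|lborel. (indicator (- A k) u * F (r k) u)\<^sup>2) = (LINT u|lborel. (indicator (- ?B) u * F 1 u)\<^sup>2)"
    proof (rule L2_norm_dilation[OF r])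
      fix u
      have "r k * u \<in> A k \<longleftrightarrow> u \<in> ?B"
        using r[of k] q by (simp add: A_def abs_mult field_simps)
      then have "indicator (- A k) (r k * u) = (indicator (- ?B) u :: real)"
        by (simp add: indicator_def)
      then show "indicator (- A k) (r k * u) * F (r k) (r k * u) = r k powr (- 1 / 2) * (indicator (- ?B) u * F 1 u)"
        using coeff_lin_f_self_similar[OF r[of k], of a u] by (simp add: F_def mult.left_commute)
    qed
    moreover have "(indicator E u * y)\<^sup>2 = indicator E u * y\<^sup>2" for E :: "real set" and u y :: real
      by (simp split: split_indicator)
    ultimately show ?thesis using small by simp
  qed
  have "\<exists>g v. wiener g v \<and> (\<forall>u. u \<notin> A k \<longrightarrow> g u = 0) \<and> (LINT u|lborel. (F (r k) u - g u)\<^sup>2) \<le> w" for k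
  proof -
    obtain g v where "wiener g v" "\<And>u. u \<notin> A k \<Longrightarrow> g u = 0"
      "(LINT u|lborel. (F (r k) u - g u)\<^sup>2) \<le> (LINT u|lborel. indicator (- A k) u * (F (r k) u)\<^sup>2) + w / 2"
      using wiener_localize[OF W[OF r], of "A k" "w / 2" k] w by auto
    with out[of k] show ?thesis by (intro exI[of _ g] exI[of _ v]) auto
  qed
  then obtain G V where GV: "\<And>k. wiener (G k) (V k)" "\<And>k u. u \<notin> A k \<Longrightarrow> G k u = 0"
    "\<And>k. (LINT u|lborel. (F (r k) u - G k u)\<^sup>2) \<le> w"
    by metis
  have orth: "G i u * G j u = 0" if "i \<noteq> j" for i j u
  proof -
    have "A i \<inter> A j = {}"
      using disj[of i j] disj[of j i] that by (cases "i < j") auto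
    then have "u \<notin> A i \<or> u \<notin> A j" by auto
    then show ?thesis using GV(2) by auto
  qed
  have "(LINT u|lborel. (coeff_lin a (\<lambda>s. f (real q ^ k * s) u) / (real q ^ k) powr H - G k u)\<^sup>2) \<le> w" for k
    using GV(3)[of k] by (simp add: F_def r_def)
  from that[OF q GV(1) orth this] show ?thesis .
qed

lemma not_summable_log_inverse:
  assumes "1 < (l::real)"
  shows "\<not> summable (\<lambda>k. exp (- ln (ln (l ^ k))))"
proof
  assume *: "summable (\<lambda>k. exp (- ln (ln (l ^ k))))"
  have "ln l > 0" using assms by simp
  have "summable (\<lambda>k. real k powr - 1)"
  proof (rule summable_comparison_test_ev)
    show "summable (\<lambda>k. ln l * exp (- ln (ln (l ^ k))))"
      using * by (rule summable_mult)
    show "\<forall>\<^sub>F k in sequentially. norm (real k powr - 1) \<le> ln l * exp (- ln (ln (l ^ k)))"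
      using eventually_gt_at_top[of 0]
    proof eventually_elim
      case (elim k)
      then have "ln (l ^ k) > 0" "ln (l ^ k) = real k * ln l"
        using assms \<open>ln l > 0\<close> by (simp_all add: ln_realpow)
      then show ?case
        using elim \<open>ln l > 0\<close> by (simp add: exp_minus powr_minus_divide field_simps)
    qed
  qed
  then show False using summable_real_powr_iff[of "- 1"] by simp
qed

text \<open>The second Borel-Cantelli argument in quantitative form, on finite blocks of scales,
  because laws are transferred between \<open>M\<close> and \<open>N\<close> for finitely many times
  only. If the functional stays below its level on a block, then either all independent main terms
  stay low or some remainder is large. The first has probability at most the exponential of minus a
  divergent sum, the second at most a convergent tail.\<close>

lemma lil_lower_fixed:
  assumes a: "a \<in> coeffs_on {0..T}" and e: "0 < e" "e < nrm a"
  shows "\<exists>q::nat. 3 \<le> q \<and> (AE \<omega> in M. \<forall>j. \<exists>k\<ge>j. (nrm a - e) * norming (real q ^ k) < coeff_lin a (\<lambda>s. X (real q ^ k * s) \<omega>))"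
proof -
  \<comment> \<open>Sharing out \<open>e\<close>: the remainder may use \<open>e / 2\<close> of the
    level, and its standard deviation bound \<open>e / 4\<close> turns this into the summable tail
    exponent \<open>4 * y k\<close>. The same bound keeps the deviation of the main term above
    \<open>nrm a - e / 4\<close>, while the main term has to exceed \<open>nrm a - e / 2\<close>
    only.\<close>
  define w where "w = (e / 4)\<^sup>2"
  have w: "w > 0" using e by (simp add: w_def)
  obtain q :: nat and G V where q: "3 \<le> q" and GV: "\<And>k. wiener (G k) (V k)"
    and orth: "\<And>i j u. i \<noteq> j \<Longrightarrow> G i u * G j u = 0"
    and close: "\<And>k. (LINT u|lborel. (coeff_lin a (\<lambda>s. f (real q ^ k * s) u) / (real q ^ k) powr H - G k u)\<^sup>2) \<le> w"
  proof (rule almost_independent_decomposition[OF a w], goal_cases)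
    case (1 q G V)
    from 1(1)[OF 1(2-)] show ?case .
  qed
  define F where "F k u = coeff_lin a (\<lambda>s. f (real q ^ k * s) u) / (real q ^ k) powr H" for k u
  define Z where "Z k \<omega> = coeff_lin a (\<lambda>s. Y (real q ^ k * s) \<omega>) / (real q ^ k) powr H" for k \<omega>
  have r: "real q ^ k > 0" for k using q by simp
  have W: "wiener (F k) (Z k)" for k
    using wiener_coeff[OF a r[of k]] by (simp add: F_def[abs_def] Z_def[abs_def])
  have R: "wiener (\<lambda>u. F k u - G k u) (\<lambda>\<omega>. Z k \<omega> - V k \<omega>)" for k
    by (rule wiener_diff[OF W GV])
  have R_small: "(LINT u|lborel. (F k u - G k u)\<^sup>2) \<le> w" for k
    using close[of k] by (simp add: F_def)
  define y where "y k = ln (ln (real q ^ k))" for k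
  define \<phi> where "\<phi> k = sqrt (2 * y k)" for k
  \<comment> \<open>Here \<open>3 \<le> q\<close> enters: \<open>q\<close> exceeds
    \<open>exp 1\<close>, so the inner logarithm is at least 1 from \<open>k = 1\<close> on.\<close>
  have y: "y k \<ge> 0" if "k \<ge> 1" for k
  proof -
    have "exp 1 \<le> real q" using exp_le q by linarith
    also have "real q \<le> real q ^ k" using that q by (intro self_le_power) auto
    finally have "1 \<le> ln (real q ^ k)" using r[of k] by (simp add: ln_ge_iff)
    then show ?thesis by (simp add: y_def)
  qed
  have \<phi>: "\<phi> k \<ge> 0" "(\<phi> k)\<^sup>2 = 2 * y k" if "k \<ge> 1" for k
    using y[OF that] by (auto simp: \<phi>_def)
  have norming_eq: "norming (real q ^ k) = (real q ^ k) powr H * \<phi> k" for k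
    by (simp add: norming_def \<phi>_def y_def)
  have G_large: "nrm a - e / 4 \<le> sqrt (LINT u|lborel. (G k u)\<^sup>2)" for k
  proof -
    have "nrm a = sqrt (LINT u|lborel. (F k u)\<^sup>2)"
      unfolding F_def coeff_variance[OF a r] using nrm_nonneg[OF a] by simp
    also have "\<dots> = sqrt (LINT u|lborel. (G k u + (F k u - G k u))\<^sup>2)" by simp
    also have "\<dots> \<le> sqrt (LINT u|lborel. (G k u)\<^sup>2) + sqrt (LINT u|lborel. (F k u - G k u)\<^sup>2)"
      using wiener_measurable[OF GV] wiener_measurable[OF R]
        wiener_square_integrable[OF GV] wiener_square_integrable[OF R] by (intro L2_triangle) auto
    also have "sqrt (LINT u|lborel. (F k u - G k u)\<^sup>2) \<le> e / 4"
      using R_small[of k] e by (intro real_le_lsqrt) (auto simp: w_def)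
    finally show ?thesis by simp
  qed
  define \<rho> where "\<rho> = (nrm a - e / 2) / (nrm a - e / 4)"
  have \<rho>: "0 < \<rho>" "\<rho> < 1"
    using e by (auto simp: \<rho>_def divide_less_eq)
  define p where "p k = exp (- (\<rho> * \<phi> k + 1)\<^sup>2 / 2) / sqrt (2 * pi)" for k
  have V_tail: "prob {\<omega> \<in> space N. V k \<omega> \<in> {..(nrm a - e / 2) * \<phi> k}} \<le> exp (- p k)" if k: "k \<ge> 1" for k
  proof -
    note [measurable] = wiener_measurable[OF GV[of k]]
    let ?x = "(nrm a - e / 2) * \<phi> k"
    have x: "0 \<le> ?x" using e \<phi>(1)[OF k] by simp
    have pos: "0 < nrm a - e / 4" using e by simp
    have "p k \<le> prob {\<omega> \<in> space N. V k \<omega> > ?x}"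
    proof -
      have "(nrm a - e / 4)\<^sup>2 \<le> (sqrt (LINT u|lborel. (G k u)\<^sup>2))\<^sup>2"
        using G_large[of k] pos by (intro power_mono) auto
      then have "exp (- (?x / sqrt ((nrm a - e / 4)\<^sup>2) + 1)\<^sup>2 / 2) / sqrt (2 * pi) \<le> prob {\<omega> \<in> space N. V k \<omega> > ?x}"
        using pos x by (intro wiener_lower_tail[OF GV]) auto
      moreover have "?x / sqrt ((nrm a - e / 4)\<^sup>2) = \<rho> * \<phi> k"
        using pos by (simp add: \<rho>_def)
      ultimately show ?thesis by (simp add: p_def)
    qed
    moreover have "prob {\<omega> \<in> space N. V k \<omega> \<in> {..?x}} = 1 - prob {\<omega> \<in> space N. V k \<omega> > ?x}"
    proof -
      have "{\<omega> \<in> space N. V k \<omega> \<in> {..?x}} = space N - {\<omega> \<in> space N. V k \<omega> > ?x}" by auto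
      then show ?thesis by (simp only:) (rule prob_compl; measurable)
    qed
    \<comment> \<open>The inequality between \<open>1 - p k\<close> and \<open>exp (- p k)\<close>
      will turn the product over independent terms into the exponential of a sum.\<close>
    ultimately show ?thesis
      using exp_ge_add_one_self[of "- p k"] by simp
  qed
  have R_tail: "prob {\<omega> \<in> space N. \<bar>Z k \<omega> - V k \<omega>\<bar> > e / 2 * \<phi> k} \<le> 2 * exp (- 4 * y k)" if k: "k \<ge> 1" for k
  proof -
    have "prob {\<omega> \<in> space N. \<bar>Z k \<omega> - V k \<omega>\<bar> > e / 2 * \<phi> k} \<le> 2 * exp (- (e / 2 * \<phi> k)\<^sup>2 / (2 * w))"
      using R_small w e \<phi>(1)[OF k] by (intro wiener_upper_tail[OF R]) auto
    also have "(e / 2 * \<phi> k)\<^sup>2 / (2 * w) = 4 * y k"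
      unfolding power_mult_distrib \<phi>(2)[OF k] using e by (simp add: w_def power2_eq_square)
    then have "- (e / 2 * \<phi> k)\<^sup>2 / (2 * w) = - 4 * y k" by simp
    finally show ?thesis by simp
  qed
  \<comment> \<open>Since \<open>\<rho> < 1\<close> and \<open>\<phi> k\<close> grows, the additive
    1 from the lower tail is absorbed: \<open>\<rho> * \<phi> k + 1\<close> is eventually at most
    \<open>\<phi> k\<close>. So \<open>p k\<close> dominates a multiple of the harmonic
    series.\<close>
  have not_sum: "\<not> summable p"
  proof
    assume "summable p"
    then have sum: "summable (\<lambda>k. sqrt (2 * pi) * p k)" by (rule summable_mult)
    have "filterlim (\<lambda>k. ln (ln (real q ^ k))) at_top sequentially"
      using q by real_asymp
    then have "\<forall>\<^sub>F k in sequentially. 1 / (2 * (1 - \<rho>)\<^sup>2) \<le> y k"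
      by (auto simp: filterlim_at_top y_def)
    with eventually_ge_at_top[of 1] have "\<forall>\<^sub>F k in sequentially. norm (exp (- ln (ln (real q ^ k)))) \<le> sqrt (2 * pi) * p k"
    proof eventually_elim
      case (elim k)
      have "1 \<le> (1 - \<rho>)\<^sup>2 * (2 * y k)"
        using elim(2) \<rho> by (simp add: field_simps)
      then have "1 \<le> ((1 - \<rho>) * \<phi> k)\<^sup>2"
        using \<phi>(2)[OF elim(1)] by (simp add: power_mult_distrib)
      then have "1 \<le> (1 - \<rho>) * \<phi> k"
        using \<phi>(1)[OF elim(1)] \<rho> by (metis abs_le_square_iff abs_of_nonneg abs_one diff_ge_0_iff_ge less_imp_le mult_nonneg_nonneg one_power2)
      then have "(\<rho> * \<phi> k + 1)\<^sup>2 \<le> (\<phi> k)\<^sup>2"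
        using \<phi>(1)[OF elim(1)] \<rho> by (intro power_mono) (auto simp: algebra_simps)
      then show ?case
        using \<phi>(2)[OF elim(1)] by (simp add: p_def y_def)
    qed
    then have "summable (\<lambda>k. exp (- ln (ln (real q ^ k))))"
      using sum by (rule summable_comparison_test_ev)
    then show False using not_summable_log_inverse[of "real q"] q by simp
  qed
  define t where "t j = (\<Sum>k. 2 * exp (- 4 * y (k + j)))" for j
  have sum_t: "summable (\<lambda>k. 2 * exp (- 4 * y k))"
    unfolding y_def using q by (intro summable_mult summable_log_power) auto
  define E where "E j = {\<omega> \<in> space M. \<forall>k\<in>{j..}. coeff_lin a (\<lambda>s. X (real q ^ k * s) \<omega>) \<le> (nrm a - e) * norming (real q ^ k)}" for j
  have mX[measurable]: "(\<lambda>\<omega>. coeff_lin a (\<lambda>s. X (real q ^ k * s) \<omega>)) \<in> borel_measurable M" for k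
    using r by (intro coeff_lin_X_measurable[OF a])
  have E: "E j \<in> sets M" for j
    unfolding E_def by (intro sets.sets_Collect_countable_All') (auto intro: borel_measurable_le)
  have block: "measure M (E j) \<le> exp (- (\<Sum>k=j..<m. p k)) + t j" if j: "j \<ge> 1" for j m
  proof -
    let ?J = "{j..<m}"
    have "measure M (E j) \<le> measure M {\<omega> \<in> space M. \<forall>k\<in>?J. (\<Sum>s\<in>{s. a s \<noteq> 0}. a s * X (real q ^ k * s) \<omega>) \<in> {..(nrm a - e) * norming (real q ^ k)}}"
    proof (rule M.finite_measure_mono)
      show "{\<omega> \<in> space M. \<forall>k\<in>?J. (\<Sum>s\<in>{s. a s \<noteq> 0}. a s * X (real q ^ k * s) \<omega>) \<in> {..(nrm a - e) * norming (real q ^ k)}} \<in> sets M"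
        using mX unfolding coeff_lin_def by (intro sets.sets_Collect_finite_All sets_Collect_mem) auto
    qed (auto simp: E_def coeff_lin_def)
    also have "\<dots> = prob {\<omega> \<in> space N. \<forall>k\<in>?J. (\<Sum>s\<in>{s. a s \<noteq> 0}. a s * Y (real q ^ k * s) \<omega>) \<in> {..(nrm a - e) * norming (real q ^ k)}}"
      using coeffs_onD[OF a] by (intro fdd_transfer) auto
    also have "\<dots> \<le> prob ({\<omega> \<in> space N. \<forall>k\<in>?J. V k \<omega> \<in> {..(nrm a - e / 2) * \<phi> k}} \<union>
        (\<Union>k\<in>?J. {\<omega> \<in> space N. \<bar>Z k \<omega> - V k \<omega>\<bar> > e / 2 * \<phi> k}))"
    proof (rule finite_measure_mono)
      show "{\<omega> \<in> space N. \<forall>k\<in>?J. (\<Sum>s\<in>{s. a s \<noteq> 0}. a s * Y (real q ^ k * s) \<omega>) \<in> {..(nrm a - e) * norming (real q ^ k)}} \<subseteq>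
        {\<omega> \<in> space N. \<forall>k\<in>?J. V k \<omega> \<in> {..(nrm a - e / 2) * \<phi> k}} \<union> (\<Union>k\<in>?J. {\<omega> \<in> space N. \<bar>Z k \<omega> - V k \<omega>\<bar> > e / 2 * \<phi> k})"
      proof
        fix \<omega> assume *: "\<omega> \<in> {\<omega> \<in> space N. \<forall>k\<in>?J. (\<Sum>s\<in>{s. a s \<noteq> 0}. a s * Y (real q ^ k * s) \<omega>) \<in> {..(nrm a - e) * norming (real q ^ k)}}"
        have "V k \<omega> \<le> (nrm a - e / 2) * \<phi> k" if k: "k \<in> ?J" and small: "\<bar>Z k \<omega> - V k \<omega>\<bar> \<le> e / 2 * \<phi> k" for k
        proof -
          have "coeff_lin a (\<lambda>s. Y (real q ^ k * s) \<omega>) \<le> ((nrm a - e) * \<phi> k) * (real q ^ k) powr H"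
            using * k by (auto simp: coeff_lin_def norming_eq mult_ac)
          moreover have "0 < (real q ^ k) powr H" using r[of k] by simp
          ultimately have "Z k \<omega> \<le> (nrm a - e) * \<phi> k"
            unfolding Z_def by (simp add: pos_divide_le_eq)
          moreover have "V k \<omega> \<le> Z k \<omega> + e / 2 * \<phi> k" using small by linarith
          moreover have "(nrm a - e) * \<phi> k + e / 2 * \<phi> k = (nrm a - e / 2) * \<phi> k"
            by (simp add: algebra_simps)
          ultimately show ?thesis by linarith
        qed
        with * show "\<omega> \<in> {\<omega> \<in> space N. \<forall>k\<in>?J. V k \<omega> \<in> {..(nrm a - e / 2) * \<phi> k}} \<union> (\<Union>k\<in>?J. {\<omega> \<in> space N. \<bar>Z k \<omega> - V k \<omega>\<bar> > e / 2 * \<phi> k})"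
          by (auto simp: not_less)
      qed
      show "{\<omega> \<in> space N. \<forall>k\<in>?J. V k \<omega> \<in> {..(nrm a - e / 2) * \<phi> k}} \<union> (\<Union>k\<in>?J. {\<omega> \<in> space N. \<bar>Z k \<omega> - V k \<omega>\<bar> > e / 2 * \<phi> k}) \<in> sets N"
        using wiener_measurable[OF GV] wiener_measurable[OF R]
        by (intro sets.Un sets.finite_UN sets.sets_Collect_finite_All sets_Collect_mem borel_measurable_less) auto
    qed
    also have "\<dots> \<le> prob {\<omega> \<in> space N. \<forall>k\<in>?J. V k \<omega> \<in> {..(nrm a - e / 2) * \<phi> k}} + prob (\<Union>k\<in>?J. {\<omega> \<in> space N. \<bar>Z k \<omega> - V k \<omega>\<bar> > e / 2 * \<phi> k})"
      using wiener_measurable[OF GV] wiener_measurable[OF R]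
      by (intro measure_Un_le sets.finite_UN sets.sets_Collect_finite_All sets_Collect_mem borel_measurable_less) auto
    also have "prob {\<omega> \<in> space N. \<forall>k\<in>?J. V k \<omega> \<in> {..(nrm a - e / 2) * \<phi> k}} =
        (\<Prod>k\<in>?J. prob {\<omega> \<in> space N. V k \<omega> \<in> {..(nrm a - e / 2) * \<phi> k}})"
      by (rule wiener_orthogonal_prob[where F=G]) (auto simp: GV orth)
    also have "\<dots> \<le> (\<Prod>k\<in>?J. exp (- p k))"
      using j by (intro prod_mono) (auto intro: V_tail simp del: atMost_iff)
    also have "\<dots> = exp (- (\<Sum>k\<in>?J. p k))"
      by (simp add: exp_sum sum_negf[symmetric])
    also have "prob (\<Union>k\<in>?J. {\<omega> \<in> space N. \<bar>Z k \<omega> - V k \<omega>\<bar> > e / 2 * \<phi> k}) \<le>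
        (\<Sum>k\<in>?J. prob {\<omega> \<in> space N. \<bar>Z k \<omega> - V k \<omega>\<bar> > e / 2 * \<phi> k})"
      using wiener_measurable[OF R] by (intro measure_UNION_le borel_measurable_less) auto
    also have "\<dots> \<le> (\<Sum>k\<in>?J. 2 * exp (- 4 * y k))"
      using j by (intro sum_mono R_tail) auto
    also have "\<dots> = (\<Sum>k<m - j. 2 * exp (- 4 * y (k + j)))"
      by (rule sum.reindex_bij_witness[where i="\<lambda>k. k + j" and j="\<lambda>k. k - j"]) auto
    also have "\<dots> \<le> t j"
      unfolding t_def by (intro sum_le_suminf summable_ignore_initial_segment[OF sum_t]) auto
    finally show ?thesis by simp
  qed
  \<comment> \<open>The block is extended to infinity with \<open>j\<close> fixed; by divergence the
    exponential term drops out.\<close>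
  have le_t: "measure M (E j) \<le> t j" if j: "j \<ge> 1" for j
  proof (rule field_le_epsilon)
    fix d :: real assume "d > 0"
    have p0: "0 \<le> p k" for k by (simp add: p_def)
    obtain m where m: "(\<Sum>k<m. p k) > (\<Sum>k<j. p k) + - ln d"
      using summableI_nonneg_bounded[of p] not_sum p0 by (meson not_le)
    have "(\<Sum>k<m. p k) \<le> (\<Sum>k\<in>{..<j} \<union> {j..<m}. p k)"
      using p0 by (intro sum_mono2) auto
    also have "\<dots> = (\<Sum>k<j. p k) + (\<Sum>k=j..<m. p k)"
      by (rule sum.union_disjoint) auto
    finally have "- (\<Sum>k=j..<m. p k) \<le> ln d" using m by linarith
    then have "exp (- (\<Sum>k=j..<m. p k)) \<le> d"
      using \<open>d > 0\<close> by (metis exp_le_cancel_iff exp_ln)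
    then show "measure M (E j) \<le> t j + d"
      using block[OF j, of m] by linarith
  qed
  \<comment> \<open>The events \<open>E j\<close> increase with \<open>j\<close>, so each is bounded
    by the tails \<open>t i\<close> of all later indices.\<close>
  have "measure M (E j) \<le> 0" for j
  proof (rule LIMSEQ_le_const)
    show "t \<longlonglongrightarrow> 0"
      unfolding t_def using suminf_exist_split2[OF sum_t] by simp
    show "\<exists>n. \<forall>i\<ge>n. measure M (E j) \<le> t i"
    proof (intro exI[of _ "Suc j"] allI impI)
      fix i assume "Suc j \<le> i"
      then have "measure M (E j) \<le> measure M (E i)"
        by (intro M.finite_measure_mono E) (auto simp: E_def)
      also have "\<dots> \<le> t i" using \<open>Suc j \<le> i\<close> by (intro le_t) simp
      finally show "measure M (E j) \<le> t i" .
    qed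
  qed
  then have "E j \<in> null_sets M" for j
    using E by (auto simp: null_sets_def M.emeasure_eq_measure intro: antisym)
  then have "AE \<omega> in M. \<omega> \<notin> E j" for j
    by (rule AE_not_in)
  then have "AE \<omega> in M. \<forall>j. \<omega> \<notin> E j"
    by (simp add: AE_all_countable)
  then have "AE \<omega> in M. \<forall>j. \<exists>k\<ge>j. (nrm a - e) * norming (real q ^ k) < coeff_lin a (\<lambda>s. X (real q ^ k * s) \<omega>)"
    by (rule AE_mp) (auto simp: E_def not_le intro!: AE_I2)
  with q show ?thesis by blast
qed

text \<open>The ratio \<open>q\<close> depends on the error, so the errors are combined only after
  passing to all integers, among which the powers of the natural number \<open>q\<close> lie. The
  errors \<open>e i\<close> are fractions of \<open>nrm a\<close> because
  \<open>lil_lower_fixed\<close> asks for \<open>e < nrm a\<close>.\<close>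

lemma lil_lower:
  assumes a: "a \<in> coeffs_on {0..T}" and pos: "0 < nrm a"
  shows "AE \<omega> in M. \<forall>e>0. \<exists>\<^sub>F n in sequentially. (nrm a - e) * norming (real n) \<le> coeff_lin a (\<lambda>s. X (real n * s) \<omega>)"
proof -
  define e where "e i = nrm a / real (i + 2)" for i
  have e: "0 < e i" "e i < nrm a" for i
    using pos by (auto simp: e_def divide_less_eq)
  have "AE \<omega> in M. \<exists>\<^sub>F n in sequentially. (nrm a - e i) * norming (real n) \<le> coeff_lin a (\<lambda>s. X (real n * s) \<omega>)" for i
  proof -
    obtain q :: nat where q: "3 \<le> q" and ae: "AE \<omega> in M. \<forall>j. \<exists>k\<ge>j. (nrm a - e i) * norming (real q ^ k) < coeff_lin a (\<lambda>s. X (real q ^ k * s) \<omega>)"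
      using lil_lower_fixed[OF a e] by blast
    from ae show ?thesis
    proof eventually_elim
      case (elim \<omega>)
      show ?case
        unfolding frequently_def eventually_sequentially
      proof (intro notI, elim exE)
        fix j assume j: "\<forall>n\<ge>j. \<not> (nrm a - e i) * norming (real n) \<le> coeff_lin a (\<lambda>s. X (real n * s) \<omega>)"
        obtain k where k: "k \<ge> j" "(nrm a - e i) * norming (real q ^ k) < coeff_lin a (\<lambda>s. X (real q ^ k * s) \<omega>)"
          using elim by blast
        have "k < q ^ k" using q by (intro power_gt_expt) auto
        with j k show False
          using j[rule_format, of "q ^ k"] by simp
      qed
    qed
  qed
  then have "AE \<omega> in M. \<forall>i. \<exists>\<^sub>F n in sequentially. (nrm a - e i) * norming (real n) \<le> coeff_lin a (\<lambda>s. X (real n * s) \<omega>)"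
    by (simp add: AE_all_countable)
  then show ?thesis
  proof eventually_elim
    case (elim \<omega>)
    show ?case
    proof (intro allI impI)
      fix d :: real assume "d > 0"
      have "filterlim (\<lambda>i. real (i + 2)) at_top sequentially" by real_asymp
      then have "(\<lambda>i. nrm a / real (i + 2)) \<longlonglongrightarrow> 0"
        by (rule real_tendsto_divide_at_top[OF tendsto_const])
      then have "\<forall>\<^sub>F i in sequentially. e i < d"
        unfolding e_def[abs_def] using \<open>d > 0\<close> by (rule order_tendstoD)
      then obtain i where i: "e i < d"
        by (metis (mono_tags, lifting) eventually_sequentially order_refl)
      have "\<forall>\<^sub>F n in sequentially. 0 \<le> ln (ln (real n))" by real_asymp
      then have "\<forall>\<^sub>F n in sequentially. (nrm a - e i) * norming (real n) \<le> coeff_lin a (\<lambda>s. X (real n * s) \<omega>) \<longrightarrow>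
          (nrm a - d) * norming (real n) \<le> coeff_lin a (\<lambda>s. X (real n * s) \<omega>)"
      proof eventually_elim
        case (elim n)
        then have "(nrm a - d) * norming (real n) \<le> (nrm a - e i) * norming (real n)"
          using i by (intro mult_right_mono) (auto simp: norming_def)
        then show ?case by linarith
      qed
      with elim[rule_format, of i] show "\<exists>\<^sub>F n in sequentially. (nrm a - d) * norming (real n) \<le> coeff_lin a (\<lambda>s. X (real n * s) \<omega>)"
        by (rule frequently_rev_mp)
    qed
  qed
qed

section \<open>Density of the sphere in the ball\<close>

lemma f_dilation:
  assumes "r > 0"
  shows "f (r * t) (r * u) = r powr H * r powr (- 1 / 2) * f t u"
  using f_self_similar[OF assms, of t u] assms by (simp add: field_simps)

lemma Q_dilation:
  assumes "r > 0"
  shows "Q (r * s) (r * t) = r powr (2 * H) * Q s t"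
proof -
  have e: "(r powr H * r powr (- 1 / 2)) * (r powr H * r powr (- 1 / 2)) * r = r powr (2 * H)"
  proof -
    have "r powr (- 1 / 2) * r powr (- 1 / 2) * r = 1"
      using assms powr_add[of r "- 1 / 2" "- 1 / 2"] by (simp add: powr_minus_divide)
    moreover have "r powr H * r powr H = r powr (2 * H)"
      by (simp flip: powr_add)
    ultimately show ?thesis by (metis (no_types, lifting) mult.assoc mult.commute mult.right_neutral)
  qed
  have "Q (r * s) (r * t) = r * (LINT u|lborel. f (r * s) (r * u) * f (r * t) (r * u))"
    unfolding Q_def using lborel_integral_real_affine[of r "\<lambda>u. f (r * s) u * f (r * t) u" 0] assms by simp
  also have "(\<lambda>u. f (r * s) (r * u) * f (r * t) (r * u)) =
      (\<lambda>u. (r powr H * r powr (- 1 / 2)) * (r powr H * r powr (- 1 / 2)) * (f s u * f t u))"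
    unfolding f_dilation[OF assms] by (simp add: mult_ac)
  also have "r * (LINT u|lborel. (r powr H * r powr (- 1 / 2)) * (r powr H * r powr (- 1 / 2)) * (f s u * f t u)) =
      ((r powr H * r powr (- 1 / 2)) * (r powr H * r powr (- 1 / 2)) * r) * Q s t"
    unfolding Q_def by simp
  finally show ?thesis unfolding e .
qed

lemma f_0: "f 0 u = 0"
  by (simp add: f_def gfbm_kernel_def)

lemma Q_diag: "t \<ge> 0 \<Longrightarrow> Q t t = t powr (2 * H) * Q 1 1"
  using Q_dilation[of t 1 1] by (cases "t = 0") (auto simp: Q_def f_0)

lemma Q_diag_nonneg: "0 \<le> Q t t"
  by (simp add: Q_def)

lemma Q_Cauchy_Schwarz: "s \<ge> 0 \<Longrightarrow> t \<ge> 0 \<Longrightarrow> \<bar>Q s t\<bar> \<le> sqrt (Q s s) * sqrt (Q t t)"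
  unfolding Q_def using Cauchy_Schwarz_LINT[of "f s" lborel "f t"]
  by (simp add: f_measurable f_integrable flip: power2_eq_square)

lemma sqrt_Q_diag: "t \<ge> 0 \<Longrightarrow> sqrt (Q t t) = t powr H * sqrt (Q 1 1)"
proof -
  assume t: "t \<ge> 0"
  have "t powr (2 * H) = (t powr H)\<^sup>2"
    by (simp add: power2_eq_square flip: powr_add)
  then show ?thesis
    unfolding Q_diag[OF t] by (simp add: real_sqrt_mult)
qed

text \<open>
  After normalisation the dilated kernels \<open>f x\<close>, \<open>x \<rightarrow> 0\<close>, concentrate near the origin, where \<open>f 1\<close>
  has little mass.  No rate is needed.
\<close>

lemma Q_decorrelation:
  assumes "0 < e"
  obtains x0 where "0 < x0" "\<And>x. 0 < x \<Longrightarrow> x \<le> x0 \<Longrightarrow> \<bar>Q x 1\<bar> \<le> e * x powr H"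
proof -
  define c where "c = sqrt (Q 1 1)"
  have c: "c \<ge> 0" by (simp add: c_def Q_diag_nonneg)
  \<comment> \<open>Chosen so that the two error terms \<open>x powr H * c * sqrt d\<close> add up
    to at most \<open>e * x powr H\<close>; \<open>c + 1\<close> avoids a division by 0.\<close>
  define d where "d = (e / (2 * (c + 1)))\<^sup>2"
  have d: "d > 0" "sqrt d = e / (2 * (c + 1))" using assms c by (auto simp: d_def)
  let ?A = "\<lambda>n. {u. 1 / sqrt (real n) \<le> \<bar>u\<bar> \<and> \<bar>u\<bar> < sqrt (real n)} :: real set"
  have "(\<lambda>n. LINT u|lborel. indicator (- ?A n) u * (f 1 u)\<^sup>2) \<longlonglongrightarrow> 0"
    by (rule L2_mass_outside_annulus) (auto intro: f_measurable f_integrable)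
  then have "\<forall>\<^sub>F n in sequentially. (LINT u|lborel. indicator (- ?A n) u * (f 1 u)\<^sup>2) < d"
    using d by (intro order_tendstoD) auto
  with eventually_ge_at_top[of 1] have "\<forall>\<^sub>F n in sequentially. 1 \<le> n \<and> (LINT u|lborel. indicator (- ?A n) u * (f 1 u)\<^sup>2) < d"
    by eventually_elim simp
  then obtain n :: nat where n: "1 \<le> n" and small: "(LINT u|lborel. indicator (- ?A n) u * (f 1 u)\<^sup>2) < d"
    by (auto simp: eventually_sequentially)
  have [measurable]: "?A n \<in> sets borel" by measurable
  have f1[measurable]: "f 1 \<in> borel_measurable borel"
    by (rule f_measurable) simp
  have ind_sq: "(indicator E u * y)\<^sup>2 = indicator E u * y\<^sup>2" for E :: "real set" and u y :: real
    by (simp split: split_indicator)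
  have ind_int: "integrable lborel (\<lambda>u. (indicator E u * f t u)\<^sup>2)" if "E \<in> sets borel" "t \<ge> 0" for E t
    unfolding ind_sq using integrable_mult_indicator[of E lborel "\<lambda>u. (f t u)\<^sup>2"] f_integrable that by simp
  have "\<bar>Q x 1\<bar> \<le> e * x powr H" if x: "0 < x" "x \<le> 1 / real n" for x
  proof -
    have fx[measurable]: "f x \<in> borel_measurable borel"
      using x by (intro f_measurable) simp
    have m: "(\<lambda>u. indicator (?A n) u * f x u) \<in> borel_measurable borel"
      "(\<lambda>u. indicator (- ?A n) u * f 1 u) \<in> borel_measurable borel"
      by measurable
    have far: "sqrt (LINT u|lborel. (indicator (- ?A n) u * f 1 u)\<^sup>2) \<le> sqrt d"
      unfolding ind_sq using small by simp
    have near: "sqrt (LINT u|lborel. (indicator (?A n) u * f x u)\<^sup>2) \<le> x powr H * sqrt d"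
    proof -
      define G where "G u = indicator (?A n) u * f x u / x powr H" for u
      have G: "G (x * u) = x powr (- 1 / 2) * (indicator (?A n) (x * u) * f 1 u)" for u
      proof -
        have "f x (x * u) / x powr H = x powr (- 1 / 2) * f 1 u"
          using f_self_similar[OF x(1), of 1 u] by simp
        then show ?thesis
          unfolding G_def times_divide_eq_right[symmetric] by (simp only: mult.left_commute)
      qed
      have "(LINT u|lborel. (G u)\<^sup>2) = (LINT u|lborel. (indicator (?A n) (x * u) * f 1 u)\<^sup>2)"
        by (rule L2_norm_dilation[OF x(1)]) (rule G)
      also have "\<dots> \<le> (LINT u|lborel. (indicator (- ?A n) u * f 1 u)\<^sup>2)"
      proof (rule integral_mono)
        have "(\<lambda>u. indicator (?A n) (x * u) * (f 1 u)\<^sup>2) = (\<lambda>u. indicator {u. x * u \<in> ?A n} u *\<^sub>R (f 1 u)\<^sup>2)"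
          by (auto simp: indicator_def)
        moreover have "integrable lborel (\<lambda>u. indicator {u. x * u \<in> ?A n} u *\<^sub>R (f 1 u)\<^sup>2)"
          by (intro integrable_mult_indicator f_integrable) simp_all
        ultimately show "integrable lborel (\<lambda>u. (indicator (?A n) (x * u) * f 1 u)\<^sup>2)"
          by (simp add: power_mult_distrib) (simp add: indicator_def of_bool_def if_distrib if_distribR cong: if_cong)
        show "integrable lborel (\<lambda>u. (indicator (- ?A n) u * f 1 u)\<^sup>2)"
          by (rule ind_int) simp_all
        fix u
        \<comment> \<open>Contraction by \<open>x \<le> 1 / n\<close> is strong enough that only
          points outside the annulus are mapped into it.\<close>
        have "u \<notin> ?A n" if "x * u \<in> ?A n"
        proof -
          have "1 / sqrt (real n) \<le> x * \<bar>u\<bar>" using that x by (simp add: abs_mult)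
          also have "\<dots> \<le> 1 / real n * \<bar>u\<bar>" using x by (intro mult_right_mono) auto
          finally have "real n / sqrt (real n) \<le> \<bar>u\<bar>" using n by (simp add: field_simps)
          then have "sqrt (real n) \<le> \<bar>u\<bar>" by (simp add: real_div_sqrt)
          then show ?thesis by auto
        qed
        then show "(indicator (?A n) (x * u) * f 1 u)\<^sup>2 \<le> (indicator (- ?A n) u * f 1 u)\<^sup>2"
          by (cases "x * u \<in> ?A n") auto
      qed
      finally have "sqrt (LINT u|lborel. (G u)\<^sup>2) \<le> sqrt d"
        using far by (meson order_trans real_sqrt_le_mono)
      moreover have "(LINT u|lborel. (indicator (?A n) u * f x u)\<^sup>2) = (x powr H)\<^sup>2 * (LINT u|lborel. (G u)\<^sup>2)"
        using x by (simp add: G_def power_divide)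
      ultimately show ?thesis
        using x by (simp add: real_sqrt_mult mult_left_mono)
    qed
    \<comment> \<open>Inside the annulus the factor \<open>f x\<close> has little mass, outside it
      the factor \<open>f 1\<close>.\<close>
    have "f x u * f 1 u = (indicator (?A n) u * f x u) * f 1 u + f x u * (indicator (- ?A n) u * f 1 u)" for u
      by (simp split: split_indicator)
    then have "Q x 1 = (LINT u|lborel. (indicator (?A n) u * f x u) * f 1 u + f x u * (indicator (- ?A n) u * f 1 u))"
      by (simp add: Q_def)
    also have "\<dots> = (LINT u|lborel. (indicator (?A n) u * f x u) * f 1 u) + (LINT u|lborel. f x u * (indicator (- ?A n) u * f 1 u))"
      using x m by (intro Bochner_Integration.integral_add square_integrable_mult ind_int f_integrable) (auto intro: f_measurable)
    finally have "\<bar>Q x 1\<bar> \<le> \<bar>LINT u|lborel. (indicator (?A n) u * f x u) * f 1 u\<bar> + \<bar>LINT u|lborel. f x u * (indicator (- ?A n) u * f 1 u)\<bar>"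
      by linarith
    also have "\<dots> \<le> sqrt (LINT u|lborel. (indicator (?A n) u * f x u)\<^sup>2) * sqrt (LINT u|lborel. (f 1 u)\<^sup>2) +
        sqrt (LINT u|lborel. (f x u)\<^sup>2) * sqrt (LINT u|lborel. (indicator (- ?A n) u * f 1 u)\<^sup>2)"
      using x m by (intro add_mono Cauchy_Schwarz_LINT ind_int f_integrable) (auto intro: f_measurable)
    also have "sqrt (LINT u|lborel. (f 1 u)\<^sup>2) = c"
      by (simp add: c_def Q_def power2_eq_square)
    also have "sqrt (LINT u|lborel. (f x u)\<^sup>2) = x powr H * c"
      using sqrt_Q_diag[of x] x by (simp add: c_def Q_def power2_eq_square)
    also have "sqrt (LINT u|lborel. (indicator (?A n) u * f x u)\<^sup>2) * c + x powr H * c * sqrt (LINT u|lborel. (indicator (- ?A n) u * f 1 u)\<^sup>2)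
        \<le> x powr H * sqrt d * c + x powr H * c * sqrt d"
      using c by (intro add_mono mult_right_mono[OF near] mult_left_mono[OF far]) auto
    also have "\<dots> = x powr H * (e * (c / (c + 1)))"
    proof -
      have "2 * (e / (2 * g)) * c = e * (c / g)" if "g \<noteq> 0" for g
        using that by simp
      from this[of "c + 1"] have "2 * sqrt d * c = e * (c / (c + 1))"
        unfolding d(2) using c by simp
      then have "x powr H * (2 * sqrt d * c) = x powr H * (e * (c / (c + 1)))" by simp
      then show ?thesis by (simp add: algebra_simps)
    qed
    also have "\<dots> \<le> x powr H * (e * 1)"
      using c assms by (intro mult_left_mono) (auto simp: divide_le_eq)
    finally show ?thesis by (simp add: mult.commute)
  qed
  then show ?thesis
    using n by (intro that[of "1 / real n"]) auto
qed

text \<open>For \<open>v \<le> \<eta>\<close> Cauchy-Schwarz suffices, as the deviation at time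
  \<open>v\<close> is itself small. For larger \<open>v\<close>, dilation by \<open>v\<close>
  reduces the claim to \<open>Q_decorrelation\<close> at \<open>t / v\<close>, and
  \<open>t \<le> x0 * \<eta>\<close> brings this ratio below \<open>x0\<close> for all such
  \<open>v\<close> at once.\<close>

lemma Q_small_time:
  assumes "0 < e"
  obtains t where "0 < t" "t \<le> T" "\<And>v. v \<in> {0..T} \<Longrightarrow> \<bar>Q t v\<bar> \<le> e * t powr H"
proof -
  define c where "c = Q 1 1"
  have c: "c \<ge> 0" by (simp add: c_def Q_diag_nonneg)
  have TH: "0 < T powr H" using T by simp
  obtain x0 where x0: "0 < x0" "\<And>x. 0 < x \<Longrightarrow> x \<le> x0 \<Longrightarrow> \<bar>Q x 1\<bar> \<le> (e / T powr H) * x powr H"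
  proof (rule Q_decorrelation[of "e / T powr H"], goal_cases)
    case 1
    show ?case using assms TH by simp
  next
    case (2 x0)
    from 2(1)[OF 2(2-)] show ?case .
  qed
  define \<eta> where "\<eta> = (e / (c + 1)) powr (1 / H)"
  have \<eta>: "\<eta> > 0" using assms c by (simp add: \<eta>_def)
  have \<eta>H: "\<eta> powr H * c \<le> e"
  proof -
    have "\<eta> powr H * c = e * (c / (c + 1))"
      using assms c H by (simp add: \<eta>_def powr_powr)
    also have "\<dots> \<le> e * 1" using c assms by (intro mult_left_mono) (auto simp: divide_le_eq)
    finally show ?thesis by simp
  qed
  define t where "t = min T (x0 * \<eta>)"
  have t: "0 < t" "t \<le> T" "t \<le> x0 * \<eta>"
    using T x0 \<eta> by (auto simp: t_def)
  have "\<bar>Q t v\<bar> \<le> e * t powr H" if v: "v \<in> {0..T}" for v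
  proof (cases "v \<le> \<eta>")
    case True
    have "\<bar>Q t v\<bar> \<le> sqrt (Q t t) * sqrt (Q v v)"
      using t v by (intro Q_Cauchy_Schwarz) auto
    also have "\<dots> = t powr H * (v powr H * c)"
      using t v by (simp add: sqrt_Q_diag[of t] sqrt_Q_diag[of v] c_def Q_diag_nonneg)
    also have "\<dots> \<le> t powr H * (\<eta> powr H * c)"
      using True v c H by (intro mult_left_mono mult_right_mono powr_mono2) auto
    also have "\<dots> \<le> t powr H * e"
      using \<eta>H by (intro mult_left_mono) auto
    finally show ?thesis by (simp add: mult.commute)
  next
    case False
    then have v0: "v > 0" using \<eta> by simp
    have "t / v \<le> x0 * \<eta> / v" using t v0 by (intro divide_right_mono) auto
    also have "\<dots> \<le> x0" using False v0 x0 by (simp add: divide_le_eq)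
    finally have bnd: "\<bar>Q (t / v) 1\<bar> \<le> (e / T powr H) * (t / v) powr H"
      using t v0 by (intro x0) auto
    have "Q t v = v powr (2 * H) * Q (t / v) 1"
      using Q_dilation[OF v0, of "t / v" 1] v0 by simp
    then have "\<bar>Q t v\<bar> = v powr (2 * H) * \<bar>Q (t / v) 1\<bar>"
      by (simp add: abs_mult)
    also have "\<dots> \<le> v powr (2 * H) * ((e / T powr H) * (t / v) powr H)"
      by (intro mult_left_mono bnd) simp
    also have "v powr (2 * H) = v powr H * v powr H"
      by (simp flip: powr_add)
    also have "v powr H * v powr H * ((e / T powr H) * (t / v) powr H) = (v powr H / T powr H) * (e * t powr H)"
      using v0 t by (simp add: powr_divide)
    also have "\<dots> \<le> 1 * (e * t powr H)"
      using v v0 TH H assms by (intro mult_right_mono) (auto simp: divide_le_eq intro!: powr_mono2)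
    finally show ?thesis by simp
  qed
  then show ?thesis using t by (intro that[of t]) auto
qed

lemma \<Psi>_eq_Q: "s \<in> {0..T} \<Longrightarrow> t \<in> {0..T} \<Longrightarrow> \<Psi> s t = Q s t"
  by (simp add: covariance_eq)

text \<open>A ball element is moved to the sphere along a direction that is small in sup norm.\<close>

lemma sphere_approx:
  assumes Q1: "Q 1 1 > 0" and a: "a \<in> coeffs_on {0..T}" and na: "nrm a \<le> 1" and "0 < e"
  obtains b where "b \<in> coeffs_on {0..T}" "nrm b = 1" "\<And>v. v \<in> {0..T} \<Longrightarrow> \<bar>comb a v - comb b v\<bar> \<le> e"
proof -
  define c where "c = sqrt (Q 1 1)"
  have c: "c > 0" using Q1 by (simp add: c_def)
  \<comment> \<open>The constant anticipates that the coefficient \<open>\<beta>\<close> of the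
    added direction satisfies \<open>\<bar>\<beta>\<bar> * sqrt A \<le> 3\<close>, where
    \<open>sqrt A = t powr H * c\<close>.\<close>
  obtain t where t: "0 < t" "t \<le> T" "\<And>v. v \<in> {0..T} \<Longrightarrow> \<bar>Q t v\<bar> \<le> (e * c / 3) * t powr H"
  proof (rule Q_small_time[of "e * c / 3"], goal_cases)
    case 1
    show ?case using c \<open>0 < e\<close> by simp
  next
    case (2 t)
    from 2(1)[OF 2(2-)] show ?case .
  qed
  have tT: "t \<in> {0..T}" using t by simp
  define A where "A = Q t t"
  have sA: "sqrt A = t powr H * c"
    using t by (simp add: A_def c_def sqrt_Q_diag[of t])
  have A: "A > 0" using sA t c by (metis mult_pos_pos powr_gt_zero real_sqrt_gt_0_iff less_numeral_extra(3))
  define p where "p = comb a t"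
  have p: "\<bar>p\<bar> \<le> sqrt A"
  proof -
    have "\<bar>p\<bar> \<le> nrm a * sqrt A"
      using comb_le[OF a tT] by (simp add: p_def A_def \<Psi>_eq_Q[OF tT tT])
    also have "\<dots> \<le> 1 * sqrt A" using na A by (intro mult_right_mono) auto
    finally show ?thesis by simp
  qed
  define C where "C = 1 - (nrm a)\<^sup>2"
  have C: "0 \<le> C" "C \<le> 1"
    using na nrm_nonneg[OF a] by (auto simp: C_def power_le_one)
  \<comment> \<open>A root of the quadratic equation saying that adding
    \<open>\<beta> * unit_coeff t\<close> to \<open>a\<close> raises the squared norm to 1.\<close>
  define \<beta> where "\<beta> = (sqrt (p\<^sup>2 + A * C) - p) / A"
  have root: "A * \<beta>\<^sup>2 + 2 * \<beta> * p = C"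
  proof -
    have "A * \<beta> + p = sqrt (p\<^sup>2 + A * C)" using A by (simp add: \<beta>_def)
    then have "(A * \<beta> + p)\<^sup>2 = p\<^sup>2 + A * C" using A C by simp
    then have "A * (A * \<beta>\<^sup>2 + 2 * \<beta> * p) = A * C" by (simp add: power2_sum power_mult_distrib power2_eq_square algebra_simps)
    with A show ?thesis by simp
  qed
  \<comment> \<open>The coefficient itself may be of order \<open>t powr (- H)\<close>. This bound
    is enough because it is multiplied by \<open>Q t v\<close>, which is small compared with
    \<open>t powr H\<close>.\<close>
  have "\<bar>A * \<beta>\<bar> \<le> 3 * sqrt A"
  proof -
    have "p\<^sup>2 \<le> (sqrt A)\<^sup>2" using p by (metis abs_ge_zero power2_abs power_mono)
    moreover have "(sqrt A)\<^sup>2 = A" using A by simp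
    moreover have "A * C \<le> A * 1" using A C by (intro mult_left_mono) auto
    ultimately have "p\<^sup>2 + A * C \<le> 2 * A" by linarith
    then have "sqrt (p\<^sup>2 + A * C) \<le> sqrt (4 * A)" using A by (intro real_sqrt_le_mono) linarith
    also have "sqrt (4 * A) = 2 * sqrt A" by (simp add: real_sqrt_mult)
    finally have "sqrt (p\<^sup>2 + A * C) \<le> 2 * sqrt A" .
    moreover have "0 \<le> sqrt (p\<^sup>2 + A * C)" using A C by simp
    moreover have "A * \<beta> = sqrt (p\<^sup>2 + A * C) - p" using A by (simp add: \<beta>_def)
    ultimately show ?thesis using p by linarith
  qed
  then have \<beta>: "\<bar>\<beta>\<bar> * sqrt A \<le> 3"
  proof -
    assume "\<bar>A * \<beta>\<bar> \<le> 3 * sqrt A"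
    then have "sqrt A * (\<bar>\<beta>\<bar> * sqrt A) \<le> sqrt A * 3"
      using A by (simp add: abs_mult mult_ac)
    then show ?thesis using A by (simp add: mult_le_cancel_left_pos)
  qed
  define b where "b = (\<lambda>s. a s + \<beta> * unit_coeff t s)"
  have cb: "b \<in> coeffs_on {0..T}"
    unfolding b_def by (intro coeffs_on_lincomb a coeffs_on_unit tT)
  have "(nrm b)\<^sup>2 = 1"
  proof -
    have "(nrm b)\<^sup>2 = (nrm a)\<^sup>2 + 2 * \<beta> * p + \<beta>\<^sup>2 * A"
      unfolding nrm_sq[OF cb] unfolding b_def ip_lincomb_self[OF a coeffs_on_unit[OF tT]]
      by (simp add: ip_unit comb_unit \<Psi>_eq_Q[OF tT tT] A_def p_def nrm_sq[OF a])
    with root show ?thesis by (simp add: C_def mult.commute)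
  qed
  then have "nrm b = 1" using nrm_nonneg[OF cb] by (simp add: power2_eq_1_iff)
  moreover have "\<bar>comb a v - comb b v\<bar> \<le> e" if v: "v \<in> {0..T}" for v
  proof -
    have "comb b v = comb a v + \<beta> * Q t v"
      unfolding b_def comb_lincomb[OF a coeffs_on_unit[OF tT]] by (simp add: comb_unit \<Psi>_eq_Q[OF tT v])
    then have "\<bar>comb a v - comb b v\<bar> = \<bar>\<beta>\<bar> * \<bar>Q t v\<bar>" by (simp add: abs_mult)
    also have "\<dots> \<le> \<bar>\<beta>\<bar> * ((e * c / 3) * t powr H)" using t(3)[OF v] by (intro mult_left_mono) auto
    also have "\<dots> = (\<bar>\<beta>\<bar> * sqrt A) * (e / 3)" by (simp add: sA)
    also have "\<dots> \<le> 3 * (e / 3)" using \<beta> \<open>0 < e\<close> by (intro mult_right_mono) auto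
    finally show ?thesis by simp
  qed
  ultimately show ?thesis using cb that by blast
qed

section \<open>Continuity of the covariance and of the elements of the ball\<close>

lemma unit_coeff_tendsto:
  assumes s: "s \<in> {0..T}" and q: "\<And>n. q n \<in> {0..T}" "q \<longlonglongrightarrow> s"
  shows "(\<lambda>n. nrm (\<lambda>x. unit_coeff s x - unit_coeff (q n) x)) \<longlonglongrightarrow> 0"
proof -
  define D where "D n = (LINT u|lborel. (f s u - f (q n) u)\<^sup>2)" for n
  have W: "wiener (\<lambda>u. f s u - f (q n) u) (\<lambda>\<omega>. Y s \<omega> - Y (q n) \<omega>)" for n
    using s q by (intro wiener_diff wiener_Y) auto
  have nrm_eq: "nrm (\<lambda>x. unit_coeff s x - unit_coeff (q n) x) = sqrt (D n)" for n
  proof -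
    have c: "unit_coeff s \<in> coeffs_on {0..T}" "unit_coeff (q n) \<in> coeffs_on {0..T}"
      using s q by (auto intro: coeffs_on_unit)
    have "coeff_lin (\<lambda>x. unit_coeff s x - unit_coeff (q n) x) (\<lambda>s. f s u) = f s u - f (q n) u" for u
      using coeff_lin_lincomb[OF coeffs_onD(1)[OF c(1)] coeffs_onD(1)[OF c(2)], of "-1" "\<lambda>s. f s u"]
      by (simp add: coeff_lin_unit)
    then show ?thesis
      unfolding kernel_norm_def kernel_inner_eq_L2[OF coeffs_on_diff[OF c]] D_def by simp
  qed
  \<comment> \<open>Mean square continuity is extracted from path continuity. The probability of an
    increment above 1 tends to 0, whereas a centred Gaussian variable of variance at least
    \<open>w\<close> exceeds 1 with probability bounded below.\<close>
  define A where "A n = {\<omega> \<in> space M. X s \<omega> - X (q n) \<omega> > 1}" for n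
  have [measurable]: "X s \<in> borel_measurable M" "X (q n) \<in> borel_measurable M" for n
    using s q by (auto intro: X_measurable)
  have A: "A n \<in> sets M" for n unfolding A_def by measurable
  have "(\<lambda>n. LINT \<omega>|M. indicator (A n) \<omega>) \<longlonglongrightarrow> (LINT \<omega>|M. (0::real))"
  proof (rule integral_dominated_convergence[where w="\<lambda>_. 1"])
    show "AE \<omega> in M. (\<lambda>n. indicator (A n) \<omega> :: real) \<longlonglongrightarrow> 0"
    proof (rule AE_I2)
      fix \<omega> assume \<omega>: "\<omega> \<in> space M"
      have "(\<lambda>n. X (q n) \<omega>) \<longlonglongrightarrow> X s \<omega>"
        by (rule continuous_on_tendsto_compose[OF X_continuous[OF \<omega>] q(2)]) (use s q in auto)
      then have "(\<lambda>n. X s \<omega> - X (q n) \<omega>) \<longlonglongrightarrow> X s \<omega> - X s \<omega>" by (intro tendsto_intros)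
      then have "\<forall>\<^sub>F n in sequentially. X s \<omega> - X (q n) \<omega> < 1"
        by (rule order_tendstoD) simp
      then have "\<forall>\<^sub>F n in sequentially. indicator (A n) \<omega> = (0::real)"
        by eventually_elim (auto simp: A_def)
      then show "(\<lambda>n. indicator (A n) \<omega> :: real) \<longlonglongrightarrow> 0" by (rule tendsto_eventually)
    qed
  qed (use A in auto)
  then have lim: "(\<lambda>n. measure M (A n)) \<longlonglongrightarrow> 0"
    using A sets.sets_into_space[OF A] by (simp add: Int_absorb2)
  have A_N: "measure M (A n) = prob {\<omega> \<in> space N. Y s \<omega> - Y (q n) \<omega> > 1}" for n
  proof -
    have "measure M {\<omega> \<in> space M. \<forall>i\<in>{()}. (\<Sum>k\<in>UNIV. (if k then 1 else - 1) * X (if k then s else q n) \<omega>) \<in> {1<..}} =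
      prob {\<omega> \<in> space N. \<forall>i\<in>{()}. (\<Sum>k\<in>UNIV. (if k then 1 else - 1) * Y (if k then s else q n) \<omega>) \<in> {1<..}}"
      using s q by (intro fdd_transfer) auto
    then show ?thesis by (simp add: UNIV_bool A_def)
  qed
  have "D \<longlonglongrightarrow> 0"
  proof (rule order_tendstoI)
    fix w :: real assume "w < 0"
    moreover have "0 \<le> D n" for n by (simp add: D_def)
    ultimately show "\<forall>\<^sub>F n in sequentially. w < D n" by (intro always_eventually) (auto intro: less_le_trans)
  next
    fix w :: real assume w: "0 < w"
    let ?p = "exp (- (1 / sqrt w + 1)\<^sup>2 / 2) / sqrt (2 * pi)"
    have "\<forall>\<^sub>F n in sequentially. measure M (A n) < ?p"
      using lim by (rule order_tendstoD) simp
    then show "\<forall>\<^sub>F n in sequentially. D n < w"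
    proof eventually_elim
      case (elim n)
      show ?case
      proof (rule ccontr)
        assume "\<not> D n < w"
        then have "?p \<le> measure M (A n)"
          unfolding A_N using w by (intro wiener_lower_tail[OF W]) (auto simp: D_def)
        with elim show False by simp
      qed
    qed
  qed
  then have "(\<lambda>n. sqrt (D n)) \<longlonglongrightarrow> sqrt 0" by (rule tendsto_real_sqrt)
  then show ?thesis unfolding nrm_eq by simp
qed

lemma rkhs_unit_ball_continuous:
  assumes h: "h \<in> rkhs_unit_ball \<Psi> {0..T}"
  shows "continuous_on {0..T} h"
  unfolding continuous_on_sequentially
proof (intro allI ballI impI, elim conjE)
  fix q s assume s: "s \<in> {0..T}" and q: "\<forall>n. q n \<in> {0..T}" "q \<longlonglongrightarrow> s"
  have "(\<lambda>n. h s - h (q n)) \<longlonglongrightarrow> 0"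
  proof (rule Lim_null_comparison)
    show "\<forall>\<^sub>F n in sequentially. norm (h s - h (q n)) \<le> nrm (\<lambda>x. unit_coeff s x - unit_coeff (q n) x)"
    proof (intro always_eventually allI)
      fix n
      have c: "unit_coeff s \<in> coeffs_on {0..T}" "unit_coeff (q n) \<in> coeffs_on {0..T}"
        using s q by (auto intro: coeffs_on_unit)
      have "coeff_lin (\<lambda>x. unit_coeff s x - unit_coeff (q n) x) h = h s - h (q n)"
        using coeff_lin_lincomb[OF coeffs_onD(1)[OF c(1)] coeffs_onD(1)[OF c(2)], of "-1" h]
        by (simp add: coeff_lin_unit)
      then show "norm (h s - h (q n)) \<le> nrm (\<lambda>x. unit_coeff s x - unit_coeff (q n) x)"
        using rkhs_unit_ball_bound[OF h coeffs_on_diff[OF c]] by simp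
    qed
    show "(\<lambda>n. nrm (\<lambda>x. unit_coeff s x - unit_coeff (q n) x)) \<longlonglongrightarrow> 0"
      using s q by (intro unit_coeff_tendsto) auto
  qed
  then have "(\<lambda>n. h s - (h s - h (q n))) \<longlonglongrightarrow> h s - 0" by (intro tendsto_intros)
  then show "(h \<circ> q) \<longlonglongrightarrow> h s" by (simp add: comp_def)
qed

text \<open>Rational in both support and values, hence countable: the functionals for which almost
  sure statements can hold simultaneously.\<close>

definition rat_coeffs :: "(real \<Rightarrow> real) set" where
  "rat_coeffs = {a \<in> coeffs_on (\<rat> \<inter> {0..T}). range a \<subseteq> \<rat>}"

lemma rat_coeffs_subset: "a \<in> rat_coeffs \<Longrightarrow> a \<in> coeffs_on {0..T}"
  by (auto simp: rat_coeffs_def coeffs_on_def)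

lemma countable_rat_coeffs: "countable rat_coeffs"
proof (rule countable_subset)
  let ?U = "\<Union>F\<in>{F. finite F \<and> F \<subseteq> \<rat> \<inter> {0..T}}. (\<lambda>g x. if x \<in> F then g x else 0) ` (F \<rightarrow>\<^sub>E (\<rat> :: real set))"
  show "rat_coeffs \<subseteq> ?U"
  proof
    fix a assume a: "a \<in> rat_coeffs"
    let ?F = "{s. a s \<noteq> 0}"
    have "?F \<in> {F. finite F \<and> F \<subseteq> \<rat> \<inter> {0..T}}"
      using a by (auto simp: rat_coeffs_def coeffs_on_def)
    moreover have "restrict a ?F \<in> ?F \<rightarrow>\<^sub>E \<rat>"
      using a by (auto simp: rat_coeffs_def)
    moreover have "a = (\<lambda>x. if x \<in> ?F then restrict a ?F x else 0)"
      by auto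
    ultimately show "a \<in> ?U" by blast
  qed
  show "countable ?U"
    by (intro countable_UN countable_Collect_finite_subset countable_image countable_PiE)
      (auto simp: countable_rat)
qed

lemma rat_coeffs_add:
  assumes "a \<in> rat_coeffs" "c \<in> \<rat>" "s \<in> \<rat> \<inter> {0..T}"
  shows "(\<lambda>x. a x + c * unit_coeff s x) \<in> rat_coeffs"
proof -
  have "a x \<in> \<rat>" for x
    using assms(1) by (auto simp: rat_coeffs_def)
  then have "a x + c * unit_coeff s x \<in> \<rat>" for x
    using assms(2) by (intro Rats_add Rats_mult) (auto simp: unit_coeff_def)
  moreover have "(\<lambda>x. a x + c * unit_coeff s x) \<in> coeffs_on (\<rat> \<inter> {0..T})"
    using assms by (intro coeffs_on_lincomb coeffs_on_unit) (auto simp: rat_coeffs_def)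
  ultimately show ?thesis by (auto simp: rat_coeffs_def)
qed

lemma rational_sequence:
  obtains q where "\<And>n. q n \<in> \<rat>" "q \<longlonglongrightarrow> (c::real)"
proof -
  have "\<exists>x\<in>\<rat>. c < x \<and> x < c + 1 / real (Suc n)" for n
    by (rule Rats_dense_in_real) simp
  then obtain q where q: "\<And>n. q n \<in> \<rat>" "\<And>n. c < q n" "\<And>n. q n < c + 1 / real (Suc n)" by metis
  have "q \<longlonglongrightarrow> c"
  proof (rule tendsto_sandwich[of "\<lambda>_. c" _ _ "\<lambda>n. c + 1 / real (Suc n)"])
    show "(\<lambda>n. c + 1 / real (Suc n)) \<longlonglongrightarrow> c" by real_asymp
  qed (use q in \<open>auto intro!: always_eventually less_imp_le\<close>)
  with q that show ?thesis by blast
qed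

lemma rational_sequence_interval:
  assumes "s \<in> {0..T}"
  obtains q where "\<And>n. q n \<in> \<rat> \<inter> {0..T}" "q \<longlonglongrightarrow> s"
proof -
  have "\<exists>x. x \<in> \<rat> \<inter> {0..T} \<and> \<bar>x - s\<bar> < 1 / real (Suc n)" for n
    using rational_approx[OF assms, of "1 / real (Suc n)"] by auto
  then obtain q where q: "\<And>n. q n \<in> \<rat> \<inter> {0..T}" "\<And>n. \<bar>q n - s\<bar> < 1 / real (Suc n)" by metis
  have "(\<lambda>n. q n - s) \<longlonglongrightarrow> 0"
  proof (rule Lim_null_comparison)
    show "(\<lambda>n. 1 / real (Suc n)) \<longlonglongrightarrow> 0" by real_asymp
  qed (use q in \<open>auto intro!: always_eventually less_imp_le\<close>)
  then have "q \<longlonglongrightarrow> s" by (simp add: LIM_zero_iff)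
  with q that show ?thesis by blast
qed

text \<open>Points of the support are moved one at a time. Norm and pairing with \<open>h\<close>
  must be approximated by the same \<open>b\<close>, since a bound on one is to be carried to the
  other.\<close>

lemma rat_coeffs_dense:
  assumes h: "continuous_on {0..T} h" and a: "a \<in> coeffs_on {0..T}" and "0 < e"
  obtains b where "b \<in> rat_coeffs" "nrm (\<lambda>s. a s - b s) < e" "\<bar>coeff_lin a h - coeff_lin b h\<bar> < e"
proof -
  have "\<exists>b\<in>rat_coeffs. nrm (\<lambda>s. a s - b s) < e \<and> \<bar>coeff_lin a h - coeff_lin b h\<bar> < e"
    if "finite F" "{s. a s \<noteq> 0} \<subseteq> F" "F \<subseteq> {0..T}" "0 < e" for F a e
    using that
  proof (induction F arbitrary: a e rule: finite_induct)
    case empty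
    then have "a = (\<lambda>_. 0)" by auto
    with empty show ?case
      by (intro bexI[of _ "\<lambda>_. 0"])
        (auto simp: rat_coeffs_def coeffs_on_zero kernel_norm_def kernel_inner_def)
  next
    case (insert s F)
    define a' where "a' = a(s := 0)"
    define c where "c = a s"
    have s: "s \<in> {0..T}" using insert.prems by simp
    have supp: "{x. a' x \<noteq> 0} \<subseteq> F" using insert.prems by (auto simp: a'_def)
    have ca': "a' \<in> coeffs_on {0..T}"
      using supp insert by (auto simp: coeffs_on_def intro: finite_subset)
    have a_eq: "a = (\<lambda>x. a' x + c * unit_coeff s x)"
      by (auto simp: a'_def c_def unit_coeff_def)
    obtain b where b: "b \<in> rat_coeffs" "nrm (\<lambda>x. a' x - b x) < e / 2" "\<bar>coeff_lin a' h - coeff_lin b h\<bar> < e / 2"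
      using insert.IH[OF supp, of "e / 2"] insert.prems by auto
    note cb = rat_coeffs_subset[OF b(1)]
    obtain q where q: "\<And>n. q n \<in> \<rat> \<inter> {0..T}" "q \<longlonglongrightarrow> s"
      using rational_sequence_interval[OF s] by blast
    obtain r where r: "\<And>n. r n \<in> \<rat>" "r \<longlonglongrightarrow> c"
      using rational_sequence by blast
    have us: "unit_coeff s \<in> coeffs_on {0..T}" and uq: "unit_coeff (q n) \<in> coeffs_on {0..T}" for n
      using s q(1)[of n] by (auto intro: coeffs_on_unit)
    \<comment> \<open>The change at one point: moving \<open>s\<close> costs \<open>c\<close> times
      the norm treated in \<open>unit_coeff_tendsto\<close>, and changing the value costs
      \<open>c - r n\<close> times a bounded norm.\<close>
    define g where "g n x = c * unit_coeff s x - r n * unit_coeff (q n) x" for n x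
    have cg: "g n \<in> coeffs_on {0..T}" for n
      unfolding g_def[abs_def] by (intro coeffs_on_diff coeffs_on_scale us uq)
    define C where "C = T powr H * sqrt (Q 1 1)"
    have nrm_uq: "nrm (unit_coeff (q n)) \<le> C" for n
    proof -
      have qn: "q n \<in> {0..T}" using q(1)[of n] by simp
      have "nrm (unit_coeff (q n)) = q n powr H * sqrt (Q 1 1)"
        using qn by (simp add: kernel_norm_def ip_unit_unit \<Psi>_eq_Q sqrt_Q_diag[of "q n"])
      also have "\<dots> \<le> C" unfolding C_def
        using qn H by (intro mult_right_mono powr_mono2) (auto simp: Q_diag_nonneg)
      finally show ?thesis .
    qed
    have "(\<lambda>n. nrm (g n)) \<longlonglongrightarrow> 0"
    proof (rule Lim_null_comparison)
      show "\<forall>\<^sub>F n in sequentially. norm (nrm (g n)) \<le> \<bar>c\<bar> * nrm (\<lambda>x. unit_coeff s x - unit_coeff (q n) x) + \<bar>c - r n\<bar> * C"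
      proof (intro always_eventually allI)
        fix n
        have "g n = (\<lambda>x. c * (unit_coeff s x - unit_coeff (q n) x) + (c - r n) * unit_coeff (q n) x)"
          by (auto simp: g_def algebra_simps)
        then have "nrm (g n) \<le> nrm (\<lambda>x. c * (unit_coeff s x - unit_coeff (q n) x)) + nrm (\<lambda>x. (c - r n) * unit_coeff (q n) x)"
          using nrm_triangle[OF coeffs_on_scale[OF coeffs_on_diff[OF us uq]] coeffs_on_scale[OF uq]] by simp
        also have "\<dots> = \<bar>c\<bar> * nrm (\<lambda>x. unit_coeff s x - unit_coeff (q n) x) + \<bar>c - r n\<bar> * nrm (unit_coeff (q n))"
          by (simp add: nrm_scale[OF coeffs_on_diff[OF us uq]] nrm_scale[OF uq])
        also have "\<dots> \<le> \<bar>c\<bar> * nrm (\<lambda>x. unit_coeff s x - unit_coeff (q n) x) + \<bar>c - r n\<bar> * C"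
          using nrm_uq[of n] by (intro add_left_mono mult_left_mono) auto
        finally show "norm (nrm (g n)) \<le> \<bar>c\<bar> * nrm (\<lambda>x. unit_coeff s x - unit_coeff (q n) x) + \<bar>c - r n\<bar> * C"
          using nrm_nonneg[OF cg, of n] by simp
      qed
      have "(\<lambda>n. \<bar>c\<bar> * nrm (\<lambda>x. unit_coeff s x - unit_coeff (q n) x) + \<bar>c - r n\<bar> * C) \<longlonglongrightarrow> \<bar>c\<bar> * 0 + \<bar>c - c\<bar> * C"
        using q(1) by (intro tendsto_intros unit_coeff_tendsto[OF s _ q(2)] r(2)) auto
      then show "(\<lambda>n. \<bar>c\<bar> * nrm (\<lambda>x. unit_coeff s x - unit_coeff (q n) x) + \<bar>c - r n\<bar> * C) \<longlonglongrightarrow> 0" by simp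
    qed
    then have ev1: "\<forall>\<^sub>F n in sequentially. nrm (g n) < e / 2"
      using insert.prems by (intro order_tendstoD) auto
    have "(\<lambda>n. h (q n)) \<longlonglongrightarrow> h s"
      by (rule continuous_on_tendsto_compose[OF h q(2) s]) (use q(1) in \<open>auto intro!: always_eventually\<close>)
    then have "(\<lambda>n. \<bar>c * h s - r n * h (q n)\<bar>) \<longlonglongrightarrow> \<bar>c * h s - c * h s\<bar>"
      by (intro tendsto_intros r)
    then have "\<forall>\<^sub>F n in sequentially. \<bar>c * h s - r n * h (q n)\<bar> < e / 2"
      using insert.prems by (intro order_tendstoD) auto
    with ev1 have "\<forall>\<^sub>F n in sequentially. nrm (g n) < e / 2 \<and> \<bar>c * h s - r n * h (q n)\<bar> < e / 2"
      by eventually_elim simp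
    then obtain n where n: "nrm (g n) < e / 2" "\<bar>c * h s - r n * h (q n)\<bar> < e / 2"
      by (auto simp: eventually_sequentially)
    define b' where "b' = (\<lambda>x. b x + r n * unit_coeff (q n) x)"
    have "b' \<in> rat_coeffs"
      unfolding b'_def by (intro rat_coeffs_add b r q)
    moreover have "nrm (\<lambda>x. a x - b' x) < e"
    proof -
      have "(\<lambda>x. a x - b' x) = (\<lambda>x. (a' x - b x) + g n x)"
        by (auto simp: a_eq b'_def g_def)
      then have "nrm (\<lambda>x. a x - b' x) \<le> nrm (\<lambda>x. a' x - b x) + nrm (g n)"
        using nrm_triangle[OF coeffs_on_diff[OF ca' cb] cg] by simp
      with b(2) n(1) show ?thesis by simp
    qed
    moreover have "\<bar>coeff_lin a h - coeff_lin b' h\<bar> < e"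
    proof -
      have "coeff_lin a h = coeff_lin a' h + c * h s"
        unfolding a_eq using coeff_lin_lincomb[OF coeffs_onD(1)[OF ca'] coeffs_onD(1)[OF us]] by (simp add: coeff_lin_unit)
      moreover have "coeff_lin b' h = coeff_lin b h + r n * h (q n)"
        unfolding b'_def using coeff_lin_lincomb[OF coeffs_onD(1)[OF cb] coeffs_onD(1)[OF uq]] by (simp add: coeff_lin_unit)
      ultimately show ?thesis using b(3) n(2) by linarith
    qed
    ultimately show ?case by blast
  qed
  from this[OF coeffs_onD(1)[OF a] order_refl _ \<open>0 < e\<close>] show ?thesis
    using coeffs_onD(2)[OF a] that by blast
qed

end

section \<open>Convergence and cluster sets of paths\<close>

lemma mspace_C_space: "f \<in> mspace (C_space T) \<longleftrightarrow> f \<in> extensional {0..T} \<and> continuous_on {0..T} f"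
  unfolding C_space_def by (subst compactin_mspace_cfunspace) (auto simp: mtopology_of_euclidean)

lemma mdist_C_space_le:
  assumes "0 \<le> T" "f \<in> mspace (C_space T)" "g \<in> mspace (C_space T)"
  shows "mdist (C_space T) f g \<le> e \<longleftrightarrow> (\<forall>t\<in>{0..T}. \<bar>f t - g t\<bar> \<le> e)"
  using assms cfunspace_mdist_le[of f "top_of_set {0..T}" euclidean_metric g e]
  unfolding C_space_def by (auto simp: dist_real_def)

lemma limitin_C_space:
  "limitin (mtopology_of (C_space T)) z x sequentially \<longleftrightarrow>
    x \<in> mspace (C_space T) \<and> (\<forall>e>0. \<forall>\<^sub>F n in sequentially. z n \<in> mspace (C_space T) \<and> mdist (C_space T) (z n) x < e)"
  unfolding mtopology_of_def by (rule Metric_space.limitin_metric[OF Metric_space_mspace_mdist])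

text \<open>The equicontinuity sets in at an index depending on \<open>e\<close>. It replaces both
  hypotheses of the classical theorem: chaining from the common value at 0 gives the uniform bound,
  and the finitely many early functions are covered by their own continuity.\<close>

lemma asymptotic_Arzela_Ascoli:
  fixes z :: "nat \<Rightarrow> real \<Rightarrow> real" and T :: real
  assumes T: "T > 0" and cont: "\<And>n. continuous_on {0..T} (z n)" and z0: "\<And>n. z n 0 = 0"
    and equi: "\<And>e. e > 0 \<Longrightarrow> \<exists>d>0. \<forall>\<^sub>F n in sequentially. \<forall>s\<in>{0..T}. \<forall>t\<in>{0..T}. \<bar>s - t\<bar> \<le> d \<longrightarrow> \<bar>z n s - z n t\<bar> \<le> e"
  obtains g r where "continuous_on {0..T} g" "strict_mono (r :: nat \<Rightarrow> nat)"
    "\<And>e. 0 < e \<Longrightarrow> \<exists>N. \<forall>n\<ge>N. \<forall>t\<in>{0..T}. \<bar>z (r n) t - g t\<bar> < e"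
proof -
  obtain d where d: "d > 0" and "\<forall>\<^sub>F n in sequentially. \<forall>s\<in>{0..T}. \<forall>t\<in>{0..T}. \<bar>s - t\<bar> \<le> d \<longrightarrow> \<bar>z n s - z n t\<bar> \<le> 1"
    using equi[OF zero_less_one] by blast
  then obtain N where "\<forall>n\<ge>N. \<forall>s\<in>{0..T}. \<forall>t\<in>{0..T}. \<bar>s - t\<bar> \<le> d \<longrightarrow> \<bar>z n s - z n t\<bar> \<le> 1"
    unfolding eventually_sequentially by blast
  then have N: "\<bar>z n s - z n t\<bar> \<le> 1" if "n \<ge> N" "s \<in> {0..T}" "t \<in> {0..T}" "\<bar>s - t\<bar> \<le> d" for n s t
    using that by blast
  \<comment> \<open>Enough steps of length at most \<open>d\<close> to reach any point of the
    interval from 0; each changes the value by at most 1.\<close>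
  obtain m :: nat where m: "T / d < real m" using reals_Archimedean2 by blast
  have m0: "m > 0" using m T d by (metis divide_pos_pos gr_zeroI less_asym of_nat_0)
  have bound: "\<bar>z n t\<bar> \<le> real m" if n: "n \<ge> N" and t: "t \<in> {0..T}" for n t
  proof -
    define p where "p i = real i * t / real m" for i
    have step: "\<bar>z n (p (Suc i)) - z n (p i)\<bar> \<le> 1" if "i < m" for i
    proof (rule N[OF n])
      have "real i * t \<le> real m * T" "real (Suc i) * t \<le> real m * T"
        using that t by (intro mult_mono; simp)+
      then show "p (Suc i) \<in> {0..T}" "p i \<in> {0..T}"
        using t m0 by (auto simp: p_def pos_divide_le_eq mult.commute)
      have "p (Suc i) - p i = t / real m"
        by (simp add: p_def diff_divide_distrib[symmetric] algebra_simps)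
      also have "\<dots> \<le> d"
      proof -
        have "t \<le> T" using t by simp
        also have "T \<le> real m * d" using m d by (simp add: pos_divide_less_eq less_imp_le)
        finally show ?thesis using m0 by (simp add: pos_divide_le_eq mult.commute)
      qed
      finally show "\<bar>p (Suc i) - p i\<bar> \<le> d"
        using t by (simp add: p_def divide_right_mono mult_right_mono)
    qed
    have "z n t = z n (p m) - z n (p 0)" using m0 z0 by (simp add: p_def)
    also have "\<dots> = (\<Sum>i<m. z n (p (Suc i)) - z n (p i))"
      by (rule sum_lessThan_telescope[symmetric])
    finally have "\<bar>z n t\<bar> \<le> (\<Sum>i<m. \<bar>z n (p (Suc i)) - z n (p i)\<bar>)" by simp
    also have "\<dots> \<le> (\<Sum>i<m. 1)" using step by (intro sum_mono) auto
    finally show ?thesis by simp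
  qed
  \<comment> \<open>The shift discards the indices to which the uniform bound does not
    apply.\<close>
  define F where "F n = z (n + N)" for n
  have Fb: "norm (F n x) \<le> real m" if "x \<in> {0..T}" for n x
    using bound[of "n + N" x] that by (simp add: F_def)
  have Fe: "\<exists>d>0. \<forall>n y. y \<in> {0..T} \<and> norm (x - y) < d \<longrightarrow> norm (F n x - F n y) < e"
    if x: "x \<in> {0..T}" and e: "0 < e" for x e
  proof -
    have "e / 2 > 0" using e by simp
    obtain d1 where d1: "d1 > 0" and "\<forall>\<^sub>F n in sequentially. \<forall>s\<in>{0..T}. \<forall>t\<in>{0..T}. \<bar>s - t\<bar> \<le> d1 \<longrightarrow> \<bar>z n s - z n t\<bar> \<le> e / 2"
      using equi[OF \<open>e / 2 > 0\<close>] by blast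
    then obtain n1 where "\<forall>n\<ge>n1. \<forall>s\<in>{0..T}. \<forall>t\<in>{0..T}. \<bar>s - t\<bar> \<le> d1 \<longrightarrow> \<bar>z n s - z n t\<bar> \<le> e / 2"
      unfolding eventually_sequentially by blast
    then have n1: "\<bar>z n s - z n t\<bar> \<le> e / 2" if "n \<ge> n1" "s \<in> {0..T}" "t \<in> {0..T}" "\<bar>s - t\<bar> \<le> d1" for n s t
      using that by blast
    have "\<exists>d>0. \<forall>y\<in>{0..T}. dist y x < d \<longrightarrow> dist (F n y) (F n x) < e" for n
      using cont[of "n + N"] x e unfolding F_def continuous_on_iff by blast
    then obtain D where D: "\<And>n. D n > 0" "\<And>n y. y \<in> {0..T} \<Longrightarrow> dist y x < D n \<Longrightarrow> dist (F n y) (F n x) < e"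
      by metis
    define d where "d = Min (insert d1 (D ` {..<n1}))"
    have "d > 0" unfolding d_def using d1 D(1) by (subst Min_gr_iff) auto
    moreover have "norm (F n x - F n y) < e" if y: "y \<in> {0..T}" "norm (x - y) < d" for n y
    proof (cases "n < n1")
      case True
      then have "d \<le> D n" unfolding d_def by (intro Min_le) auto
      then show ?thesis
        using D(2)[OF y(1), of n] y(2) by (simp add: dist_real_def abs_minus_commute)
    next
      case False
      have "d \<le> d1" unfolding d_def by (intro Min_le) auto
      then have "\<bar>F n x - F n y\<bar> \<le> e / 2"
        unfolding F_def using False x y by (intro n1) auto
      with e show ?thesis by simp
    qed
    ultimately show ?thesis by blast
  qed
  obtain g k where g: "continuous_on {0..T} g" and k: "strict_mono (k :: nat \<Rightarrow> nat)"
    and conv: "\<And>e. 0 < e \<Longrightarrow> \<exists>n0. \<forall>n x. n \<ge> n0 \<and> x \<in> {0..T} \<longrightarrow> norm (F (k n) x - g x) < e"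
    by (rule Arzela_Ascoli[of "{0..T}" F "real m"]) (use Fb Fe in auto)
  show ?thesis
  proof (rule that[OF g, of "\<lambda>n. k n + N"])
    show "strict_mono (\<lambda>n. k n + N)" using k by (simp add: strict_mono_def)
    fix e :: real assume "0 < e"
    then obtain n0 where "\<And>n x. n \<ge> n0 \<Longrightarrow> x \<in> {0..T} \<Longrightarrow> norm (F (k n) x - g x) < e"
      using conv by blast
    then show "\<exists>n0. \<forall>n\<ge>n0. \<forall>t\<in>{0..T}. \<bar>z (k n + N) t - g t\<bar> < e"
      by (intro exI[of _ n0]) (auto simp: F_def)
  qed
qed

context gfbm_process
begin

text \<open>
  The path-wise part of the argument.  By \<open>upper\<close> every limit point lies in the ball; by \<open>lower\<close> and
  strict convexity every normalised \<open>kernel_comb\<close> is a limit point, and these are dense in the ball.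
\<close>

context
  fixes z :: "nat \<Rightarrow> real \<Rightarrow> real"
  assumes ext: "\<And>n. z n \<in> extensional {0..T}" and cont: "\<And>n. continuous_on {0..T} (z n)" and z0: "\<And>n. z n 0 = 0"
    and equi: "\<And>e. e > 0 \<Longrightarrow> \<exists>d>0. \<forall>\<^sub>F n in sequentially. \<forall>s\<in>{0..T}. \<forall>t\<in>{0..T}. \<bar>s - t\<bar> \<le> d \<longrightarrow> \<bar>z n s - z n t\<bar> \<le> e"
    and upper: "\<And>a e. a \<in> rat_coeffs \<Longrightarrow> 0 < e \<Longrightarrow> \<forall>\<^sub>F n in sequentially. \<bar>coeff_lin a (z n)\<bar> \<le> nrm a + e"
    and lower: "\<And>a e. a \<in> rat_coeffs \<Longrightarrow> 0 < nrm a \<Longrightarrow> 0 < e \<Longrightarrow> \<exists>\<^sub>F n in sequentially. nrm a - e \<le> coeff_lin a (z n)"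
begin

abbreviation "K \<equiv> rkhs_unit_ball \<Psi> {0..T}"

lemma z_mspace: "z n \<in> mspace (C_space T)"
  by (simp add: mspace_C_space ext cont)

lemma K_mspace: "h \<in> K \<Longrightarrow> h \<in> mspace (C_space T)"
  by (simp add: mspace_C_space rkhs_unit_ball_continuous rkhs_unit_ball_extensional)

lemma mdist_le_iff:
  "x \<in> mspace (C_space T) \<Longrightarrow> g \<in> mspace (C_space T) \<Longrightarrow>
    mdist (C_space T) x g \<le> e \<longleftrightarrow> (\<forall>t\<in>{0..T}. \<bar>x t - g t\<bar> \<le> e)"
  using T by (intro mdist_C_space_le) auto

text \<open>The limit inherits \<open>upper\<close> for rational functionals. Being continuous, it
  satisfies the bound for all functionals by \<open>rat_coeffs_dense\<close>, which puts it in the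
  ball.\<close>

lemma compactness:
  assumes r: "strict_mono (r :: nat \<Rightarrow> nat)"
  shows "\<exists>(r' :: nat \<Rightarrow> nat) g. strict_mono r' \<and> g \<in> K \<and>
    (\<forall>e>0. \<exists>n0. \<forall>n\<ge>n0. \<forall>t\<in>{0..T}. \<bar>z (r (r' n)) t - g t\<bar> < e)"
proof -
  have equi': "\<exists>d>0. \<forall>\<^sub>F n in sequentially. \<forall>s\<in>{0..T}. \<forall>t\<in>{0..T}. \<bar>s - t\<bar> \<le> d \<longrightarrow> \<bar>z (r n) s - z (r n) t\<bar> \<le> e"
    if e: "e > 0" for e
  proof -
    obtain d where d: "d > 0" "\<forall>\<^sub>F n in sequentially. \<forall>s\<in>{0..T}. \<forall>t\<in>{0..T}. \<bar>s - t\<bar> \<le> d \<longrightarrow> \<bar>z n s - z n t\<bar> \<le> e"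
      using equi[OF e] by blast
    from eventually_subseq[OF r d(2)] d(1) show ?thesis by blast
  qed
  obtain g0 r' where g0: "continuous_on {0..T} g0" and r': "strict_mono (r' :: nat \<Rightarrow> nat)"
    and conv0: "\<And>e. 0 < e \<Longrightarrow> \<exists>n0. \<forall>n\<ge>n0. \<forall>t\<in>{0..T}. \<bar>z (r (r' n)) t - g0 t\<bar> < e"
    by (rule asymptotic_Arzela_Ascoli[of T "\<lambda>n. z (r n)"]) (use T cont z0 equi' in auto)
  define g where "g = restrict g0 {0..T}"
  have conv: "\<exists>n0. \<forall>n\<ge>n0. \<forall>t\<in>{0..T}. \<bar>z (r (r' n)) t - g t\<bar> < e" if "0 < e" for e
    using conv0[OF that] by (simp add: g_def)
  have g: "continuous_on {0..T} g" by (rule continuous_on_eq[OF g0]) (simp add: g_def)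
  have pw: "(\<lambda>n. z (r (r' n)) t) \<longlonglongrightarrow> g t" if "t \<in> {0..T}" for t
    unfolding LIMSEQ_iff using conv that by (metis real_norm_def)
  have rat: "\<bar>coeff_lin a g\<bar> \<le> nrm a" if a: "a \<in> rat_coeffs" for a
  proof (rule field_le_epsilon)
    fix e :: real assume "0 < e"
    have "(\<lambda>n. coeff_lin a (z (r (r' n)))) \<longlonglongrightarrow> coeff_lin a g"
      unfolding coeff_lin_def using coeffs_onD(2)[OF rat_coeffs_subset[OF a]]
      by (intro tendsto_sum tendsto_mult tendsto_const pw) auto
    then have lim: "(\<lambda>n. \<bar>coeff_lin a (z (r (r' n)))\<bar>) \<longlonglongrightarrow> \<bar>coeff_lin a g\<bar>"
      by (rule tendsto_rabs)
    have "\<forall>\<^sub>F n in sequentially. \<bar>coeff_lin a (z (r (r' n)))\<bar> \<le> nrm a + e"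
      using eventually_subseq[OF strict_mono_o[OF r r'] upper[OF a \<open>0 < e\<close>]] by (simp add: comp_def)
    then show "\<bar>coeff_lin a g\<bar> \<le> nrm a + e"
      by (intro tendsto_upperbound[OF lim]) auto
  qed
  have "g \<in> K"
  proof (rule rkhs_unit_ballI)
    show "g \<in> extensional {0..T}" by (simp add: g_def)
    fix b assume b: "b \<in> coeffs_on {0..T}"
    show "\<bar>coeff_lin b g\<bar> \<le> nrm b"
    proof (rule field_le_epsilon)
      fix e :: real assume "0 < e"
      then have "e / 2 > 0" by simp
      obtain a where a: "a \<in> rat_coeffs" "nrm (\<lambda>s. b s - a s) < e / 2" "\<bar>coeff_lin b g - coeff_lin a g\<bar> < e / 2"
        by (rule rat_coeffs_dense[OF g b \<open>e / 2 > 0\<close>])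
      show "\<bar>coeff_lin b g\<bar> \<le> nrm b + e"
        using a rat[OF a(1)] nrm_diff_le[OF b rat_coeffs_subset[OF a(1)]] by linarith
    qed
  qed
  with r' conv show ?thesis by blast
qed

lemma mdist_to_set_le:
  assumes "h \<in> K"
  shows "0 \<le> mdist_to_set (C_space T) x K" "mdist_to_set (C_space T) x K \<le> mdist (C_space T) x h"
proof -
  have "bdd_below ((\<lambda>h. mdist (C_space T) x h) ` K)"
    by (rule bdd_belowI2[of _ 0]) simp
  then show "mdist_to_set (C_space T) x K \<le> mdist (C_space T) x h"
    unfolding mdist_to_set_def by (rule cINF_lower[OF _ assms])
  show "0 \<le> mdist_to_set (C_space T) x K"
    unfolding mdist_to_set_def using assms by (intro cINF_greatest) auto
qed

text \<open>A subsequence staying away from the ball would have a further subsequence converging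
  into it.\<close>

lemma dist_tendsto: "(\<lambda>n. mdist_to_set (C_space T) (z n) K) \<longlonglongrightarrow> 0"
proof (rule ccontr)
  obtain h where h: "h \<in> K"
    using compactness[OF strict_mono_id] by blast
  assume "\<not> ?thesis"
  then obtain e where e: "e > 0" "\<And>n0. \<exists>n\<ge>n0. \<not> mdist_to_set (C_space T) (z n) K < e"
    unfolding LIMSEQ_def dist_real_def using mdist_to_set_le(1)[OF h] by auto
  have "infinite {n. \<not> mdist_to_set (C_space T) (z n) K < e}"
    unfolding infinite_nat_iff_unbounded_le using e(2) by blast
  from infinite_enumerate[OF this] obtain r :: "nat \<Rightarrow> nat" where r: "strict_mono r"
    and "\<forall>n. r n \<in> {n. \<not> mdist_to_set (C_space T) (z n) K < e}" by blast
  then have far: "\<not> mdist_to_set (C_space T) (z (r n)) K < e" for n by blast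
  obtain r' :: "nat \<Rightarrow> nat" and g where g: "g \<in> K" and conv: "\<forall>e>0. \<exists>n0. \<forall>n\<ge>n0. \<forall>t\<in>{0..T}. \<bar>z (r (r' n)) t - g t\<bar> < e"
    using compactness[OF r] by blast
  obtain n where "\<forall>t\<in>{0..T}. \<bar>z (r (r' n)) t - g t\<bar> < e / 2"
    using conv[rule_format, of "e / 2"] e(1) by auto
  then have "mdist (C_space T) (z (r (r' n))) g \<le> e / 2"
    by (subst mdist_le_iff[OF z_mspace K_mspace[OF g]]) (auto intro: less_imp_le)
  with mdist_to_set_le(2)[OF g, of "z (r (r' n))"] far[of "r' n"] e(1) show False by simp
qed

lemma frequently_near_imp_cluster:
  assumes h: "h \<in> mspace (C_space T)"
    and near: "\<And>e m. 0 < e \<Longrightarrow> \<exists>n>m. \<forall>t\<in>{0..T}. \<bar>z n t - h t\<bar> \<le> e"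
  shows "h \<in> cluster_set (C_space T) z"
proof -
  have "\<exists>n>m. \<forall>t\<in>{0..T}. \<bar>z n t - h t\<bar> \<le> 1 / real (Suc i)" for m i
    by (rule near) simp
  then have "\<forall>m i. \<exists>n. n > m \<and> (\<forall>t\<in>{0..T}. \<bar>z n t - h t\<bar> \<le> 1 / real (Suc i))" by blast
  then obtain p where p: "\<And>m i. p m i > m"
    "\<And>m i. \<forall>t\<in>{0..T}. \<bar>z (p m i) t - h t\<bar> \<le> 1 / real (Suc i)" by metis
  define r where "r = rec_nat (p 0 0) (\<lambda>i m. p m (Suc i))"
  have r: "r 0 = p 0 0" "r (Suc i) = p (r i) (Suc i)" for i by (simp_all add: r_def)
  have mono: "strict_mono r"
    unfolding strict_mono_Suc_iff using r p(1) by simp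
  have near_r: "\<bar>z (r i) t - h t\<bar> \<le> 1 / real (Suc i)" if "t \<in> {0..T}" for i t
  proof (cases i)
    case 0
    then show ?thesis using p(2)[of 0 0] that r(1) by simp
  next
    case (Suc n)
    then show ?thesis using p(2)[of "r n" "Suc n"] that r(2) by simp
  qed
  have "limitin (mtopology_of (C_space T)) (z \<circ> r) h sequentially"
    unfolding limitin_C_space
  proof (intro conjI allI impI h)
    fix e :: real assume "0 < e"
    have "(\<lambda>i. 1 / real (Suc i)) \<longlonglongrightarrow> 0" by real_asymp
    then have "\<forall>\<^sub>F i in sequentially. 1 / real (Suc i) < e" using \<open>0 < e\<close> by (rule order_tendstoD)
    then show "\<forall>\<^sub>F n in sequentially. (z \<circ> r) n \<in> mspace (C_space T) \<and> mdist (C_space T) ((z \<circ> r) n) h < e"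
    proof eventually_elim
      case (elim i)
      have "mdist (C_space T) (z (r i)) h \<le> 1 / real (Suc i)"
        using near_r by (subst mdist_le_iff[OF z_mspace h]) auto
      with elim show ?case by (simp add: z_mspace)
    qed
  qed
  with mono show ?thesis unfolding cluster_set_def by blast
qed

lemma near_normalized_comb:
  assumes b: "b \<in> rat_coeffs" "0 < nrm b" and e: "0 < e"
  shows "\<exists>n>m. \<forall>t\<in>{0..T}. \<bar>z n t - comb b t / nrm b\<bar> \<le> e"
proof -
  note cb = rat_coeffs_subset[OF b(1)]
  have "\<exists>n>k. nrm b - 1 / real (Suc i) \<le> coeff_lin b (z n)" for k i
  proof -
    have "\<exists>\<^sub>F n in sequentially. nrm b - 1 / real (Suc i) \<le> coeff_lin b (z n)"
      using b by (intro lower) auto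
    then show ?thesis
      unfolding frequently_def eventually_sequentially by (metis Suc_le_eq)
  qed
  then have "\<forall>k i. \<exists>n. n > k \<and> nrm b - 1 / real (Suc i) \<le> coeff_lin b (z n)" by blast
  then obtain p where p: "\<And>k i. p k i > k"
    "\<And>k i. nrm b - 1 / real (Suc i) \<le> coeff_lin b (z (p k i))" by metis
  define r where "r = rec_nat (p m 0) (\<lambda>i k. p k (Suc i))"
  have r: "r 0 = p m 0" "r (Suc i) = p (r i) (Suc i)" for i by (simp_all add: r_def)
  have mono: "strict_mono r"
    unfolding strict_mono_Suc_iff using r p(1) by simp
  have rm: "r i > m" for i
    using p(1) r by (induction i) (auto intro: less_trans)
  have low: "nrm b - 1 / real (Suc i) \<le> coeff_lin b (z (r i))" for i
  proof (cases i)
    case 0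
    then show ?thesis using p(2)[of 0 m] r(1) by simp
  next
    case (Suc n)
    then show ?thesis using p(2)[of "Suc n" "r n"] r(2) by simp
  qed
  obtain r' :: "nat \<Rightarrow> nat" and g where r': "strict_mono r'" and g: "g \<in> K"
    and conv: "\<forall>e>0. \<exists>n0. \<forall>n\<ge>n0. \<forall>t\<in>{0..T}. \<bar>z (r (r' n)) t - g t\<bar> < e"
    using compactness[OF mono] by blast
  have pw: "(\<lambda>n. z (r (r' n)) t) \<longlonglongrightarrow> g t" if "t \<in> {0..T}" for t
    unfolding LIMSEQ_iff using conv that by (metis real_norm_def)
  have lim1: "(\<lambda>n. coeff_lin b (z (r (r' n)))) \<longlonglongrightarrow> coeff_lin b g"
    unfolding coeff_lin_def using coeffs_onD(2)[OF cb]
    by (intro tendsto_sum tendsto_mult tendsto_const pw) auto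
  have "(\<lambda>i. 1 / real (Suc i)) \<longlonglongrightarrow> 0" by real_asymp
  then have "(\<lambda>i. nrm b - 1 / real (Suc i)) \<longlonglongrightarrow> nrm b - 0" by (intro tendsto_intros)
  then have "(\<lambda>i. nrm b - 1 / real (Suc i)) \<longlonglongrightarrow> nrm b" by simp
  then have lim2: "(\<lambda>n. nrm b - 1 / real (Suc (r' n))) \<longlonglongrightarrow> nrm b"
    using LIMSEQ_subseq_LIMSEQ[OF _ r'] by (simp add: comp_def)
  have "nrm b \<le> coeff_lin b g"
    by (rule LIMSEQ_le[OF lim2 lim1]) (use low in auto)
  then have g_eq: "g t = comb b t / nrm b" if "t \<in> {0..T}" for t
    using rkhs_unit_ball_peak[OF g cb _ that] b(2) by (simp add: field_simps)
  obtain n where "\<forall>t\<in>{0..T}. \<bar>z (r (r' n)) t - g t\<bar> < e"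
    using conv[rule_format, OF e] by blast
  then show ?thesis
    using rm[of "r' n"] g_eq by (intro exI[of _ "r (r' n)"]) (auto intro: less_imp_le)
qed

lemma comb_bound: "a \<in> coeffs_on {0..T} \<Longrightarrow> t \<in> {0..T} \<Longrightarrow> \<bar>comb a t\<bar> \<le> nrm a * (T powr H * sqrt (Q 1 1))"
proof -
  assume a: "a \<in> coeffs_on {0..T}" and t: "t \<in> {0..T}"
  have "\<bar>comb a t\<bar> \<le> nrm a * sqrt (Q t t)"
    using comb_le[OF a t] by (simp add: \<Psi>_eq_Q[OF t t])
  also have "sqrt (Q t t) = t powr H * sqrt (Q 1 1)"
    using t by (intro sqrt_Q_diag) auto
  also have "nrm a * (t powr H * sqrt (Q 1 1)) \<le> nrm a * (T powr H * sqrt (Q 1 1))"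
    using t H nrm_nonneg[OF a]
    by (intro mult_left_mono mult_right_mono powr_mono2) (auto simp: Q_diag_nonneg)
  finally show ?thesis .
qed

text \<open>A chain of five moves, each costing at most \<open>e / 8\<close>: from \<open>h\<close>
  to the span, into the unit ball by scaling, to the sphere, to rational coefficients and back to
  norm 1.\<close>

lemma ball_near_normalized_comb:
  assumes Q1: "Q 1 1 > 0" and h: "h \<in> K" and e: "0 < e"
  shows "\<exists>b\<in>rat_coeffs. 0 < nrm b \<and> (\<forall>t\<in>{0..T}. \<bar>h t - comb b t / nrm b\<bar> \<le> e)"
proof -
  define C where "C = T powr H * sqrt (Q 1 1)"
  have C: "C > 0" using T Q1 by (simp add: C_def)
  \<comment> \<open>\<open>C\<close> bounds the sup norm of an element of norm 1, so norm errors of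
    size \<open>d\<close> cost at most \<open>e / 8\<close>. The bound 1/2 keeps
    \<open>nrm c\<close> away from 0.\<close>
  define d where "d = min (1 / 2) (e / (8 * C))"
  have d: "0 < d" "d \<le> 1 / 2" "d * C \<le> e / 8"
  proof -
    show "0 < d" "d \<le> 1 / 2" using e C by (auto simp: d_def)
    have "d \<le> e / (8 * C)" by (simp add: d_def)
    then have "d * C \<le> e / (8 * C) * C" using C by (intro mult_right_mono) auto
    then show "d * C \<le> e / 8" using C by simp
  qed
  obtain a where a: "a \<in> coeffs_on {0..T}" "nrm a \<le> 1 + d" "\<And>t. t \<in> {0..T} \<Longrightarrow> \<bar>h t - comb a t\<bar> \<le> d * sqrt (\<Psi> t t)"
    by (rule rkhs_unit_ball_approx[OF h d(1)]) blast
  define a' where "a' = (\<lambda>s. 1 / (1 + d) * a s)"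
  have ca': "a' \<in> coeffs_on {0..T}" unfolding a'_def by (rule coeffs_on_scale[OF a(1)])
  have na': "nrm a' \<le> 1"
    unfolding a'_def nrm_scale[OF a(1)] using a(2) d(1) by (simp add: divide_le_eq)
  have "e / 8 > 0" using e by simp
  obtain b where b: "b \<in> coeffs_on {0..T}" "nrm b = 1" "\<And>v. v \<in> {0..T} \<Longrightarrow> \<bar>comb a' v - comb b v\<bar> \<le> e / 8"
    by (rule sphere_approx[OF Q1 ca' na' \<open>e / 8 > 0\<close>]) blast
  obtain c where c: "c \<in> rat_coeffs" "nrm (\<lambda>s. b s - c s) < d"
    by (rule rat_coeffs_dense[OF continuous_on_const b(1) d(1)]) blast
  note cc = rat_coeffs_subset[OF c(1)]
  have nc: "\<bar>1 - nrm c\<bar> < d" using nrm_diff_le[OF b(1) cc] c(2) b(2) by simp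
  then have nc_pos: "1 / 2 < nrm c" using d(2) by linarith
  have "\<bar>h t - comb c t / nrm c\<bar> \<le> e" if t: "t \<in> {0..T}" for t
  proof -
    have 1: "\<bar>h t - comb a t\<bar> \<le> e / 8"
    proof -
      have "sqrt (\<Psi> t t) = t powr H * sqrt (Q 1 1)"
        using t by (simp add: \<Psi>_eq_Q sqrt_Q_diag[of t])
      also have "\<dots> \<le> C"
        unfolding C_def using t H by (intro mult_right_mono powr_mono2) (auto simp: Q_diag_nonneg)
      finally have "d * sqrt (\<Psi> t t) \<le> d * C" using d by (intro mult_left_mono) auto
      then show ?thesis using a(3)[OF t] d(3) by linarith
    qed
    have 2: "\<bar>comb a t - comb a' t\<bar> \<le> e / 8"
    proof -
      have "comb a t - comb a' t = d * comb a' t"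
        using d(1) unfolding a'_def comb_scale[OF a(1)] by (simp add: field_simps)
      then have "\<bar>comb a t - comb a' t\<bar> = d * \<bar>comb a' t\<bar>" using d(1) by (simp add: abs_mult)
      also have "\<dots> \<le> d * (nrm a' * C)" unfolding C_def using d(1) by (intro mult_left_mono comb_bound ca' t) auto
      also have "\<dots> \<le> d * (1 * C)" using d(1) C na' by (intro mult_left_mono mult_right_mono) auto
      finally show ?thesis using d(3) by simp
    qed
    have 3: "\<bar>comb b t - comb c t\<bar> \<le> e / 8"
    proof -
      have "\<bar>comb b t - comb c t\<bar> \<le> nrm (\<lambda>s. b s - c s) * C"
        using comb_bound[OF coeffs_on_diff[OF b(1) cc] t] by (simp add: comb_diff b(1) cc C_def)
      also have "\<dots> \<le> d * C" using c(2) C by (intro mult_right_mono) auto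
      finally show ?thesis using d(3) by simp
    qed
    have 4: "\<bar>comb c t - comb c t / nrm c\<bar> \<le> e / 8"
    proof -
      have "comb c t - comb c t / nrm c = (nrm c - 1) * (comb c t / nrm c)"
        using nc_pos by (simp add: field_simps)
      moreover have "\<bar>comb c t / nrm c\<bar> \<le> C"
        using comb_bound[OF cc t] nc_pos by (simp add: abs_divide pos_divide_le_eq C_def mult.commute)
      moreover have "\<bar>nrm c - 1\<bar> \<le> d" using nc by linarith
      ultimately have "\<bar>comb c t - comb c t / nrm c\<bar> \<le> d * C"
        unfolding abs_mult using d(1) by (simp only: abs_mult) (intro mult_mono; simp)
      then show ?thesis using d(3) by simp
    qed
    show ?thesis using 1 2 b(3)[OF t] 3 4 e by linarith
  qed
  with c(1) nc_pos show ?thesis by (intro bexI[of _ c]) auto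
qed

lemma cluster_subset: "cluster_set (C_space T) z \<subseteq> K"
proof
  fix x assume "x \<in> cluster_set (C_space T) z"
  then obtain r where r: "strict_mono r" and lim: "limitin (mtopology_of (C_space T)) (z \<circ> r) x sequentially"
    unfolding cluster_set_def by blast
  have x: "x \<in> mspace (C_space T)" using lim unfolding limitin_C_space by blast
  obtain r' :: "nat \<Rightarrow> nat" and g where r': "strict_mono r'" and g: "g \<in> K"
    and conv: "\<forall>e>0. \<exists>n0. \<forall>n\<ge>n0. \<forall>t\<in>{0..T}. \<bar>z (r (r' n)) t - g t\<bar> < e"
    using compactness[OF r] by blast
  have "x t = g t" if t: "t \<in> {0..T}" for t
  proof (rule LIMSEQ_unique)
    show "(\<lambda>n. z (r (r' n)) t) \<longlonglongrightarrow> g t"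
      unfolding LIMSEQ_iff using conv t by (metis real_norm_def)
    have "(\<lambda>n. z (r n) t) \<longlonglongrightarrow> x t"
      unfolding LIMSEQ_iff eventually_sequentially[symmetric]
    proof (intro allI impI)
      fix e :: real assume "0 < e"
      then have "\<forall>\<^sub>F n in sequentially. mdist (C_space T) (z (r n)) x < e"
        using lim unfolding limitin_C_space by (auto elim: eventually_mono)
      then show "\<forall>\<^sub>F n in sequentially. norm (z (r n) t - x t) < e"
      proof eventually_elim
        case (elim n)
        then show ?case
          using mdist_le_iff[OF z_mspace x, of "r n" "mdist (C_space T) (z (r n)) x"] t by force
      qed
    qed
    then show "(\<lambda>n. z (r (r' n)) t) \<longlonglongrightarrow> x t"
      using LIMSEQ_subseq_LIMSEQ[OF _ r'] by (force simp: comp_def)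
  qed
  moreover have "x \<in> extensional {0..T}" "g \<in> extensional {0..T}"
    using x g by (simp_all add: mspace_C_space rkhs_unit_ball_extensional)
  ultimately have "x = g" by (intro extensionalityI)
  with g show "x \<in> K" by simp
qed

text \<open>By scaling all variances vanish, so the sphere is empty and the density argument has
  nothing to start from; the ball contains only the zero function.\<close>

lemma degenerate_ball:
  assumes "Q 1 1 = 0" "h \<in> K" "t \<in> {0..T}"
  shows "h t = 0"
proof -
  have "\<bar>coeff_lin (unit_coeff t) h\<bar> \<le> nrm (unit_coeff t)"
    by (rule rkhs_unit_ball_bound[OF assms(2) coeffs_on_unit[OF assms(3)]])
  moreover have "Q t t = 0" using Q_diag[of t] assms by simp
  ultimately show ?thesis
    by (simp add: coeff_lin_unit kernel_norm_def ip_unit_unit \<Psi>_eq_Q[OF assms(3,3)])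
qed

lemma cluster_eq: "cluster_set (C_space T) z = K"
proof (intro equalityI cluster_subset subsetI)
  fix h assume h: "h \<in> K"
  show "h \<in> cluster_set (C_space T) z"
  proof (rule frequently_near_imp_cluster[OF K_mspace[OF h]])
    fix e :: real and m :: nat assume e: "0 < e"
    show "\<exists>n>m. \<forall>t\<in>{0..T}. \<bar>z n t - h t\<bar> \<le> e"
    proof (cases "Q 1 1 = 0")
      case True
      obtain r' :: "nat \<Rightarrow> nat" and g where r': "strict_mono r'" and g: "g \<in> K"
        and conv: "\<forall>e>0. \<exists>n0. \<forall>n\<ge>n0. \<forall>t\<in>{0..T}. \<bar>z (id (r' n)) t - g t\<bar> < e"
        using compactness[OF strict_mono_id] by blast
      obtain n0 where n0: "\<forall>n\<ge>n0. \<forall>t\<in>{0..T}. \<bar>z (id (r' n)) t - g t\<bar> < e"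
        using conv e by blast
      have "r' (Suc (max n0 m)) > m"
        using seq_suble[OF r', of "Suc (max n0 m)"] by simp
      moreover have "\<bar>z (r' (Suc (max n0 m))) t - h t\<bar> \<le> e" if t: "t \<in> {0..T}" for t
      proof -
        have "\<bar>z (id (r' (Suc (max n0 m)))) t - g t\<bar> < e"
          using n0 t by simp
        then show ?thesis
          using degenerate_ball[OF True h t] degenerate_ball[OF True g t] by simp
      qed
      ultimately show ?thesis by blast
    next
      case False
      then have Q1: "Q 1 1 > 0" using Q_diag_nonneg[of 1] by simp
      have e2: "e / 2 > 0" using e by simp
      obtain b where b: "b \<in> rat_coeffs" "0 < nrm b" "\<forall>t\<in>{0..T}. \<bar>h t - comb b t / nrm b\<bar> \<le> e / 2"
        using ball_near_normalized_comb[OF Q1 h e2] by blast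
      obtain n where n: "n > m" "\<forall>t\<in>{0..T}. \<bar>z n t - comb b t / nrm b\<bar> \<le> e / 2"
        using near_normalized_comb[OF b(1,2) e2] by blast
      have "\<bar>z n t - h t\<bar> \<le> e" if t: "t \<in> {0..T}" for t
        using bspec[OF b(3) t] bspec[OF n(2) t] by linarith
      with n(1) show ?thesis by blast
    qed
  qed
qed

end

end

section \<open>The functional law of the iterated logarithm\<close>

text \<open>Take the least \<open>k\<close> with \<open>r \<le> l ^ k\<close>; large
  \<open>r\<close> forces it past the index from which \<open>P\<close> holds.\<close>

lemma power_bracket:
  fixes l :: real
  assumes l: "1 < l" and P: "\<forall>\<^sub>F k in sequentially. P k"
  shows "\<forall>\<^sub>F r in at_top. \<exists>k. P k \<and> r \<le> l ^ k \<and> l ^ k \<le> l * r"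
proof -
  obtain k0 where k0: "\<And>k. k \<ge> k0 \<Longrightarrow> P k"
    using P by (auto simp: eventually_sequentially)
  have "\<forall>\<^sub>F r in at_top. l ^ k0 < r \<and> 1 < r"
    by (intro eventually_conj eventually_gt_at_top)
  then show ?thesis
  proof eventually_elim
    case (elim r)
    obtain k where "r \<le> l ^ k" using real_arch_pow[OF l, of r] less_imp_le by blast
    then obtain k where k: "r \<le> l ^ k" "\<And>i. i < k \<Longrightarrow> \<not> r \<le> l ^ i"
      using exists_least_iff[of "\<lambda>k. r \<le> l ^ k"] by blast
    have "l ^ k0 < l ^ k" using elim k(1) by linarith
    then have "k0 \<le> k" using l by (simp add: power_strict_increasing_iff)
    moreover have "l ^ k \<le> l * r"
    proof (cases k)
      case 0
      then show ?thesis using k(1) elim by simp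
    next
      case (Suc i)
      then have "l ^ i \<le> r" using k(2)[of i] by simp
      then show ?thesis using Suc l by simp
    qed
    ultimately show ?case using k0 k(1) by blast
  qed
qed

context gfbm_process
begin

lemma norming_pos: "exp 1 < r \<Longrightarrow> 0 < norming r"
proof -
  assume r: "exp 1 < r"
  then have "0 < r" by (meson exp_gt_zero less_trans)
  then have "1 < ln r" using r \<open>0 < r\<close> ln_less_cancel_iff[of "exp 1" r] by simp
  then have "0 < sqrt (2 * ln (ln r))" by simp
  moreover have "0 < r powr H" using \<open>0 < r\<close> by simp
  ultimately show ?thesis unfolding norming_def by (rule mult_pos_pos[rotated])
qed

text \<open>The power contributes \<open>l powr H\<close> exactly, and the quotient of the iterated
  logarithms tends to 1, so any \<open>c > 1\<close> absorbs it.\<close>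

lemma norming_ratio:
  assumes l: "1 < l" and c: "1 < c"
  shows "\<forall>\<^sub>F r in at_top. 0 < norming r \<and> (\<forall>R. r \<le> R \<and> R \<le> l * r \<longrightarrow> 0 < norming R \<and> norming R \<le> l powr H * c * norming r)"
proof -
  have "((\<lambda>r. ln (ln (l * r)) / ln (ln r)) \<longlongrightarrow> 1) at_top"
    using l by real_asymp
  moreover have "1 < c\<^sup>2" using c by simp
  ultimately have "\<forall>\<^sub>F r in at_top. ln (ln (l * r)) / ln (ln r) < c\<^sup>2"
    by (rule order_tendstoD)
  then show ?thesis
    using eventually_gt_at_top[of "exp 1"]
  proof eventually_elim
    case (elim r)
    have r0: "0 < r" using elim(2) by (meson exp_gt_zero less_trans)
    have lr: "1 < ln r" using elim(2) r0 ln_less_cancel_iff[of "exp 1" r] by simp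
    then have "0 < ln (ln r)" by simp
    then have "ln (ln (l * r)) \<le> c\<^sup>2 * ln (ln r)"
      using elim(1) by (simp add: divide_less_eq)
    then have "sqrt (2 * ln (ln (l * r))) \<le> sqrt (c\<^sup>2 * (2 * ln (ln r)))"
      by (intro real_sqrt_le_mono) simp
    then have sq: "sqrt (2 * ln (ln (l * r))) \<le> c * sqrt (2 * ln (ln r))"
      using c by (simp add: real_sqrt_mult)
    have "0 < norming R \<and> norming R \<le> l powr H * c * norming r" if R: "r \<le> R" "R \<le> l * r" for R
    proof
      show "0 < norming R" using elim(2) R by (intro norming_pos) simp
      have "ln r \<le> ln R" "ln R \<le> ln (l * r)" using r0 R by auto
      then have "ln (ln R) \<le> ln (ln (l * r))" "0 \<le> ln (ln R)" using lr by auto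
      then have "norming R \<le> (l * r) powr H * sqrt (2 * ln (ln (l * r)))"
        unfolding norming_def using r0 R H by (intro mult_mono powr_mono2 real_sqrt_le_mono) auto
      also have "\<dots> \<le> (l * r) powr H * (c * sqrt (2 * ln (ln r)))"
        by (intro mult_left_mono sq) simp
      also have "\<dots> = l powr H * c * norming r"
        using l r0 by (simp add: norming_def powr_mult)
      finally show "norming R \<le> l powr H * c * norming r" .
    qed
    with norming_pos[OF elim(2)] show ?case by blast
  qed
qed

text \<open>Bracketing from above writes \<open>r = 2 ^ k * x\<close> with \<open>x \<le> 1\<close>.
  Times \<open>r * s\<close> are then \<open>2 ^ k * (x * s)\<close>, where \<open>x * s\<close>
  stays in the interval and pairs of times only come closer. The divisor in \<open>e'\<close> pays
  for the quotient of the two normings.\<close>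

lemma modulus_all_scales:
  assumes dyadic: "\<forall>e>0. \<exists>d>0. \<forall>\<^sub>F k in sequentially. \<forall>s\<in>{0..T}. \<forall>t\<in>{0..T}. \<bar>s - t\<bar> \<le> d \<longrightarrow>
     \<bar>X (2 ^ k * s) \<omega> - X (2 ^ k * t) \<omega>\<bar> \<le> e * norming (2 ^ k)" and e: "0 < e"
  shows "\<exists>d>0. \<forall>\<^sub>F r in at_top. \<forall>s\<in>{0..T}. \<forall>t\<in>{0..T}. \<bar>s - t\<bar> \<le> d \<longrightarrow>
     \<bar>X (r * s) \<omega> - X (r * t) \<omega>\<bar> \<le> e * norming r"
proof -
  define e' where "e' = e / (2 powr H * 2)"
  have e': "e' > 0" using e by (simp add: e'_def)
  obtain d where d: "d > 0" and ev: "\<forall>\<^sub>F k in sequentially. \<forall>s\<in>{0..T}. \<forall>t\<in>{0..T}. \<bar>s - t\<bar> \<le> d \<longrightarrow>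
     \<bar>X (2 ^ k * s) \<omega> - X (2 ^ k * t) \<omega>\<bar> \<le> e' * norming (2 ^ k)"
    using dyadic e' by blast
  have "\<forall>\<^sub>F r in at_top. \<forall>s\<in>{0..T}. \<forall>t\<in>{0..T}. \<bar>s - t\<bar> \<le> d \<longrightarrow> \<bar>X (r * s) \<omega> - X (r * t) \<omega>\<bar> \<le> e * norming r"
    using power_bracket[of 2, OF _ ev, simplified] norming_ratio[of 2 2, simplified] eventually_gt_at_top[of 0]
  proof eventually_elim
    case (elim r)
    then obtain k where k: "\<forall>s\<in>{0..T}. \<forall>t\<in>{0..T}. \<bar>s - t\<bar> \<le> d \<longrightarrow>
        \<bar>X (2 ^ k * s) \<omega> - X (2 ^ k * t) \<omega>\<bar> \<le> e' * norming (2 ^ k)" "r \<le> 2 ^ k" "2 ^ k \<le> 2 * r"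
      by auto
    define x where "x = r / 2 ^ k"
    have x: "0 \<le> x" "x \<le> 1" "2 ^ k * x = r" using k(2) elim(3) by (auto simp: x_def)
    have "norming (2 ^ k) \<le> 2 powr H * 2 * norming r"
      using elim(2) k(2,3) by auto
    then have "e' * norming (2 ^ k) \<le> e' * (2 powr H * 2 * norming r)"
      using e' by (intro mult_left_mono) auto
    also have "\<dots> = e * norming r" by (simp add: e'_def)
    finally have le: "e' * norming (2 ^ k) \<le> e * norming r" .
    show ?case
    proof (intro ballI impI)
      fix s t assume st: "s \<in> {0..T}" "t \<in> {0..T}" "\<bar>s - t\<bar> \<le> d"
      have in_T: "x * u \<in> {0..T}" if "u \<in> {0..T}" for u
        using that x mult_mono[of x 1 u T] by auto
      have "\<bar>x * s - x * t\<bar> = x * \<bar>s - t\<bar>"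
        using x by (simp add: right_diff_distrib[symmetric] abs_mult)
      also have "\<dots> \<le> 1 * \<bar>s - t\<bar>" using x by (intro mult_right_mono) auto
      finally have "\<bar>X (2 ^ k * (x * s)) \<omega> - X (2 ^ k * (x * t)) \<omega>\<bar> \<le> e' * norming (2 ^ k)"
        using k(1) in_T[OF st(1)] in_T[OF st(2)] st(3) by auto
      then show "\<bar>X (r * s) \<omega> - X (r * t) \<omega>\<bar> \<le> e * norming r"
        using le by (simp add: mult.assoc[symmetric] x(3))
    qed
  qed
  with d show ?thesis by blast
qed

text \<open>With \<open>R = l ^ k\<close> just above \<open>r\<close>, time \<open>r * s\<close>
  equals \<open>R * (y * s)\<close> for some \<open>y\<close> between \<open>1 / l\<close> and 1, a
  displacement of at most \<open>T * (1 - 1 / l)\<close>. The modulus turns this into an error of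
  \<open>A * x\<close> normings. The order of choice is \<open>x\<close>, then \<open>d\<close>,
  then \<open>l\<close> close to 1.\<close>

lemma upper_all_scales:
  assumes modulus: "\<And>e. 0 < e \<Longrightarrow> \<exists>d>0. \<forall>\<^sub>F r in at_top. \<forall>s\<in>{0..T}. \<forall>t\<in>{0..T}. \<bar>s - t\<bar> \<le> d \<longrightarrow>
     \<bar>X (r * s) \<omega> - X (r * t) \<omega>\<bar> \<le> e * norming r"
    and a: "a \<in> coeffs_on {0..T}"
    and geometric: "\<And>j e. 0 < e \<Longrightarrow> \<forall>\<^sub>F k in sequentially.
      \<bar>coeff_lin a (\<lambda>s. X ((1 + 1 / real (Suc j)) ^ k * s) \<omega>)\<bar> \<le> (nrm a + e) * norming ((1 + 1 / real (Suc j)) ^ k)"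
    and e: "0 < e"
  shows "\<forall>\<^sub>F r in at_top. \<bar>coeff_lin a (\<lambda>s. X (r * s) \<omega>)\<bar> \<le> (nrm a + e) * norming r"
proof -
  define A where "A = (\<Sum>s | a s \<noteq> 0. \<bar>a s\<bar>)"
  have A: "A \<ge> 0" unfolding A_def by (intro sum_nonneg) simp
  \<comment> \<open>One factor \<open>1 + x\<close> bounds \<open>l powr H\<close>, the other is the
    constant \<open>c\<close> in \<open>norming_ratio\<close>; as \<open>x\<close> tends to 0 the
    whole expression tends to \<open>nrm a\<close>.\<close>
  obtain x where x: "0 < x" "(1 + x) * (1 + x) * (nrm a + x + A * x) < nrm a + e"
  proof -
    have inv: "(\<lambda>i. 1 / real (Suc i)) \<longlonglongrightarrow> 0" by real_asymp
    have "(\<lambda>i. (1 + 1 / real (Suc i)) * (1 + 1 / real (Suc i)) * (nrm a + 1 / real (Suc i) + A * (1 / real (Suc i))))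
        \<longlonglongrightarrow> (1 + 0) * (1 + 0) * (nrm a + 0 + A * 0)"
      by (intro tendsto_intros inv)
    then have "\<forall>\<^sub>F i in sequentially. (1 + 1 / real (Suc i)) * (1 + 1 / real (Suc i)) * (nrm a + 1 / real (Suc i) + A * (1 / real (Suc i))) < nrm a + e"
      using e by (intro order_tendstoD) auto
    then obtain i where "(1 + 1 / real (Suc i)) * (1 + 1 / real (Suc i)) * (nrm a + 1 / real (Suc i) + A * (1 / real (Suc i))) < nrm a + e"
      by (metis (mono_tags, lifting) eventually_sequentially order_refl)
    then show ?thesis by (intro that[of "1 / real (Suc i)"]) auto
  qed
  obtain d where d: "d > 0" and ev: "\<forall>\<^sub>F r in at_top. \<forall>s\<in>{0..T}. \<forall>t\<in>{0..T}. \<bar>s - t\<bar> \<le> d \<longrightarrow>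
     \<bar>X (r * s) \<omega> - X (r * t) \<omega>\<bar> \<le> x * norming r"
    using modulus[OF x(1)] by blast
  obtain j where j: "(1 + 1 / real (Suc j)) powr H < 1 + x" "T * (1 - 1 / (1 + 1 / real (Suc j))) < d"
  proof -
    have l: "(\<lambda>j. 1 + 1 / real (Suc j)) \<longlonglongrightarrow> 1" by real_asymp
    have "(\<lambda>j. (1 + 1 / real (Suc j)) powr H) \<longlonglongrightarrow> 1 powr H"
      by (intro tendsto_intros l) simp
    then have 1: "\<forall>\<^sub>F j in sequentially. (1 + 1 / real (Suc j)) powr H < 1 + x"
      using x(1) by (intro order_tendstoD) auto
    have "(\<lambda>j. T * (1 - 1 / (1 + 1 / real (Suc j)))) \<longlonglongrightarrow> T * (1 - 1 / 1)"
      by (intro tendsto_intros l) simp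
    then have "\<forall>\<^sub>F j in sequentially. T * (1 - 1 / (1 + 1 / real (Suc j))) < d"
      using d by (intro order_tendstoD) auto
    with 1 have "\<forall>\<^sub>F j in sequentially. (1 + 1 / real (Suc j)) powr H < 1 + x \<and> T * (1 - 1 / (1 + 1 / real (Suc j))) < d"
      by (rule eventually_conj)
    then show ?thesis
      using that by (metis (mono_tags, lifting) eventually_sequentially order_refl)
  qed
  define l where "l = 1 + 1 / real (Suc j)"
  have l: "1 < l" by (simp add: l_def)
  have "filterlim (\<lambda>k. l ^ k) at_top sequentially" using l by real_asymp
  from eventually_compose_filterlim[OF ev this]
  have "\<forall>\<^sub>F k in sequentially. (\<forall>s\<in>{0..T}. \<forall>t\<in>{0..T}. \<bar>s - t\<bar> \<le> d \<longrightarrow>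
      \<bar>X (l ^ k * s) \<omega> - X (l ^ k * t) \<omega>\<bar> \<le> x * norming (l ^ k)) \<and>
      \<bar>coeff_lin a (\<lambda>s. X (l ^ k * s) \<omega>)\<bar> \<le> (nrm a + x) * norming (l ^ k)"
    using geometric[OF x(1), of j] unfolding l_def by (rule eventually_conj)
  note bracket = power_bracket[OF l this]
  have "1 < 1 + x" using x(1) by simp
  from bracket norming_ratio[OF l this] eventually_gt_at_top[of 0] show ?thesis
  proof eventually_elim
    case (elim r)
    then obtain k where k: "\<forall>s\<in>{0..T}. \<forall>t\<in>{0..T}. \<bar>s - t\<bar> \<le> d \<longrightarrow>
        \<bar>X (l ^ k * s) \<omega> - X (l ^ k * t) \<omega>\<bar> \<le> x * norming (l ^ k)"
      "\<bar>coeff_lin a (\<lambda>s. X (l ^ k * s) \<omega>)\<bar> \<le> (nrm a + x) * norming (l ^ k)"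
      "r \<le> l ^ k" "l ^ k \<le> l * r"
      by blast
    define R where "R = l ^ k"
    have R: "0 < R" using l by (simp add: R_def)
    have N: "0 < norming R" "norming R \<le> l powr H * (1 + x) * norming r" "0 < norming r"
      using elim(2) k(3,4) by (auto simp: R_def)
    define y where "y = r / R"
    have y: "1 / l \<le> y" "0 \<le> y" "y \<le> 1" "R * y = r"
      using k(3,4) R l elim(3) by (auto simp: y_def R_def field_simps)
    have step: "\<bar>X (r * s) \<omega> - X (R * s) \<omega>\<bar> \<le> x * norming R" if s: "s \<in> {0..T}" for s
    proof -
      have "y * s \<in> {0..T}" using s y mult_mono[of y 1 s T] by auto
      moreover have "\<bar>y * s - s\<bar> = s * (1 - y)"
        using s y mult_right_mono[of y 1 s] by (simp add: abs_if algebra_simps)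
      moreover have "s * (1 - y) \<le> T * (1 - 1 / l)"
        using s y by (intro mult_mono) auto
      ultimately have "\<bar>X (R * (y * s)) \<omega> - X (R * s) \<omega>\<bar> \<le> x * norming R"
        using k(1) s j(2) unfolding R_def l_def by fastforce
      then show ?thesis by (simp add: mult.assoc[symmetric] y(4))
    qed
    have "coeff_lin a (\<lambda>s. X (r * s) \<omega>) - coeff_lin a (\<lambda>s. X (R * s) \<omega>) =
        (\<Sum>s | a s \<noteq> 0. a s * (X (r * s) \<omega> - X (R * s) \<omega>))"
      by (simp add: coeff_lin_def sum_subtractf[symmetric] right_diff_distrib)
    also have "\<bar>\<dots>\<bar> \<le> (\<Sum>s | a s \<noteq> 0. \<bar>a s\<bar> * (x * norming R))"
      using coeffs_onD(2)[OF a]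
      by (intro order_trans[OF sum_abs] sum_mono) (auto simp: abs_mult intro!: mult_left_mono step)
    also have "\<dots> = A * (x * norming R)"
      by (simp add: A_def sum_distrib_right)
    finally have "\<bar>coeff_lin a (\<lambda>s. X (r * s) \<omega>)\<bar> \<le> (nrm a + x) * norming R + A * (x * norming R)"
      using k(2) unfolding R_def by linarith
    also have "\<dots> = (nrm a + x + A * x) * norming R"
      by (simp add: algebra_simps)
    also have "\<dots> \<le> (nrm a + x + A * x) * (l powr H * (1 + x) * norming r)"
      using N(2) x(1) A nrm_nonneg[OF a] by (intro mult_left_mono) auto
    also have "\<dots> \<le> (nrm a + x + A * x) * ((1 + x) * (1 + x) * norming r)"
      using N(3) x(1) A nrm_nonneg[OF a] j(1) unfolding l_def
      by (intro mult_left_mono mult_right_mono) auto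
    also have "\<dots> = ((1 + x) * (1 + x) * (nrm a + x + A * x)) * norming r"
      by (simp add: mult_ac)
    also have "\<dots> \<le> (nrm a + e) * norming r"
      using x(2) N(3) by (intro mult_right_mono) auto
    finally show ?case .
  qed
qed

lemma lil_path_eq:
  assumes "t \<in> {0..T}"
  shows "lil_path T H X \<omega> n t = X (real n * t) \<omega> / norming (real n)"
proof -
  have "real n powr (2 * H) = (real n powr H)\<^sup>2"
    by (simp add: power2_eq_square flip: powr_add)
  then have "2 * real n powr (2 * H) * ln (ln (real n)) = (real n powr H)\<^sup>2 * (2 * ln (ln (real n)))"
    by simp
  then have "sqrt (2 * real n powr (2 * H) * ln (ln (real n))) = norming (real n)"
    unfolding norming_def by (simp only: real_sqrt_mult real_sqrt_abs) simp
  then show ?thesis using assms by (simp add: lil_path_def)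
qed

lemma X_zero: "AE \<omega> in M. X 0 \<omega> = 0"
proof -
  have [measurable]: "X 0 \<in> borel_measurable M" by (rule X_measurable) simp
  have "measure M {\<omega> \<in> space M. \<forall>i\<in>{()}. (\<Sum>k\<in>{()}. 1 * X 0 \<omega>) \<in> {0}} =
      prob {\<omega> \<in> space N. \<forall>i\<in>{()}. (\<Sum>k\<in>{()}. 1 * Y 0 \<omega>) \<in> {0}}"
    by (rule fdd_transfer) auto
  then have "measure M {\<omega> \<in> space M. X 0 \<omega> \<in> {0}} = prob {\<omega> \<in> space N. Y 0 \<omega> \<in> {0}}" by simp
  also have "\<dots> = 1"
    using wiener_null[OF wiener_Y[OF order_refl], of "{0}"] by (simp add: f_0)
  finally show ?thesis
    using M.prob_eq_1[of "{\<omega> \<in> space M. X 0 \<omega> \<in> {0}}"] by simp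
qed

theorem functional_lil:
  shows "AE \<omega> in M. (\<lambda>n. mdist_to_set (C_space T) (lil_path T H X \<omega> n) (rkhs_unit_ball \<Psi> {0..T})) \<longlonglongrightarrow> 0 \<and>
    cluster_set (C_space T) (lil_path T H X \<omega>) = rkhs_unit_ball \<Psi> {0..T}"
proof -
  \<comment> \<open>One null set for all rational functionals and all the ratios
    \<open>1 + 1 / Suc j\<close>; afterwards the path is fixed and the argument is
    deterministic.\<close>
  have up: "AE \<omega> in M. \<forall>a\<in>rat_coeffs. \<forall>j. \<forall>e>0. \<forall>\<^sub>F k in sequentially.
      \<bar>coeff_lin a (\<lambda>s. X ((1 + 1 / real (Suc j)) ^ k * s) \<omega>)\<bar> \<le> (nrm a + e) * norming ((1 + 1 / real (Suc j)) ^ k)"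
    unfolding AE_ball_countable[OF countable_rat_coeffs] AE_all_countable
    by (intro ballI allI lil_upper rat_coeffs_subset) auto
  have low: "AE \<omega> in M. \<forall>a\<in>{a \<in> rat_coeffs. 0 < nrm a}. \<forall>e>0. \<exists>\<^sub>F n in sequentially.
      (nrm a - e) * norming (real n) \<le> coeff_lin a (\<lambda>s. X (real n * s) \<omega>)"
  proof (subst AE_ball_countable)
    show "countable {a \<in> rat_coeffs. 0 < nrm a}"
      by (rule countable_subset[OF _ countable_rat_coeffs]) auto
  qed (auto intro: lil_lower rat_coeffs_subset)
  from AE_space lil_modulus up low X_zero show ?thesis
  proof eventually_elim
    case (elim \<omega>)
    define z where "z = lil_path T H X \<omega>"
    have z: "z n t = X (real n * t) \<omega> / norming (real n)" if "t \<in> {0..T}" for n t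
      unfolding z_def by (rule lil_path_eq[OF that])
    have lin_z: "coeff_lin a (z n) = coeff_lin a (\<lambda>s. X (real n * s) \<omega>) / norming (real n)" if "a \<in> rat_coeffs" for a n
      unfolding coeff_lin_def sum_divide_distrib
      using coeffs_onD(2)[OF rat_coeffs_subset[OF that]] by (intro sum.cong refl) (simp add: z)
    note modulus = modulus_all_scales[OF elim(2)]
    have pos: "\<forall>\<^sub>F n in sequentially. 0 < norming (real n)"
      using eventually_compose_filterlim[OF eventually_gt_at_top[of "exp 1"] filterlim_real_sequentially]
      by eventually_elim (rule norming_pos)
    have ext: "z n \<in> extensional {0..T}" for n by (simp add: z_def lil_path_def)
    have cont: "continuous_on {0..T} (z n)" for n
    proof -
      have "continuous_on {0..T} (\<lambda>t. X (real n * t) \<omega>)"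
        by (rule continuous_on_compose2[OF X_continuous[OF elim(1)]]) (auto intro!: continuous_intros)
      then have "continuous_on {0..T} (\<lambda>t. X (real n * t) \<omega> * (1 / norming (real n)))"
        by (intro continuous_intros)
      then show ?thesis by (rule continuous_on_eq) (simp add: z)
    qed
    have z0: "z n 0 = 0" for n using z[of 0 n] T elim(5) by simp
    have equi: "\<exists>d>0. \<forall>\<^sub>F n in sequentially. \<forall>s\<in>{0..T}. \<forall>t\<in>{0..T}. \<bar>s - t\<bar> \<le> d \<longrightarrow> \<bar>z n s - z n t\<bar> \<le> e"
      if e: "e > 0" for e
    proof -
      obtain d where d: "d > 0" and ev: "\<forall>\<^sub>F r in at_top. \<forall>s\<in>{0..T}. \<forall>t\<in>{0..T}. \<bar>s - t\<bar> \<le> d \<longrightarrow>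
          \<bar>X (r * s) \<omega> - X (r * t) \<omega>\<bar> \<le> e * norming r"
        using modulus[OF e] by blast
      have "\<forall>\<^sub>F n in sequentially. \<forall>s\<in>{0..T}. \<forall>t\<in>{0..T}. \<bar>s - t\<bar> \<le> d \<longrightarrow> \<bar>z n s - z n t\<bar> \<le> e"
        using eventually_compose_filterlim[OF ev filterlim_real_sequentially] pos
        by eventually_elim (simp add: z diff_divide_distrib[symmetric] abs_divide pos_divide_le_eq)
      with d show ?thesis by blast
    qed
    have upper: "\<forall>\<^sub>F n in sequentially. \<bar>coeff_lin a (z n)\<bar> \<le> nrm a + e" if a: "a \<in> rat_coeffs" and e: "0 < e" for a e
    proof -
      have "\<forall>\<^sub>F r in at_top. \<bar>coeff_lin a (\<lambda>s. X (r * s) \<omega>)\<bar> \<le> (nrm a + e) * norming r"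
        using elim(3) a by (intro upper_all_scales[OF modulus rat_coeffs_subset[OF a] _ e]) auto
      from eventually_compose_filterlim[OF this filterlim_real_sequentially] pos show ?thesis
        by eventually_elim (simp add: lin_z[OF a] abs_divide pos_divide_le_eq)
    qed
    have lower: "\<exists>\<^sub>F n in sequentially. nrm a - e \<le> coeff_lin a (z n)"
      if a: "a \<in> rat_coeffs" "0 < nrm a" and e: "0 < e" for a e
    proof -
      have "\<exists>\<^sub>F n in sequentially. (nrm a - e) * norming (real n) \<le> coeff_lin a (\<lambda>s. X (real n * s) \<omega>)"
        using elim(4) a e by blast
      moreover have "\<forall>\<^sub>F n in sequentially. (nrm a - e) * norming (real n) \<le> coeff_lin a (\<lambda>s. X (real n * s) \<omega>) \<longrightarrow>
          nrm a - e \<le> coeff_lin a (z n)"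
        using pos by eventually_elim (simp add: lin_z[OF a(1)] pos_le_divide_eq)
      ultimately show ?thesis by (rule frequently_rev_mp)
    qed
    note A = ext cont z0 equi upper lower
    show ?case
      unfolding z_def[symmetric] using dist_tendsto[of z, OF A] cluster_eq[of z, OF A] by blast
  qed
qed

end

theorem theorem5p1:
  fixes T \<alpha> \<gamma> H :: real
    and M :: "'a measure" and X :: "real \<Rightarrow> 'a \<Rightarrow> real"
    and N :: "'b measure" and B :: "real set \<Rightarrow> 'b \<Rightarrow> real"
    and \<Psi> :: "real \<Rightarrow> real \<Rightarrow> real" and K :: "(real \<Rightarrow> real) set"
  assumes "T > 0"
    and "0 \<le> \<gamma>" and "\<gamma> < 1"
    and "- 1 / 2 + \<gamma> / 2 < \<alpha>" and "\<alpha> < 1 / 2 + \<gamma> / 2"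
    and "H = \<alpha> - \<gamma> / 2 + 1 / 2"
    and "gfbm \<alpha> \<gamma> N B M X"
    and "\<Psi> = covariance_fun M X"
    and "K = rkhs_unit_ball \<Psi> {0..T}"
  shows "(AE \<omega> in M. (\<lambda>n. mdist_to_set (C_space T) (lil_path T H X \<omega> n) K) \<longlonglongrightarrow> 0) \<and>
         (AE \<omega> in M. cluster_set (C_space T) (lil_path T H X \<omega>) = K)"
proof -
  from \<open>gfbm \<alpha> \<gamma> N B M X\<close> have g: "gaussian_random_measure N B" "prob_space M"
      "\<And>t. 0 \<le> t \<Longrightarrow> X t \<in> borel_measurable M"
      "\<And>\<omega>. \<omega> \<in> space M \<Longrightarrow> continuous_on {0..} (\<lambda>t. X t \<omega>)"
    unfolding gfbm_def by blast+
  from \<open>gfbm \<alpha> \<gamma> N B M X\<close> obtain I where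
    I: "\<And>t. 0 \<le> t \<Longrightarrow> is_wiener_integral N B (gfbm_kernel \<alpha> \<gamma> t) (I t)"
      "same_fdd {0..} M X N (\<lambda>t \<omega>. gfbm_const \<alpha> \<gamma> * I t \<omega>)"
    unfolding gfbm_def by blast
  have "gfbm_process N B T \<alpha> \<gamma> H M X I"
  proof (intro gfbm_process.intro gaussian_measure.intro gfbm_process_axioms.intro)
    show "0 < H" using assms(4,6) by simp
  qed (fact assms g I)+
  then interpret gfbm_process N B T \<alpha> \<gamma> H M X I .
  show ?thesis
    unfolding assms(8,9) AE_conj_iff[symmetric] by (rule functional_lil)
qed

end
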